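(* For each positive integer $k$ with $1\le k\le n-1$, there exists a unique $U(n)$-invariant (shrinking) Kähler-Ricci soliton on the total space $M_k$ of the projective line bundle $\mathbb{P}(L^k\oplus L^{-k})\to\mathbb{P}^{n-1}$, where $L$ is the hyperplane bundle over the complex projective space $\mathbb{P}^{n-1}$.
   Context: A (shrinking) Kähler-Ricci soliton on a compact complex manifold $M$ here means a gradient one for the normalized Kähler-Ricci flow $\partial_t g_{i\bar j}=-R_{i\bar j}+g_{i\bar j}$: a Kähler metric $g=(g_{i\bar j})$ for which there is a smooth real-valued function $f$ on $M$ with $R_{i\bar j}-g_{i\bar j}=f_{,i\bar j}$ and $f_{,ij}=0$, where $R_{i\bar j}=-\partial_i\partial_{\bar j}\log\det(g_{k\bar l})$ is the Ricci tensor and commas denote covariant derivatives with respect to $g$. The bundle $M_k\to\mathbb{P}^{n-1}$ is taken with the following transition functions. Let $z_1,\dots,z_n$ be homogeneous coordinates on $\mathbb{P}^{n-1}$ and $U_j=\{z_j\ne 0\}$; the pieces over $U_j$, with fibre coordinates $y_j\in\mathbb{P}^1=\mathbb{C}\cup\{\infty\}$, are glued by $y_i=(z_i/z_j)^k y_j$ over $U_i\cap U_j$. Let $S_0=\{y_j=0\}$ and $S_\infty=\{y_j=\infty\}$. The complement $M_k\setminus(S_0\cup S_\infty)$ is parametrized by the $k$-to-one map $\mathbb{C}^n\setminus\{0\}\to M_k\setminus(S_0\cup S_\infty)$, $(z_1,\dots,z_n)\mapsto\big((z_i/z_j)_{i\ne j};\,y_j=z_j^k\big)$ (where $z_j\ne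 0$). The standard action of the unitary group $U(n)$ on $\mathbb{C}^n\setminus\{0\}$ induces an action of $U(n)$ on $M_k$ by automorphisms; $U(n)$-invariance of a metric refers to this action.
   Formalization: "Unique" is proved as unique up to biholomorphisms of M_k commuting with U(n): the metric itself is not unique, since pulling back by a fibre dilation y_j -> c y_j (c>0, c≠1) gives a different U(n)-invariant soliton. *)

theory Defs
  imports "HOL-Analysis.Analysis"
begin

section \<open>Calculus in a coordinate chart\<close>

text \<open>
  Iterated directional derivatives (in real directions). A map is \<open>C\<^sup>\<infinity>\<close> on the whole space iff all
  of them are everywhere (real) Frechet differentiable.
\<close>

primrec iterated_deriv ::
  "'a::real_normed_vector list \<Rightarrow> ('a \<Rightarrow> 'b::real_normed_vector) \<Rightarrow> 'a \<Rightarrow> 'b" where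
  "iterated_deriv [] F = F"
| "iterated_deriv (v # vs) F = (\<lambda>x. frechet_derivative (iterated_deriv vs F) (at x) v)"

definition smooth :: "('a::real_normed_vector \<Rightarrow> 'b::real_normed_vector) \<Rightarrow> bool" where
  "smooth F \<longleftrightarrow> (\<forall>vs x. iterated_deriv vs F differentiable (at x))"

text \<open>The Wirtinger operators \<open>\<partial>/\<partial>z\<^sub>i\<close> and \<open>\<partial>/\<partial>\<close>\<open>z\<^sub>i\<close>-bar on complex coordinate space.\<close>

definition wirt :: "'n \<Rightarrow> (complex^'n \<Rightarrow> complex) \<Rightarrow> complex^'n \<Rightarrow> complex" where
  "wirt i F x = (frechet_derivative F (at x) (axis i 1)
                  - \<i> * frechet_derivative F (at x) (axis i \<i>)) / 2"

definition wirt_bar :: "'n \<Rightarrow> (complex^'n \<Rightarrow> complex) \<Rightarrow> complex^'n \<Rightarrow> complex" where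
  "wirt_bar i F x = (frechet_derivative F (at x) (axis i 1)
                      + \<i> * frechet_derivative F (at x) (axis i \<i>)) / 2"

definition complex_differentiable_at ::
  "(complex^'n \<Rightarrow> complex^'m) \<Rightarrow> complex^'n \<Rightarrow> bool" where
  "complex_differentiable_at T x \<longleftrightarrow>
     (\<exists>D. (T has_derivative D) (at x) \<and> (\<forall>a v. D (a *s v) = a *s D v))"

text \<open>
  In the following three definitions \<open>G x $ i $ j\<close> is the component \<open>g\<^sub>i\<^sub>j\<close> of a Hermitian metric with
  \<open>i\<close> the holomorphic and \<open>j\<close> the antiholomorphic (barred) index. Correspondingly, the component of
  the inverse metric with holomorphic upper index \<open>m\<close> and barred upper index \<open>l\<close> is
  \<open>matrix_inv (G x) $ l $ m\<close>, and the only Christoffel symbols of a Kaehler metric without barred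
  indices are as in \<open>christoffel G m i j\<close> (upper index \<open>m\<close>).
\<close>

definition pos_def_hermitian :: "complex^'n^'n \<Rightarrow> bool" where
  "pos_def_hermitian G \<longleftrightarrow>
     (\<forall>i j. G $ j $ i = cnj (G $ i $ j)) \<and>
     (\<forall>v. v \<noteq> 0 \<longrightarrow> 0 < Re (\<Sum>i\<in>UNIV. \<Sum>j\<in>UNIV. G $ i $ j * v $ i * cnj (v $ j)))"

definition ricci :: "(complex^'n \<Rightarrow> complex^'n^'n) \<Rightarrow> 'n \<Rightarrow> 'n \<Rightarrow> complex^'n \<Rightarrow> complex" where
  "ricci G i j x = - wirt i (wirt_bar j (\<lambda>u. Ln (det (G u)))) x"

definition christoffel ::
  "(complex^'n \<Rightarrow> complex^'n^'n) \<Rightarrow> 'n \<Rightarrow> 'n \<Rightarrow> 'n \<Rightarrow> complex^'n \<Rightarrow> complex" where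
  "christoffel G m i j x =
     (\<Sum>l\<in>UNIV. matrix_inv (G x) $ l $ m * wirt i (\<lambda>u. G u $ j $ l) x)"

text \<open>
  The second covariant derivatives of a function. For mixed indices no Christoffel symbol enters.
\<close>

definition hess_mixed :: "(complex^'n \<Rightarrow> complex) \<Rightarrow> 'n \<Rightarrow> 'n \<Rightarrow> complex^'n \<Rightarrow> complex" where
  "hess_mixed F i j x = wirt i (wirt_bar j F) x"

definition hess_pure ::
  "(complex^'n \<Rightarrow> complex^'n^'n) \<Rightarrow> (complex^'n \<Rightarrow> complex) \<Rightarrow> 'n \<Rightarrow> 'n \<Rightarrow> complex^'n \<Rightarrow> complex"
  where
  "hess_pure G F i j x =
     wirt i (wirt j F) x - (\<Sum>m\<in>UNIV. christoffel G m i j x * wirt m F x)"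


section \<open>Complex manifolds, Kaehler metrics and solitons\<close>

text \<open>
  An atlas is a set of inverse charts. It suffices here to consider atlases whose inverse charts are
  all defined on the whole of the coordinate space.
\<close>

type_synonym ('n, 'p) atlas = "(complex^'n \<Rightarrow> 'p) set"

definition holomorphic_map :: "('n::finite, 'p) atlas \<Rightarrow> ('p \<Rightarrow> 'p) \<Rightarrow> bool" where
  "holomorphic_map A F \<longleftrightarrow>
     (\<forall>c\<in>A. \<forall>d\<in>A. open {x. F (c x) \<in> range d} \<and>
        (\<forall>x. F (c x) \<in> range d \<longrightarrow> complex_differentiable_at (inv d \<circ> F \<circ> c) x))"

definition complex_atlas :: "'p set \<Rightarrow> ('n::finite, 'p) atlas \<Rightarrow> bool" where
  "complex_atlas M A \<longleftrightarrow> (\<Union>c\<in>A. range c) = M \<and> (\<forall>c\<in>A. inj c) \<and> holomorphic_map A id"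

definition automorphism :: "'p set \<Rightarrow> ('n::finite, 'p) atlas \<Rightarrow> ('p \<Rightarrow> 'p) \<Rightarrow> bool" where
  "automorphism M A F \<longleftrightarrow>
     bij_betw F M M \<and> holomorphic_map A F \<and> holomorphic_map A (inv_into M F)"

text \<open>
  A Hermitian tensor field is given by its components \<open>g c x $ i $ j\<close> with respect to every chart.
  The relation \<open>is_pullback A F g h\<close> says that \<open>h\<close> is the pullback of \<open>g\<close> under the holomorphic map
  \<open>F\<close>; for \<open>F = id\<close> and \<open>h = g\<close> it is the transformation law making \<open>g\<close> a tensor field.
\<close>

type_synonym ('n, 'p) tensor_field = "(complex^'n \<Rightarrow> 'p) \<Rightarrow> complex^'n \<Rightarrow> complex^'n^'n"

definition is_pullback ::
  "('n::finite, 'p) atlas \<Rightarrow> ('p \<Rightarrow> 'p) \<Rightarrow> ('n, 'p) tensor_field \<Rightarrow> ('n, 'p) tensor_field \<Rightarrow> bool" where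
  "is_pullback A F g h \<longleftrightarrow>
     (\<forall>c\<in>A. \<forall>d\<in>A. \<forall>x. F (c x) \<in> range d \<longrightarrow>
        (let T = inv d \<circ> F \<circ> c in
         \<forall>i j. h c x $ i $ j =
           (\<Sum>a\<in>UNIV. \<Sum>b\<in>UNIV.
              wirt i (\<lambda>u. T u $ a) x * cnj (wirt j (\<lambda>u. T u $ b) x) * g d (T x) $ a $ b)))"

definition kahler_metric :: "('n::finite, 'p) atlas \<Rightarrow> ('n, 'p) tensor_field \<Rightarrow> bool" where
  "kahler_metric A g \<longleftrightarrow>
     is_pullback A id g g \<and>
     (\<forall>c\<in>A. smooth (g c) \<and>
        (\<forall>x. pos_def_hermitian (g c x)) \<and>
        (\<forall>x i j m. wirt m (\<lambda>u. g c u $ i $ j) x = wirt i (\<lambda>u. g c u $ m $ j) x))"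

definition kahler_ricci_soliton :: "('n::finite, 'p) atlas \<Rightarrow> ('n, 'p) tensor_field \<Rightarrow> bool" where
  "kahler_ricci_soliton A g \<longleftrightarrow>
     kahler_metric A g \<and>
     (\<exists>f :: 'p \<Rightarrow> real. \<forall>c\<in>A. smooth (f \<circ> c) \<and>
        (\<forall>x i j.
           ricci (g c) i j x - g c x $ i $ j = hess_mixed (\<lambda>u. complex_of_real (f (c u))) i j x \<and>
           hess_pure (g c) (\<lambda>u. complex_of_real (f (c u))) i j x = 0))"


section \<open>The projective line bundle\<close>

text \<open>
  \<open>homog z\<close> is the point of projective space with homogeneous coordinates \<open>z\<close>, and \<open>complex option\<close>
  is the projective line, with \<open>None\<close> in the role of \<open>\<infinity>\<close>.
\<close>

definition homog :: "complex^'n \<Rightarrow> (complex^'n) set" where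
  "homog z = {a *s z | a. a \<noteq> 0}"

type_synonym 'n piece_point = "'n \<times> (complex^'n) set \<times> complex option"

definition pieces :: "'n::finite piece_point set" where
  "pieces = {(j, homog z, y) | j z y. z $ j \<noteq> 0}"

text \<open>Since \<open>a \<noteq> 0\<close> wherever it is used, \<open>sphere_scale a\<close> correctly fixes \<open>\<infinity>\<close>.\<close>

definition sphere_scale :: "complex \<Rightarrow> complex option \<Rightarrow> complex option" where
  "sphere_scale a = map_option ((*) a)"

definition glue :: "nat \<Rightarrow> ('n::finite piece_point \<times> 'n piece_point) set" where
  "glue k = {((j, homog z, y), (i, homog z, sphere_scale ((z $ i / z $ j) ^ k) y)) | i j z y.
               z $ i \<noteq> 0 \<and> z $ j \<noteq> 0}"

definition Mk :: "nat \<Rightarrow> 'n::finite piece_point set set" where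
  "Mk k = pieces // glue k"

definition Mk_point :: "nat \<Rightarrow> 'n::finite \<Rightarrow> complex^'n \<Rightarrow> complex option \<Rightarrow> 'n piece_point set" where
  "Mk_point k j z y = glue k `` {(j, homog z, y)}"

text \<open>
  The standard inverse charts: over \<open>z\<^sub>j \<noteq> 0\<close> the base coordinates are \<open>z\<^sub>i / z\<^sub>j\<close> for \<open>i \<noteq> j\<close>, and the
  remaining \<open>j\<close>-th coordinate is the fibre coordinate \<open>y\<^sub>j\<close> (away from \<open>\<infinity>\<close>) or \<open>1 / y\<^sub>j\<close> (away from \<open>0\<close>).
\<close>

definition sphere_recip :: "complex \<Rightarrow> complex option" where
  "sphere_recip u = (if u = 0 then None else Some (1 / u))"

definition affine_lift :: "'n \<Rightarrow> complex^'n \<Rightarrow> complex^'n" where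
  "affine_lift j x = (\<chi> i. if i = j then 1 else x $ i)"

definition Mk_chart ::
  "nat \<Rightarrow> (complex \<Rightarrow> complex option) \<Rightarrow> 'n \<Rightarrow> complex^'n \<Rightarrow> 'n piece_point set" where
  "Mk_chart k e j x = Mk_point k j (affine_lift j x) (e (x $ j))"

definition Mk_atlas :: "nat \<Rightarrow> ('n::finite, 'n piece_point set) atlas" where
  "Mk_atlas k = {Mk_chart k e j | e j. e \<in> {Some, sphere_recip}}"

definition unitary_matrix :: "complex^'n^'n \<Rightarrow> bool" where
  "unitary_matrix U \<longleftrightarrow>
     (\<chi> i j. cnj (U $ j $ i)) ** U = mat 1 \<and> U ** (\<chi> i j. cnj (U $ j $ i)) = mat 1"

text \<open>
  The action of a matrix \<open>U\<close> on a point, i.e. on an equivalence class \<open>P\<close>. See \<open>Mk_act_point\<close> and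
  \<open>Mk_act_cover\<close> below: it extends the standard action on \<open>z \<noteq> 0\<close>, where \<open>y\<^sub>j = z\<^sub>j\<^sup>k\<close>, across the zero
  and infinity sections.
\<close>

definition Mk_act :: "nat \<Rightarrow> complex^'n^'n \<Rightarrow> 'n piece_point set \<Rightarrow> 'n piece_point set" where
  "Mk_act k U P =
     {(i, homog (U *v z), sphere_scale (((U *v z) $ i / z $ j) ^ k) y) | i j z y.
        (j, homog z, y) \<in> P \<and> z $ j \<noteq> 0 \<and> (U *v z) $ i \<noteq> 0}"

definition unitary_invariant :: "nat \<Rightarrow> ('n::finite, 'n piece_point set) tensor_field \<Rightarrow> bool" where
  "unitary_invariant k g \<longleftrightarrow>
     (\<forall>U. unitary_matrix U \<longrightarrow> is_pullback (Mk_atlas k) (Mk_act k U) g g)"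

definition unitary_equivariant ::
  "nat \<Rightarrow> ('n::finite piece_point set \<Rightarrow> 'n piece_point set) \<Rightarrow> bool" where
  "unitary_equivariant k F \<longleftrightarrow>
     (\<forall>U. unitary_matrix U \<longrightarrow> (\<forall>P\<in>Mk k. F (Mk_act k U P) = Mk_act k U (F P)))"


lemma sphere_scale_simps: "sphere_scale a None = None" "sphere_scale a (Some y) = Some (a * y)"
  by (simp_all add: sphere_scale_def)

lemma sphere_scale_scale: "sphere_scale a (sphere_scale b y) = sphere_scale (a * b) y"
  by (cases y) (simp_all add: sphere_scale_simps)

lemma sphere_scale_1: "sphere_scale 1 y = y"
  by (cases y) (simp_all add: sphere_scale_simps)

lemma homog_eq_iff: "homog z = homog w \<longleftrightarrow> (\<exists>a. a \<noteq> 0 \<and> w = a *s z)"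
proof
  assume "homog z = homog w"
  moreover have "w \<in> homog w"
    unfolding homog_def by (rule CollectI, rule exI[of _ 1]) simp
  ultimately show "\<exists>a. a \<noteq> 0 \<and> w = a *s z"
    by (auto simp: homog_def)
next
  assume "\<exists>a. a \<noteq> 0 \<and> w = a *s z"
  then obtain a where a: "a \<noteq> 0" "w = a *s z" by blast
  show "homog z = homog w"
  proof
    show "homog w \<subseteq> homog z"
      using a by (force simp: homog_def vector_smult_assoc)
    show "homog z \<subseteq> homog w"
    proof
      fix v assume "v \<in> homog z"
      then obtain b where b: "b \<noteq> 0" "v = b *s z" by (auto simp: homog_def)
      then have "v = (b / a) *s w" "b / a \<noteq> 0" using a by (auto simp: vector_smult_assoc)
      then show "v \<in> homog w" by (auto simp: homog_def)
    qed
  qed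
qed

lemma glue_iff:
  assumes "z $ j \<noteq> 0" "w $ i \<noteq> 0"
  shows "((j, homog z, y), (i, homog w, y')) \<in> glue k \<longleftrightarrow>
    homog z = homog w \<and> z $ i \<noteq> 0 \<and> y' = sphere_scale ((z $ i / z $ j) ^ k) y"
proof
  assume "((j, homog z, y), (i, homog w, y')) \<in> glue k"
  then obtain u where u: "homog z = homog u" "homog w = homog u" "u $ i \<noteq> 0"
      "y' = sphere_scale ((u $ i / u $ j) ^ k) y"
    by (auto simp: glue_def)
  moreover obtain a where "a \<noteq> 0" "u = a *s z" using u homog_eq_iff by metis
  ultimately show "homog z = homog w \<and> z $ i \<noteq> 0 \<and> y' = sphere_scale ((z $ i / z $ j) ^ k) y"
    by auto
next
  assume R: "homog z = homog w \<and> z $ i \<noteq> 0 \<and> y' = sphere_scale ((z $ i / z $ j) ^ k) y"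
  then show "((j, homog z, y), (i, homog w, y')) \<in> glue k"
    using assms unfolding glue_def by fastforce
qed

lemma equiv_glue: "equiv (pieces :: 'n::finite piece_point set) (glue k)" (is "equiv ?A ?r")
proof (rule equivI)
  show "?r \<subseteq> ?A \<times> ?A" by (auto simp: glue_def pieces_def)
  show "refl_on ?A ?r"
    by (rule refl_onI) (auto simp: pieces_def glue_iff sphere_scale_1)
  show "sym ?r"
  proof (rule symI)
    fix p q :: "'n piece_point" assume "(p, q) \<in> ?r"
    then obtain i j z y where "z $ i \<noteq> 0" "z $ j \<noteq> 0" "p = (j, homog z, y)"
        "q = (i, homog z, sphere_scale ((z $ i / z $ j) ^ k) y)"
      by (auto simp: glue_def)
    then show "(q, p) \<in> glue k"
      by (simp add: glue_iff sphere_scale_scale sphere_scale_1 flip: power_mult_distrib)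
  qed
  show "trans ?r"
  proof (rule transI)
    fix p q r :: "'n piece_point" assume pq: "(p, q) \<in> glue k" and "(q, r) \<in> glue k"
    then obtain i l w y' where w: "w $ l \<noteq> 0" "w $ i \<noteq> 0" "q = (i, homog w, y')"
        "r = (l, homog w, sphere_scale ((w $ l / w $ i) ^ k) y')"
      by (auto simp: glue_def)
    from pq obtain j z y where z: "z $ j \<noteq> 0" "p = (j, homog z, y)"
      by (auto simp: glue_def)
    with pq w have *: "homog z = homog w" "z $ i \<noteq> 0" "y' = sphere_scale ((z $ i / z $ j) ^ k) y"
      by (simp_all add: glue_iff)
    then obtain a where a: "a \<noteq> 0" "w = a *s z" using homog_eq_iff by metis
    then have "z $ l \<noteq> 0" using w by auto
    then show "(p, r) \<in> glue k"
      using w z * a by (simp add: glue_iff sphere_scale_scale flip: power_mult_distrib)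
  qed
qed

lemma Mk_point_eq_iff:
  assumes "z $ j \<noteq> 0" "w $ i \<noteq> 0"
  shows "Mk_point k j z y = Mk_point k i w y' \<longleftrightarrow>
    homog z = homog w \<and> z $ i \<noteq> 0 \<and> y' = sphere_scale ((z $ i / z $ j) ^ k) y"
proof -
  have "(j, homog z, y) \<in> pieces" "(i, homog w, y') \<in> pieces"
    using assms by (auto simp: pieces_def)
  from eq_equiv_class_iff[OF equiv_glue this] show ?thesis
    using glue_iff[OF assms] by (simp add: Mk_point_def)
qed

lemma Mk_eq: "Mk k = {Mk_point k j z y | j z y. z $ j \<noteq> 0}"
  unfolding Mk_def pieces_def quotient_def Mk_point_def by blast

lemma mem_Mk_point_iff:
  assumes "z $ j \<noteq> 0" "w $ i \<noteq> 0"
  shows "(i, homog w, y') \<in> Mk_point k j z y \<longleftrightarrow>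
    homog z = homog w \<and> z $ i \<noteq> 0 \<and> y' = sphere_scale ((z $ i / z $ j) ^ k) y"
  using glue_iff[OF assms] by (simp add: Mk_point_def)

lemma Mk_act_point:
  assumes "z $ j \<noteq> 0" "(U *v z) $ i \<noteq> 0"
  shows "Mk_act k U (Mk_point k j z y) =
    Mk_point k i (U *v z) (sphere_scale (((U *v z) $ i / z $ j) ^ k) y)" (is "?L = ?R")
proof
  show "?L \<subseteq> ?R"
  proof
    fix q assume "q \<in> ?L"
    then obtain i' j' w y' where q: "q = (i', homog (U *v w), sphere_scale (((U *v w) $ i' / w $ j') ^ k) y')"
        "(j', homog w, y') \<in> Mk_point k j z y" "w $ j' \<noteq> 0" "(U *v w) $ i' \<noteq> 0"
      unfolding Mk_act_def by blast
    then have *: "homog z = homog w" "z $ j' \<noteq> 0" "y' = sphere_scale ((z $ j' / z $ j) ^ k) y"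
      using assms by (simp_all add: mem_Mk_point_iff)
    then obtain a where a: "a \<noteq> 0" "w = a *s z" using homog_eq_iff by metis
    then have Uw: "U *v w = a *s (U *v z)" by (simp add: vec.scale)
    then have "homog (U *v z) = homog (U *v w)" using a homog_eq_iff by blast
    then show "q \<in> ?R"
      using q * assms a Uw
      by (simp add: mem_Mk_point_iff sphere_scale_scale flip: power_mult_distrib)
  qed
  show "?R \<subseteq> ?L"
  proof
    fix q assume "q \<in> ?R"
    then have "((i, homog (U *v z), sphere_scale (((U *v z) $ i / z $ j) ^ k) y), q) \<in> glue k"
      by (simp add: Mk_point_def)
    moreover from this obtain l w y' where q: "q = (l, homog w, y')" "w $ l \<noteq> 0"
      by (auto simp: glue_def)
    ultimately have *: "homog (U *v z) = homog w" "(U *v z) $ l \<noteq> 0"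
        "y' = sphere_scale (((U *v z) $ l / (U *v z) $ i) ^ k)
                (sphere_scale (((U *v z) $ i / z $ j) ^ k) y)"
      using assms by (simp_all add: glue_iff)
    then have "q = (l, homog (U *v z), sphere_scale (((U *v z) $ l / z $ j) ^ k) y)"
      using q assms by (simp add: sphere_scale_scale flip: power_mult_distrib)
    moreover have "(j, homog z, y) \<in> Mk_point k j z y"
      using assms by (simp add: mem_Mk_point_iff sphere_scale_1)
    ultimately show "q \<in> ?L" using assms * unfolding Mk_act_def by blast
  qed
qed

lemma Mk_act_cover:
  assumes "z $ j \<noteq> 0" "(U *v z) $ i \<noteq> 0"
  shows "Mk_act k U (Mk_point k j z (Some ((z $ j) ^ k))) =
    Mk_point k i (U *v z) (Some (((U *v z) $ i) ^ k))"
  using assms by (simp add: Mk_act_point sphere_scale_simps power_divide)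


lemma Mk_act_in_Mk:
  assumes "unitary_matrix U" "P \<in> Mk k"
  shows "Mk_act k U P \<in> Mk k"
proof -
  from assms(2) obtain j z y where P: "P = Mk_point k j z y" "z $ j \<noteq> 0"
    by (auto simp: Mk_eq)
  have "U *v z \<noteq> 0"
  proof
    assume "U *v z = 0"
    then have "mat 1 *v z = 0"
      using assms(1) unfolding unitary_matrix_def by (metis matrix_vector_mul_assoc matrix_vector_mult_0_right)
    then show False using P by simp
  qed
  then obtain i where "(U *v z) $ i \<noteq> 0" by (auto simp: vec_eq_iff)
  with P show ?thesis by (auto simp: Mk_act_point Mk_eq)
qed

definition cdiff :: "(complex^'n \<Rightarrow> complex) \<Rightarrow> complex^'n \<Rightarrow> bool" where
  "cdiff f x \<longleftrightarrow> (\<exists>D. (f has_derivative D) (at x) \<and> (\<forall>a v. D (a *s v) = a * D v))"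

lemma cdiff_const: "cdiff (\<lambda>_. c) x"
  unfolding cdiff_def by (rule exI[of _ "\<lambda>_. 0"]) auto

lemma cdiff_nth: "cdiff (\<lambda>x. x $ i) x"
  unfolding cdiff_def
  by (rule exI[of _ "\<lambda>x. x $ i"])
     (auto intro: bounded_linear.has_derivative[OF bounded_linear_vec_nth] has_derivative_ident)

lemma cdiff_mult:
  assumes "cdiff f x" "cdiff g x"
  shows "cdiff (\<lambda>x. f x * g x) x"
proof -
  obtain D E where "(f has_derivative D) (at x)" "\<forall>a v. D (a *s v) = a * D v"
      "(g has_derivative E) (at x)" "\<forall>a v. E (a *s v) = a * E v"
    using assms unfolding cdiff_def by blast
  then show ?thesis unfolding cdiff_def
    by (intro exI[of _ "\<lambda>h. f x * E h + D h * g x"] conjI has_derivative_mult)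
       (auto simp: algebra_simps)
qed

lemma cdiff_inverse:
  assumes "cdiff f x" "f x \<noteq> 0"
  shows "cdiff (\<lambda>x. inverse (f x)) x"
proof -
  obtain D where "(f has_derivative D) (at x)" "\<forall>a v. D (a *s v) = a * D v"
    using assms unfolding cdiff_def by blast
  note D = this
  have "((\<lambda>x. inverse (f x)) has_derivative (\<lambda>h. - (inverse (f x) * D h * inverse (f x)))) (at x)"
    by (rule Deriv.has_derivative_inverse) (use assms(2) D in auto)
  with D show ?thesis unfolding cdiff_def
    by (intro exI[of _ "\<lambda>h. - (inverse (f x) * D h * inverse (f x))"]) (auto simp: algebra_simps)
qed

lemma cdiff_divide:
  assumes "cdiff f x" "cdiff g x" "g x \<noteq> 0"
  shows "cdiff (\<lambda>x. f x / g x) x"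
  using cdiff_mult[OF assms(1) cdiff_inverse[OF assms(2,3)]] by (simp add: divide_inverse)

lemma cdiff_power: "cdiff f x \<Longrightarrow> cdiff (\<lambda>x. f x ^ m) x"
  by (induction m) (auto intro: cdiff_const cdiff_mult)

lemma complex_differentiable_at_componentwise:
  fixes T :: "complex^'n \<Rightarrow> complex^'m"
  assumes "\<And>i. cdiff (\<lambda>x. T x $ i) x"
  shows "complex_differentiable_at T x"
proof -
  obtain D where D: "\<And>i. ((\<lambda>x. T x $ i) has_derivative D i) (at x)"
      "\<And>i a v. D i (a *s v) = a * D i v"
    using assms unfolding cdiff_def by metis
  have lin: "bounded_linear (axis i :: complex \<Rightarrow> complex^'m)" for i
    by (intro linear_conv_bounded_linear[THEN iffD1] linearI) (auto simp: vec_eq_iff axis_def)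
  have *: "(\<Sum>i\<in>UNIV. axis i (w $ i)) = w" for w :: "complex^'m"
    by (auto simp: vec_eq_iff axis_def if_distrib[of "\<lambda>f. f _"] cong: if_cong)
  have "((\<lambda>x. \<Sum>i\<in>UNIV. axis i (T x $ i)) has_derivative (\<lambda>h. \<Sum>i\<in>UNIV. axis i (D i h))) (at x)"
    by (intro has_derivative_sum bounded_linear.has_derivative[OF lin] D)
  then have "(T has_derivative (\<lambda>h. \<Sum>i\<in>UNIV. axis i (D i h))) (at x)"
    by (simp only: *)
  moreover have "(\<Sum>i\<in>UNIV. axis i (D i (a *s v))) = a *s (\<Sum>i\<in>UNIV. axis i (D i v))" for a v
    by (auto simp: vec_eq_iff axis_def D sum_distrib_left intro!: sum.cong)
  ultimately show ?thesis unfolding complex_differentiable_at_def by blast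
qed

lemma complex_differentiable_at_cong:
  assumes "complex_differentiable_at T x" "open S" "x \<in> S" "\<And>u. u \<in> S \<Longrightarrow> T u = T' u"
  shows "complex_differentiable_at T' x"
  using assms has_derivative_transform_within_open unfolding complex_differentiable_at_def by metis

lemma affine_lift_nth: "affine_lift j x $ i = (if i = j then 1 else x $ i)"
  by (simp add: affine_lift_def)

lemma homog_affine_lift_iff:
  "homog w = homog (affine_lift j x) \<longleftrightarrow> w $ j \<noteq> 0 \<and> (\<forall>i. i \<noteq> j \<longrightarrow> x $ i = w $ i / w $ j)"
proof
  assume "homog w = homog (affine_lift j x)"
  then obtain a where a: "a \<noteq> 0" "affine_lift j x = a *s w" using homog_eq_iff by metis
  then have nth: "affine_lift j x $ i = a * w $ i" for i by simp
  from nth[of j] have 1: "a * w $ j = 1" by (simp add: affine_lift_nth)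
  then have "w $ j \<noteq> 0" by auto
  moreover from this 1 have "a = 1 / w $ j" by (simp add: field_simps)
  moreover have "x $ i = a * w $ i" if "i \<noteq> j" for i
    using nth[of i] that by (simp add: affine_lift_nth)
  ultimately show "w $ j \<noteq> 0 \<and> (\<forall>i. i \<noteq> j \<longrightarrow> x $ i = w $ i / w $ j)" by simp
next
  assume "w $ j \<noteq> 0 \<and> (\<forall>i. i \<noteq> j \<longrightarrow> x $ i = w $ i / w $ j)"
  then show "homog w = homog (affine_lift j x)"
    unfolding homog_eq_iff
    by (intro exI[of _ "1 / w $ j"]) (auto simp: vec_eq_iff affine_lift_nth)
qed

lemma Mk_chart_eq_Mk_point_iff:
  assumes "w $ i \<noteq> 0"
  shows "Mk_point k i w y = Mk_chart k e j x \<longleftrightarrow>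
    w $ j \<noteq> 0 \<and> (\<forall>l. l \<noteq> j \<longrightarrow> x $ l = w $ l / w $ j) \<and>
    e (x $ j) = sphere_scale ((w $ j / w $ i) ^ k) y"
  using assms by (auto simp: Mk_chart_def Mk_point_eq_iff homog_affine_lift_iff affine_lift_nth)

lemma Mk_chart_eq_iff:
  "Mk_chart k e i x = Mk_chart k e' j x' \<longleftrightarrow>
    affine_lift i x $ j \<noteq> 0 \<and>
    (\<forall>l. l \<noteq> j \<longrightarrow> x' $ l = affine_lift i x $ l / affine_lift i x $ j) \<and>
    e' (x' $ j) = sphere_scale (affine_lift i x $ j ^ k) (e (x $ i))"
  unfolding Mk_chart_def[of k e i]
  by (subst Mk_chart_eq_Mk_point_iff) (auto simp: affine_lift_nth)

lemma inj_sphere_recip: "inj sphere_recip"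
  by (rule injI) (auto simp: sphere_recip_def split: if_splits)

lemma inj_Mk_chart:
  assumes "inj e"
  shows "inj (Mk_chart k e j)"
proof (rule injI)
  fix x x' assume "Mk_chart k e j x = Mk_chart k e j x'"
  then have *: "\<forall>l. l \<noteq> j \<longrightarrow> x' $ l = x $ l" "e (x' $ j) = e (x $ j)"
    by (auto simp: Mk_chart_eq_iff affine_lift_nth sphere_scale_1)
  then have "x' $ j = x $ j" using assms by (auto dest: injD)
  with * show "x = x'" by (metis vec_eq_iff)
qed

lemma Union_Mk_atlas: "(\<Union>c\<in>Mk_atlas k. range c) = (Mk k :: 'n::finite piece_point set set)"
  (is "?L = ?R")
proof
  show "?L \<subseteq> ?R"
  proof -
    have "Mk_chart k e j x \<in> Mk k" for e j and x :: "complex^'n"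
      unfolding Mk_chart_def Mk_eq by (rule CollectI) (metis affine_lift_nth one_neq_zero)
    then show ?thesis by (auto simp: Mk_atlas_def)
  qed
  show "?R \<subseteq> ?L"
  proof
    fix P assume "P \<in> ?R"
    then obtain j z y where P: "P = Mk_point k j z y" "z $ j \<noteq> 0" by (auto simp: Mk_eq)
    obtain e u where e: "e \<in> {Some, sphere_recip}" "e u = y"
    proof (cases y)
      case None
      then show ?thesis using that[of sphere_recip 0] by (simp add: sphere_recip_def)
    next
      case (Some u)
      then show ?thesis using that[of Some u] by simp
    qed
    have "P = Mk_chart k e j (\<chi> l. if l = j then u else z $ l / z $ j)"
      using P e by (simp add: Mk_chart_eq_Mk_point_iff sphere_scale_1)
    then show "P \<in> ?L" using e unfolding Mk_atlas_def by blast
  qed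
qed

lemma Mk_transition:
  fixes v :: "complex^'n \<Rightarrow> complex"
  assumes e: "inj e'" and S: "open S"
    and eq: "\<And>x. x \<in> S \<Longrightarrow> affine_lift i x $ j \<noteq> 0 \<and>
      e' (v x) = sphere_scale (affine_lift i x $ j ^ k) (e (x $ i))"
    and v: "\<And>x. x \<in> S \<Longrightarrow> cdiff v x"
    and out: "\<And>x u. x \<notin> S \<Longrightarrow> affine_lift i x $ j \<noteq> 0 \<Longrightarrow>
      e' u \<noteq> sphere_scale (affine_lift i x $ j ^ k) (e (x $ i))"
  shows "open {x. Mk_chart k e i x \<in> range (Mk_chart k e' j)} \<and>
    (\<forall>x. Mk_chart k e i x \<in> range (Mk_chart k e' j) \<longrightarrow>
       complex_differentiable_at (inv (Mk_chart k e' j) \<circ> Mk_chart k e i) x)"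
proof -
  define T where "T = (\<lambda>x. \<chi> l. if l = j then v x else affine_lift i x $ l / affine_lift i x $ j)"
  have T: "Mk_chart k e i x = Mk_chart k e' j (T x)" if "x \<in> S" for x
    using eq[OF that] by (auto simp: Mk_chart_eq_iff T_def)
  have dom: "{x. Mk_chart k e i x \<in> range (Mk_chart k e' j)} = S"
  proof (intro equalityI subsetI)
    fix x assume "x \<in> {x. Mk_chart k e i x \<in> range (Mk_chart k e' j)}"
    then obtain x' where "Mk_chart k e i x = Mk_chart k e' j x'" by auto
    then show "x \<in> S" using out[of x "x' $ j"] by (auto simp: Mk_chart_eq_iff)
  qed (use T in auto)
  have lift: "cdiff (\<lambda>x. affine_lift i x $ l) x" for l x
    by (cases "l = i") (simp_all add: affine_lift_nth cdiff_const cdiff_nth)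
  have "complex_differentiable_at (inv (Mk_chart k e' j) \<circ> Mk_chart k e i) x" if "x \<in> S" for x
  proof (rule complex_differentiable_at_cong[OF _ S that])
    show "complex_differentiable_at T x"
    proof (rule complex_differentiable_at_componentwise)
      show "cdiff (\<lambda>x. T x $ l) x" for l
        using v[OF that] eq[OF that] by (cases "l = j") (auto simp: T_def intro: cdiff_divide lift)
    qed
    show "T u = (inv (Mk_chart k e' j) \<circ> Mk_chart k e i) u" if "u \<in> S" for u
      using T[OF that] by (simp add: inv_f_f[OF inj_Mk_chart[OF e]])
  qed
  with dom S show ?thesis by blast
qed

lemma complex_atlas_Mk: "complex_atlas (Mk k) (Mk_atlas k :: ('n::finite, _) atlas)"
proof -
  have lift: "cdiff (\<lambda>x. affine_lift i x $ l) x" for i l and x :: "complex^'n"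
    by (cases "l = i") (simp_all add: affine_lift_nth cdiff_const cdiff_nth)
  have "continuous_on UNIV (\<lambda>x. affine_lift i x $ l)" for i l :: 'n
    by (cases "l = i") (auto simp: affine_lift_nth intro: continuous_intros)
  then have o1: "open {x. affine_lift i x $ l \<noteq> 0}" for i l :: 'n
    by (intro open_Collect_neq) auto
  have "open {x :: complex^'n. x $ l \<noteq> 0}" for l
    by (intro open_Collect_neq) (auto intro: continuous_intros)
  with o1 have o2: "open {x. affine_lift i x $ j \<noteq> 0 \<and> x $ l \<noteq> 0}" for i j l :: 'n
    by (rule open_Collect_conj)
  note cd = cdiff_divide cdiff_mult cdiff_power cdiff_const cdiff_nth lift
  have "open {x. c x \<in> range d} \<and>
      (\<forall>x. c x \<in> range d \<longrightarrow> complex_differentiable_at (inv d \<circ> c) x)"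
    if cd_atlas: "c \<in> Mk_atlas k" "d \<in> Mk_atlas k" for c d :: "complex^'n \<Rightarrow> 'n piece_point set"
  proof -
    obtain e i e' j where c: "c = Mk_chart k e i" "e \<in> {Some, sphere_recip}"
        and d: "d = Mk_chart k e' j" "e' \<in> {Some, sphere_recip}"
      using cd_atlas unfolding Mk_atlas_def by blast
    consider "e = Some" "e' = Some" | "e = sphere_recip" "e' = sphere_recip"
      | "e = Some" "e' = sphere_recip" | "e = sphere_recip" "e' = Some"
      using c d by auto
    then show ?thesis unfolding c d
    proof cases
      case 1
      show "open {x. Mk_chart k e i x \<in> range (Mk_chart k e' j)} \<and>
        (\<forall>x. Mk_chart k e i x \<in> range (Mk_chart k e' j) \<longrightarrow>
           complex_differentiable_at (inv (Mk_chart k e' j) \<circ> Mk_chart k e i) x)"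
        by (rule Mk_transition[OF _ o1, where v = "\<lambda>x. affine_lift i x $ j ^ k * x $ i"])
           (auto simp: 1 sphere_scale_simps intro!: cd)
    next
      case 2
      show "open {x. Mk_chart k e i x \<in> range (Mk_chart k e' j)} \<and>
        (\<forall>x. Mk_chart k e i x \<in> range (Mk_chart k e' j) \<longrightarrow>
           complex_differentiable_at (inv (Mk_chart k e' j) \<circ> Mk_chart k e i) x)"
        by (rule Mk_transition[OF _ o1, where v = "\<lambda>x. x $ i / affine_lift i x $ j ^ k"])
           (auto simp: 2 inj_sphere_recip sphere_recip_def sphere_scale_simps intro!: cd)
    next
      case 3
      show "open {x. Mk_chart k e i x \<in> range (Mk_chart k e' j)} \<and>
        (\<forall>x. Mk_chart k e i x \<in> range (Mk_chart k e' j) \<longrightarrow>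
           complex_differentiable_at (inv (Mk_chart k e' j) \<circ> Mk_chart k e i) x)"
        by (rule Mk_transition[OF _ o2[of i j i], where v = "\<lambda>x. 1 / (affine_lift i x $ j ^ k * x $ i)"])
           (auto simp: 3 inj_sphere_recip sphere_recip_def sphere_scale_simps intro!: cd)
    next
      case 4
      show "open {x. Mk_chart k e i x \<in> range (Mk_chart k e' j)} \<and>
        (\<forall>x. Mk_chart k e i x \<in> range (Mk_chart k e' j) \<longrightarrow>
           complex_differentiable_at (inv (Mk_chart k e' j) \<circ> Mk_chart k e i) x)"
        by (rule Mk_transition[OF _ o2[of i j i], where v = "\<lambda>x. affine_lift i x $ j ^ k / x $ i"])
           (auto simp: 4 inj_sphere_recip sphere_recip_def sphere_scale_simps intro!: cd)
    qed
  qed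
  then have "holomorphic_map (Mk_atlas k :: ('n, _) atlas) id"
    by (simp add: holomorphic_map_def)
  moreover have "\<forall>c\<in>Mk_atlas k. inj (c :: complex^'n \<Rightarrow> _)"
    by (auto simp: Mk_atlas_def intro: inj_Mk_chart inj_sphere_recip)
  ultimately show ?thesis by (simp add: complex_atlas_def Union_Mk_atlas)
qed

end

theory Submission
  imports Defs "HOL-Complex_Analysis.Cauchy_Integral_Formula"
begin

text \<open>
  Off the two sections an invariant Kaehler metric is determined by a momentum coordinate \<open>a\<close>, a function of
  the squared norm \<open>w\<close> on the line bundle, with \<open>a' = k b\<close> where \<open>b > 0\<close> is the fibre component. Since the
  gradient field of \<open>f\<close> is holomorphic, \<open>f = c a\<close> up to a constant. The mixed equation
  on the lines in the two sections gives \<open>a = n - k\<close> and \<open>a = n + k\<close> there, and it then integrates twice to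
  \<open>k\<^sup>2 w b a\<^sup>n\<^sup>-\<^sup>1 exp (c a) = P a - P (n - k)\<close> with \<open>P' x = (n - x) x\<^sup>n\<^sup>-\<^sup>1 exp (c x)\<close>. Hence the integral of \<open>P'\<close> over
  \<open>[n - k, n + k]\<close> vanishes, and this determines \<open>c\<close> because the integral, suitably normalised, is strictly
  monotone in \<open>c\<close>. What remains is an autonomous first-order equation for \<open>a\<close> in \<open>log w\<close>, whose solutions
  differ by a translation, that is, by a homothety of the fibres, which an equivariant automorphism realises.
  Conversely the solution of this equation closes up smoothly: the right-hand side has simple zeros with
  derivatives \<open>\<plusminus> 1\<close> at the endpoints, so it extends analytically to coordinates \<open>w\<close> and \<open>1 / w\<close>.
\<close>

section \<open>Smooth functions\<close>

text \<open>The potential \<open>f\<close> is not assumed to be invariant, and no regularity at the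
  sections is given beyond smoothness in charts. Both obstacles are met on projective lines: a
  fibre, or a line inside a section. Such a line is compact, so \<open>f\<close> is bounded on it,
  and Liouville's theorem then yields that \<open>f\<close> is radial along a fibre and that a
  certain multiple of log (1 + |x|^2) must vanish on a line in a section, which fixes the endpoint
  values of the momentum. Smoothness as a function of \<open>w\<close> at 0 is not at hand for a
  given metric. Uniqueness therefore uses the radius r = sqrt w, in which restrictions to a real
  line are smooth, and quantities that are constant on an open ray and continuous at its end.
  Existence instead constructs functions of \<open>w\<close> that are smooth slightly beyond 0. A
  boolean \<open>e\<close> treats the two sections at once: it fixes the sign of the degree s =
  \<plusminus> k of the fibre coordinate, the endpoint value is n - s, and inversion of
  \<open>w\<close> exchanges the two cases. The condition k < n makes both endpoint values
  positive.\<close>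

primrec ck :: "nat \<Rightarrow> 'a::real_normed_vector set \<Rightarrow> ('a \<Rightarrow> 'b::real_normed_vector) \<Rightarrow> bool" where
  "ck 0 S F \<longleftrightarrow> True"
| "ck (Suc n) S F \<longleftrightarrow> (\<forall>x\<in>S. F differentiable (at x)) \<and>
      (\<forall>v. ck n S (\<lambda>x. frechet_derivative F (at x) v))"

definition smooth_on :: "'a::real_normed_vector set \<Rightarrow> ('a \<Rightarrow> 'b::real_normed_vector) \<Rightarrow> bool" where
  "smooth_on S F \<longleftrightarrow> (\<forall>n. ck n S F)"

lemma frechet_derivative_eqI: "(f has_derivative f') (at x) \<Longrightarrow> frechet_derivative f (at x) = f'"
  using frechet_derivative_at by metis

lemma iterated_deriv_append:
  "iterated_deriv (us @ vs) F = iterated_deriv us (iterated_deriv vs F)"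
  by (induction us) auto

text \<open>\<open>ck\<close> peels off the derivative that is taken first, whereas
  \<open>iterated_deriv\<close> adds the one taken last; \<open>iterated_deriv_append\<close>
  mediates. The form of \<open>ck\<close> suits inductions over all functions of a given shape. As
  \<open>ck n\<close> asks for n successive differentiabilities, a list \<open>vs\<close> needs the
  index \<open>Suc (length vs)\<close>.\<close>

lemma smooth_iff_smooth_on: "smooth F \<longleftrightarrow> smooth_on UNIV F"
proof
  assume "smooth F"
  have "(\<forall>vs x. iterated_deriv vs F differentiable (at x)) \<Longrightarrow> ck n UNIV F" for n
  proof (induction n arbitrary: F)
    case (Suc n)
    have "ck n UNIV (\<lambda>x. frechet_derivative F (at x) v)" for v
    proof (rule Suc.IH, intro allI)
      fix vs x
      show "iterated_deriv vs (\<lambda>x. frechet_derivative F (at x) v) differentiable at x"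
        using Suc.prems[rule_format, of "vs @ [v]" x] by (simp add: iterated_deriv_append)
    qed
    moreover have "F differentiable at x" for x using Suc.prems[rule_format, of "[]" x] by simp
    ultimately show ?case by simp
  qed simp
  with \<open>smooth F\<close> show "smooth_on UNIV F" by (simp add: smooth_def smooth_on_def)
next
  assume "smooth_on UNIV F"
  have "ck (Suc (length vs)) UNIV F \<Longrightarrow> iterated_deriv vs F differentiable (at x)" for vs x
  proof (induction vs arbitrary: F rule: rev_induct)
    case (snoc v vs)
    then show ?case by (simp add: iterated_deriv_append)
  qed simp
  with \<open>smooth_on UNIV F\<close> show "smooth F" by (simp add: smooth_def smooth_on_def del: ck.simps)
qed

lemma smooth_on_differentiable: "smooth_on S F \<Longrightarrow> x \<in> S \<Longrightarrow> F differentiable (at x)"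
  unfolding smooth_on_def by (metis ck.simps(2))

lemma smooth_on_frechet: "smooth_on S F \<Longrightarrow> smooth_on S (\<lambda>x. frechet_derivative F (at x) v)"
  unfolding smooth_on_def by (metis ck.simps(2))

lemma smooth_onI:
  assumes "\<And>x. x \<in> S \<Longrightarrow> F differentiable (at x)"
    and "\<And>v. smooth_on S (\<lambda>x. frechet_derivative F (at x) v)"
  shows "smooth_on S F"
  unfolding smooth_on_def
proof
  fix n show "ck n S F" using assms by (cases n) (auto simp: smooth_on_def)
qed

lemma ck_mono: "ck (Suc n) S F \<Longrightarrow> ck n S F"
  by (induction n arbitrary: F) auto

lemma ck_cong:
  assumes "open S" "\<And>x. x \<in> S \<Longrightarrow> F x = G x" "ck n S F"
  shows "ck n S G"
  using assms(2,3)
proof (induction n arbitrary: F G)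
  case (Suc n)
  have "(G has_derivative frechet_derivative F (at x)) (at x)" if "x \<in> S" for x
    using has_derivative_transform_within_open[OF _ assms(1) that] Suc.prems that
    by (metis ck.simps(2) frechet_derivative_works)
  moreover from this have "ck n S (\<lambda>x. frechet_derivative G (at x) v)" for v
    using Suc.IH[of "\<lambda>x. frechet_derivative F (at x) v" "\<lambda>x. frechet_derivative G (at x) v"]
      Suc.prems(2) frechet_derivative_eqI by fastforce
  ultimately show ?case by (auto simp: differentiable_def)
qed simp

lemma smooth_on_cong:
  assumes "open S" "\<And>x. x \<in> S \<Longrightarrow> F x = G x" "smooth_on S F"
  shows "smooth_on S G"
  unfolding smooth_on_def
proof
  fix n show "ck n S G"
    by (rule ck_cong[OF assms(1,2)]) (use assms(3) in \<open>simp_all add: smooth_on_def\<close>)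
qed

lemma smooth_on_const: "smooth_on S (\<lambda>_. c)"
proof -
  have "ck n S (\<lambda>_. c)" for n
    by (induction n arbitrary: c) (auto simp: frechet_derivative_eqI[OF has_derivative_const])
  then show ?thesis by (simp add: smooth_on_def)
qed

lemma smooth_on_linear:
  assumes "bounded_linear F" shows "smooth_on S F"
  by (rule smooth_onI)
     (auto simp: frechet_derivative_eqI[OF bounded_linear_imp_has_derivative[OF assms]]
       bounded_linear_imp_differentiable[OF assms] smooth_on_const)

lemma ck_add:
  assumes "open S" "ck n S F" "ck n S G"
  shows "ck n S (\<lambda>x. F x + G x)"
  using assms(2,3)
proof (induction n arbitrary: F G)
  case (Suc n)
  have d: "((\<lambda>x. F x + G x) has_derivative
     (\<lambda>v. frechet_derivative F (at x) v + frechet_derivative G (at x) v)) (at x)" if "x \<in> S" for x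
    using Suc.prems that by (intro has_derivative_add) (auto simp: frechet_derivative_works)
  have "ck n S (\<lambda>x. frechet_derivative (\<lambda>x. F x + G x) (at x) v)" for v
    by (rule ck_cong[OF assms(1) _ Suc.IH, of "\<lambda>x. frechet_derivative F (at x) v"
          "\<lambda>x. frechet_derivative G (at x) v"])
       (use Suc.prems frechet_derivative_eqI[OF d] in auto)
  then show ?case using d by (auto simp: differentiable_def)
qed simp

lemma smooth_on_add:
  assumes "open S" "smooth_on S F" "smooth_on S G"
  shows "smooth_on S (\<lambda>x. F x + G x)"
  using assms by (simp add: smooth_on_def ck_add)

lemma smooth_on_sum:
  assumes "open S" "\<And>i. i \<in> I \<Longrightarrow> smooth_on S (F i)"
  shows "smooth_on S (\<lambda>x. \<Sum>i\<in>I. F i x)"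
  using assms(2)
  by (induction I rule: infinite_finite_induct) (auto intro: smooth_on_const smooth_on_add[OF assms(1)])

lemma (in bounded_bilinear) ck_prod:
  assumes "open S" "ck n S F" "ck n S G"
  shows "ck n S (\<lambda>x. prod (F x) (G x))"
  using assms(2,3)
proof (induction n arbitrary: F G)
  case (Suc n)
  have d: "((\<lambda>x. prod (F x) (G x)) has_derivative
     (\<lambda>v. prod (F x) (frechet_derivative G (at x) v) + prod (frechet_derivative F (at x) v) (G x))) (at x)"
    if "x \<in> S" for x
    using Suc.prems that by (intro FDERIV) (auto simp: frechet_derivative_works)
  have "ck n S (\<lambda>x. prod (F x) (frechet_derivative G (at x) v))"
    "ck n S (\<lambda>x. prod (frechet_derivative F (at x) v) (G x))" for v
    using Suc.prems ck_mono[OF Suc.prems(1)] ck_mono[OF Suc.prems(2)] by (auto intro: Suc.IH)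
  note ck_add[OF assms(1) this]
  then have "ck n S (\<lambda>x. frechet_derivative (\<lambda>x. prod (F x) (G x)) (at x) v)" for v
    by (rule ck_cong[OF assms(1), rotated]) (simp add: frechet_derivative_eqI[OF d])
  then show ?case using d by (auto simp: differentiable_def)
qed simp

lemma (in bounded_bilinear) smooth_on_prod:
  assumes "open S" "smooth_on S F" "smooth_on S G"
  shows "smooth_on S (\<lambda>x. prod (F x) (G x))"
  using assms by (simp add: smooth_on_def ck_prod)

lemmas smooth_on_mult = bounded_bilinear.smooth_on_prod[OF bounded_bilinear_mult]

lemma smooth_on_linear_compose:
  assumes "bounded_linear L" "open S" "smooth_on S F"
  shows "smooth_on S (\<lambda>x. L (F x))"
proof -
  have "ck n S F \<Longrightarrow> ck n S (\<lambda>x. L (F x))" for n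
  proof (induction n arbitrary: F)
    case (Suc n)
    have d: "((\<lambda>x. L (F x)) has_derivative (\<lambda>v. L (frechet_derivative F (at x) v))) (at x)"
      if "x \<in> S" for x
      using Suc.prems that by (intro bounded_linear.has_derivative[OF assms(1)]) (auto simp: frechet_derivative_works)
    have "ck n S (\<lambda>x. frechet_derivative (\<lambda>x. L (F x)) (at x) v)" for v
      by (rule ck_cong[OF assms(2) _ Suc.IH, of "\<lambda>x. frechet_derivative F (at x) v"])
         (use Suc.prems frechet_derivative_eqI[OF d] in auto)
    then show ?case using d by (auto simp: differentiable_def)
  qed simp
  with assms show ?thesis by (simp add: smooth_on_def)
qed

lemma smooth_on_compose_linear:
  assumes "bounded_linear L" "open S" "smooth_on T F" "L ` S \<subseteq> T"
  shows "smooth_on S (\<lambda>x. F (L x))"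
proof -
  have "ck n T F \<Longrightarrow> ck n S (\<lambda>x. F (L x))" for n
  proof (induction n arbitrary: F)
    case (Suc n)
    have d: "((\<lambda>x. F (L x)) has_derivative (\<lambda>v. frechet_derivative F (at (L x)) (L v))) (at x)"
      if "x \<in> S" for x
      using Suc.prems that assms(4)
      by (intro has_derivative_compose[OF bounded_linear_imp_has_derivative[OF assms(1)]])
         (auto simp: frechet_derivative_works)
    have "ck n S (\<lambda>x. frechet_derivative (\<lambda>x. F (L x)) (at x) v)" for v
      by (rule ck_cong[OF assms(2) _ Suc.IH, of "\<lambda>x. frechet_derivative F (at x) (L v)"])
         (use Suc.prems frechet_derivative_eqI[OF d] in auto)
    then show ?case using d by (auto simp: differentiable_def)
  qed simp
  with assms show ?thesis by (simp add: smooth_on_def)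
qed

text \<open>The derivative of the composite is the derivative of \<open>u\<close> times the
  composite of \<open>u\<close> with the derivative of \<open>h\<close>. An induction with
  \<open>u\<close> fixed and \<open>h\<close> arbitrary therefore closes.\<close>

lemma smooth_on_compose_real:
  fixes h :: "real \<Rightarrow> 'b::real_normed_vector"
  assumes "open S" "smooth_on J h" "smooth_on S u" "u ` S \<subseteq> J"
  shows "smooth_on S (\<lambda>x. h (u x))"
proof -
  have "smooth_on J h \<Longrightarrow> ck n S (\<lambda>x. h (u x))" for n
  proof (induction n arbitrary: h)
    case (Suc n)
    have d: "((\<lambda>x. h (u x)) has_derivative
       (\<lambda>v. frechet_derivative u (at x) v *\<^sub>R frechet_derivative h (at (u x)) 1)) (at x)" if "x \<in> S" for x
    proof -
      have h: "(h has_derivative frechet_derivative h (at (u x))) (at (u x))"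
        using smooth_on_differentiable[OF Suc.prems] assms(4) that frechet_derivative_works by blast
      have "(u has_derivative frechet_derivative u (at x)) (at x)"
        using smooth_on_differentiable[OF assms(3) that] frechet_derivative_works by blast
      note d = has_derivative_compose[OF this h]
      have "frechet_derivative h (at (u x)) r = r *\<^sub>R frechet_derivative h (at (u x)) 1" for r
        using linear_scale[OF has_derivative_linear[OF h], of r 1] by (simp only: real_scaleR_def mult_1_right)
      then have "(\<lambda>v. frechet_derivative h (at (u x)) (frechet_derivative u (at x) v)) =
          (\<lambda>v. frechet_derivative u (at x) v *\<^sub>R frechet_derivative h (at (u x)) 1)"
        by blast
      with d show ?thesis by (simp only:)
    qed
    have ck: "ck n S (\<lambda>x. frechet_derivative u (at x) v *\<^sub>R frechet_derivative h (at (u x)) 1)" for v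
      using smooth_on_frechet[OF assms(3)] Suc.IH[OF smooth_on_frechet[OF Suc.prems]]
      by (intro bounded_bilinear.ck_prod[OF bounded_bilinear_scaleR assms(1)]) (simp_all add: smooth_on_def)
    have "ck n S (\<lambda>x. frechet_derivative (\<lambda>x. h (u x)) (at x) v)" for v
      by (rule ck_cong[OF assms(1) _ ck[of v]]) (simp add: frechet_derivative_eqI[OF d])
    then show ?case using d by (auto simp: differentiable_def)
  qed simp
  with assms show ?thesis by (simp add: smooth_on_def)
qed

section \<open>Smooth functions of one real or complex variable\<close>

lemma smooth_on_real_derivI:
  assumes "open S" "\<And>x. x \<in> S \<Longrightarrow> (h has_real_derivative h' x) (at x)" "smooth_on S h'"
  shows "smooth_on S h"
proof (rule smooth_onI)
  have d: "frechet_derivative h (at x) = (*) (h' x)" if "x \<in> S" for x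
    using assms(2)[OF that] by (simp add: has_field_derivative_def frechet_derivative_eqI)
  show "h differentiable at x" if "x \<in> S" for x
    using assms(2)[OF that] real_differentiable_def by blast
  show "smooth_on S (\<lambda>x. frechet_derivative h (at x) v)" for v
    by (rule smooth_on_cong[OF assms(1) _ smooth_on_mult[OF assms(1,3) smooth_on_const[of S v]]]) (simp add: d)
qed

lemma smooth_on_real_deriv:
  fixes h :: "real \<Rightarrow> real"
  assumes "smooth_on S h" "open S"
  shows "smooth_on S (deriv h)" and "\<And>x. x \<in> S \<Longrightarrow> (h has_real_derivative deriv h x) (at x)"
proof -
  show 1: "(h has_real_derivative deriv h x) (at x)" if "x \<in> S" for x
    using smooth_on_differentiable[OF assms(1) that] DERIV_deriv_iff_real_differentiable by blast
  have "frechet_derivative h (at x) = (*) (deriv h x)" if "x \<in> S" for x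
    using 1[OF that] by (simp add: has_field_derivative_def frechet_derivative_eqI)
  then show "smooth_on S (deriv h)"
    by (intro smooth_on_cong[OF assms(2) _ smooth_on_frechet[OF assms(1), of 1]]) simp
qed

lemma smooth_on_holomorphic:
  assumes "f holomorphic_on D" "open D"
  shows "smooth_on D f"
proof -
  have "f holomorphic_on D \<Longrightarrow> ck n D f" for n
  proof (induction n arbitrary: f)
    case (Suc n)
    have d: "(f has_derivative (*) (deriv f x)) (at x)" if "x \<in> D" for x
      using holomorphic_derivI[OF Suc.prems assms(2) that] by (simp add: has_field_derivative_def)
    have "ck n D (\<lambda>x. frechet_derivative f (at x) v)" for v
    proof (rule ck_cong[OF assms(2)])
      show "ck n D (\<lambda>x. deriv f x * v)"
        using Suc.prems assms(2) by (intro Suc.IH holomorphic_intros)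
    qed (simp add: frechet_derivative_eqI[OF d])
    then show ?case using d by (auto simp: differentiable_def)
  qed simp
  with assms show ?thesis by (simp add: smooth_on_def)
qed

lemma smooth_on_Re_holomorphic:
  assumes "f holomorphic_on D" "open D" "open J" "of_real ` J \<subseteq> D"
  shows "smooth_on J (\<lambda>x::real. Re (f (of_real x)))"
  by (rule smooth_on_linear_compose[OF bounded_linear_Re assms(3)
      smooth_on_compose_linear[OF bounded_linear_of_real assms(3) smooth_on_holomorphic[OF assms(1,2)] assms(4)]])

lemma smooth_on_power_int: "smooth_on {0<..} (\<lambda>x::real. x powi s)"
proof -
  \<comment> \<open>The factor \<open>c\<close> absorbs the exponent that differentiation brings
    down and keeps the induction within one family.\<close>
  have "ck n {0<..} (\<lambda>x::real. c * x powi s)" for n c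
  proof (induction n arbitrary: s c)
    case (Suc n)
    have d: "((\<lambda>x::real. c * x powi s) has_derivative (\<lambda>v. (c * of_int s) * x powi (s - 1) * v)) (at x)"
      if "x \<in> {0<..}" for x
      using that by (auto intro!: derivative_eq_intros)
    have "ck n {0<..} (\<lambda>x. frechet_derivative (\<lambda>x::real. c * x powi s) (at x) v)" for v
      by (rule ck_cong[OF open_greaterThan _ Suc.IH[of "c * of_int s * v" "s - 1"]])
         (simp add: frechet_derivative_eqI[OF d])
    then show ?case using d by (auto simp: differentiable_def)
  qed simp
  from this[of _ 1] show ?thesis by (simp add: smooth_on_def)
qed

lemma smooth_on_ln: "smooth_on {0<..} (ln :: real \<Rightarrow> real)"
proof (rule smooth_on_real_derivI)
  show "(ln has_real_derivative inverse x) (at x)" if "x \<in> {0<..}" for x :: real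
    using that by (auto intro!: derivative_eq_intros simp: divide_inverse)
  show "smooth_on {0<..} (inverse :: real \<Rightarrow> real)"
    using smooth_on_power_int[of "-1"] by (simp add: power_int_minus)
qed auto

lemma smooth_on_real_derivI_self:
  fixes h :: "real \<Rightarrow> real"
  assumes "open S" "\<And>x. x \<in> S \<Longrightarrow> (h has_real_derivative h x) (at x)"
  shows "smooth_on S h"
proof -
  have "ck n S h" for n
  proof (induction n)
    case (Suc n)
    have d: "(h has_derivative (*) (h x)) (at x)" if "x \<in> S" for x
      using assms(2)[OF that] by (simp add: has_field_derivative_def)
    have "ck n S (\<lambda>x. frechet_derivative h (at x) v)" for v
      by (rule ck_cong[OF assms(1) _ bounded_bilinear.ck_prod[OF bounded_bilinear_mult assms(1) Suc.IH, of "\<lambda>_. v"]])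
         (use smooth_on_const[of S v] in \<open>auto simp: frechet_derivative_eqI[OF d] smooth_on_def\<close>)
    then show ?case using d by (auto simp: differentiable_def)
  qed simp
  then show ?thesis by (simp add: smooth_on_def)
qed

lemma smooth_on_exp: "smooth_on UNIV (exp :: real \<Rightarrow> real)"
  by (rule smooth_on_real_derivI_self) (auto intro!: derivative_eq_intros)

text \<open>Bootstrapping along a flow: if f' = R(f), the derivative of q(f) is (q' R)(f), a
  function of the same kind. The induction therefore ranges over all smooth \<open>q\<close>. In
  \<open>inverse_coordinate\<close> this gives the smoothness of an inverse function.\<close>

lemma smooth_on_autonomous:
  assumes "open S" "open J" "\<And>x. x \<in> S \<Longrightarrow> (f has_real_derivative R (f x)) (at x)"
    "f ` S \<subseteq> J" "smooth_on J R"
  shows "smooth_on S f"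
proof -
  have "smooth_on J q \<Longrightarrow> ck n S (\<lambda>x. q (f x))" for n and q :: "real \<Rightarrow> real"
  proof (induction n arbitrary: q)
    case (Suc n)
    have d: "((\<lambda>x. q (f x)) has_derivative (\<lambda>v. deriv q (f x) * R (f x) * v)) (at x)" if "x \<in> S" for x
      using DERIV_chain2[OF smooth_on_real_deriv(2)[OF Suc.prems assms(2)] assms(3)] assms(4) that
      unfolding has_field_derivative_def by blast
    have "ck n S (\<lambda>x. frechet_derivative (\<lambda>x. q (f x)) (at x) v)" for v
      by (rule ck_cong[OF assms(1) _ Suc.IH[of "\<lambda>x. deriv q x * R x * v"]])
         (auto simp: frechet_derivative_eqI[OF d] intro!: smooth_on_mult assms smooth_on_const
           smooth_on_real_deriv Suc.prems)
    then show ?case using d by (auto simp: differentiable_def)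
  qed simp
  from this[OF smooth_on_linear[OF bounded_linear_ident]] show ?thesis by (simp add: smooth_on_def)
qed

section \<open>Vector-valued smooth maps and determinants\<close>

lemma bounded_linear_axis: "bounded_linear (axis i :: 'a::euclidean_space \<Rightarrow> 'a^'n::finite)"
  by (intro linear_conv_bounded_linear[THEN iffD1] linearI) (auto simp: vec_eq_iff axis_def)

lemma smooth_on_vecI:
  fixes F :: "'a::real_normed_vector \<Rightarrow> 'b::euclidean_space^'n::finite"
  assumes "open S" "\<And>i. smooth_on S (\<lambda>x. F x $ i)"
  shows "smooth_on S F"
proof -
  have "(\<Sum>i\<in>UNIV. axis i (F x $ i)) = F x" for x
    by (auto simp: vec_eq_iff axis_def if_distrib[of "\<lambda>f. f _"] cong: if_cong)
  moreover have "smooth_on S (\<lambda>x. \<Sum>i\<in>UNIV. axis i (F x $ i))"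
    by (intro smooth_on_sum smooth_on_linear_compose[OF bounded_linear_axis] assms)
  ultimately show ?thesis by simp
qed

lemma smooth_on_nth: "open S \<Longrightarrow> smooth_on S F \<Longrightarrow> smooth_on S (\<lambda>x. F x $ i)"
  by (rule smooth_on_linear_compose[OF bounded_linear_vec_nth])

lemma smooth_on_prod_set:
  fixes F :: "'i \<Rightarrow> 'a::real_normed_vector \<Rightarrow> 'b::{real_normed_algebra,comm_monoid_mult}"
  assumes "open S" "\<And>i. i \<in> I \<Longrightarrow> smooth_on S (F i)"
  shows "smooth_on S (\<lambda>x. \<Prod>i\<in>I. F i x)"
  using assms(2)
  by (induction I rule: infinite_finite_induct) (auto intro: smooth_on_const smooth_on_mult[OF assms(1)])

lemma smooth_on_det:
  fixes F :: "'a::real_normed_vector \<Rightarrow> complex^'n::finite^'n"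
  assumes "open S" "smooth_on S F"
  shows "smooth_on S (\<lambda>x. det (F x))"
  unfolding det_def
  by (intro smooth_on_sum smooth_on_mult smooth_on_const smooth_on_prod_set smooth_on_nth assms)

section \<open>Wirtinger calculus\<close>

text \<open>Splits the real derivative into a complex-linear part with coefficients \<open>p\<close>
  and an antilinear part with coefficients \<open>q\<close>. Carrying both makes products,
  conjugation and composition with real functions purely algebraic, and \<open>wirt\<close> and
  \<open>wirt_bar\<close> are read off at the end.\<close>

definition has_wirt :: "(complex^'n \<Rightarrow> complex) \<Rightarrow> ('n \<Rightarrow> complex) \<Rightarrow> ('n \<Rightarrow> complex) \<Rightarrow> complex^'n::finite \<Rightarrow> bool" where
  "has_wirt F p q x \<longleftrightarrow>
     (F has_derivative (\<lambda>v. (\<Sum>i\<in>UNIV. p i * v $ i) + (\<Sum>i\<in>UNIV. q i * cnj (v $ i)))) (at x)"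

lemma has_wirt_eqs:
  assumes "has_wirt F p q x"
  shows "wirt i F x = p i" "wirt_bar i F x = q i"
proof -
  have *: "frechet_derivative F (at x) (axis i c) = p i * c + q i * cnj c" for c
    using assms unfolding has_wirt_def
    by (simp add: frechet_derivative_eqI axis_def if_distrib[of "\<lambda>f. _ * f"] if_distrib[of cnj] cong: if_cong)
  show "wirt i F x = p i" "wirt_bar i F x = q i"
    by (simp_all add: wirt_def wirt_bar_def * algebra_simps)
qed

lemma has_wirt_differentiable: "has_wirt F p q x \<Longrightarrow> F differentiable (at x)"
  by (auto simp: has_wirt_def differentiable_def)

lemma vec_decompose: "(v :: complex^'n::finite) = (\<Sum>i\<in>UNIV. Re (v $ i) *\<^sub>R axis i 1 + Im (v $ i) *\<^sub>R axis i \<i>)"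
proof -
  have "(\<Sum>i\<in>UNIV. Re (v $ i) *\<^sub>R axis i 1 + Im (v $ i) *\<^sub>R axis i \<i>) $ l = v $ l" for l
  proof -
    have "(\<Sum>i\<in>UNIV. Re (v $ i) *\<^sub>R axis i 1 + Im (v $ i) *\<^sub>R axis i \<i>) $ l =
        (\<Sum>i\<in>UNIV. if i = l then v $ i else 0)"
      unfolding sum_component by (intro sum.cong) (auto simp: axis_def complex_eq_iff)
    then show ?thesis by simp
  qed
  then show ?thesis by (simp add: vec_eq_iff)
qed

lemma has_wirtI:
  assumes "F differentiable (at x)"
  shows "has_wirt F (\<lambda>i. wirt i F x) (\<lambda>i. wirt_bar i F x) x"
proof -
  have d: "(F has_derivative frechet_derivative F (at x)) (at x)" using assms frechet_derivative_works by blast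
  then have lin: "linear (frechet_derivative F (at x))" by (rule has_derivative_linear)
  have "frechet_derivative F (at x) v =
      (\<Sum>i\<in>UNIV. wirt i F x * v $ i) + (\<Sum>i\<in>UNIV. wirt_bar i F x * cnj (v $ i))" for v
  proof -
    have *: "Re c *\<^sub>R a + Im c *\<^sub>R b = (a - \<i> * b) / 2 * c + (a + \<i> * b) / 2 * cnj c" for a b c :: complex
      by (simp add: complex_eq_iff field_simps)
    have "frechet_derivative F (at x) v =
      (\<Sum>i\<in>UNIV. Re (v $ i) *\<^sub>R frechet_derivative F (at x) (axis i 1)
                + Im (v $ i) *\<^sub>R frechet_derivative F (at x) (axis i \<i>))"
      by (subst vec_decompose)
         (simp only: linear_sum[OF lin] linear_add[OF lin] linear_scale[OF lin] o_def)
    then show ?thesis unfolding * wirt_def wirt_bar_def by (simp only: sum.distrib)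
  qed
  then have "frechet_derivative F (at x) = (\<lambda>v. (\<Sum>i\<in>UNIV. wirt i F x * v $ i) + (\<Sum>i\<in>UNIV. wirt_bar i F x * cnj (v $ i)))"
    by blast
  with d show ?thesis unfolding has_wirt_def by simp
qed

lemma has_wirt_const: "has_wirt (\<lambda>_. c) (\<lambda>_. 0) (\<lambda>_. 0) x"
  by (simp add: has_wirt_def)

lemma has_wirt_nth: "has_wirt (\<lambda>x. x $ j) (\<lambda>i. if i = j then 1 else 0) (\<lambda>_. 0) x"
  unfolding has_wirt_def
  by (simp add: if_distrib[of "\<lambda>f. f * _"] bounded_linear_imp_has_derivative[OF bounded_linear_vec_nth] cong: if_cong)

lemma has_wirt_cnj:
  assumes "has_wirt F p q x"
  shows "has_wirt (\<lambda>x. cnj (F x)) (\<lambda>i. cnj (q i)) (\<lambda>i. cnj (p i)) x"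
  using bounded_linear.has_derivative[OF bounded_linear_cnj assms[unfolded has_wirt_def]]
  by (simp add: has_wirt_def add.commute)

lemma has_wirt_add:
  assumes "has_wirt F p q x" "has_wirt G p' q' x"
  shows "has_wirt (\<lambda>x. F x + G x) (\<lambda>i. p i + p' i) (\<lambda>i. q i + q' i) x"
  using has_derivative_add[OF assms[unfolded has_wirt_def]]
  by (simp add: has_wirt_def algebra_simps sum.distrib)

lemma has_wirt_mult:
  assumes "has_wirt F p q x" "has_wirt G p' q' x"
  shows "has_wirt (\<lambda>x. F x * G x) (\<lambda>i. F x * p' i + p i * G x) (\<lambda>i. F x * q' i + q i * G x) x"
  using has_derivative_mult[OF assms[unfolded has_wirt_def]]
  by (simp add: has_wirt_def algebra_simps sum.distrib sum_distrib_left)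

lemma has_wirt_minus:
  assumes "has_wirt F p q x"
  shows "has_wirt (\<lambda>x. - F x) (\<lambda>i. - p i) (\<lambda>i. - q i) x"
  using has_wirt_mult[OF has_wirt_const[of "-1"] assms] by simp

lemma has_wirt_diff:
  assumes "has_wirt F p q x" "has_wirt G p' q' x"
  shows "has_wirt (\<lambda>x. F x - G x) (\<lambda>i. p i - p' i) (\<lambda>i. q i - q' i) x"
  using has_wirt_add[OF assms(1) has_wirt_minus[OF assms(2)]] by simp

lemma has_wirt_sum:
  assumes "\<And>a. a \<in> I \<Longrightarrow> has_wirt (F a) (p a) (q a) x"
  shows "has_wirt (\<lambda>x. \<Sum>a\<in>I. F a x) (\<lambda>i. \<Sum>a\<in>I. p a i) (\<lambda>i. \<Sum>a\<in>I. q a i) x"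
  using assms
  by (induction I rule: infinite_finite_induct) (auto intro: has_wirt_const has_wirt_add)

lemma has_wirt_inverse:
  assumes "has_wirt F p q x" "F x \<noteq> 0"
  shows "has_wirt (\<lambda>x. inverse (F x)) (\<lambda>i. - p i / F x ^ 2) (\<lambda>i. - q i / F x ^ 2) x"
proof -
  have *: "-(inverse a * (s + t) * inverse a) = - s / a\<^sup>2 + - t / a\<^sup>2" for a s t :: complex
    by (simp add: divide_inverse algebra_simps power2_eq_square)
  show ?thesis
    using Deriv.has_derivative_inverse[OF assms(2) assms(1)[unfolded has_wirt_def]]
    unfolding has_wirt_def * by (simp add: sum_divide_distrib sum_negf)
qed

lemma has_wirt_of_real:
  assumes u: "has_wirt (\<lambda>x. complex_of_real (u x)) p q x"
    and h: "(h has_real_derivative h') (at (u x))"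
  shows "has_wirt (\<lambda>x. complex_of_real (h (u x))) (\<lambda>i. of_real h' * p i) (\<lambda>i. of_real h' * q i) x"
proof -
  let ?D = "\<lambda>v. (\<Sum>i\<in>UNIV. p i * v $ i) + (\<Sum>i\<in>UNIV. q i * cnj (v $ i))"
  have 1: "(u has_derivative (\<lambda>v. Re (?D v))) (at x)"
    using bounded_linear.has_derivative[OF bounded_linear_Re u[unfolded has_wirt_def]] by simp
  have "((\<lambda>x. complex_of_real (u x)) has_derivative (\<lambda>v. of_real (Re (?D v)))) (at x)"
    by (rule bounded_linear.has_derivative[OF bounded_linear_of_real 1])
  \<comment> \<open>Both sides are derivatives of the same real-valued function, so taking the real
    part changes nothing.\<close>
  then have re: "of_real (Re (?D v)) = ?D v" for v
    using fun_cong[OF has_derivative_unique[OF _ u[unfolded has_wirt_def]], of _ v] by simp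
  have "((\<lambda>x. h (u x)) has_derivative (\<lambda>v. h' * Re (?D v))) (at x)"
    using has_derivative_compose[OF 1 h[unfolded has_field_derivative_def]] by simp
  from bounded_linear.has_derivative[OF bounded_linear_of_real[where 'a = complex] this]
  have "((\<lambda>x. complex_of_real (h (u x))) has_derivative (\<lambda>v. of_real h' * ?D v)) (at x)"
    unfolding of_real_mult re .
  then show ?thesis
    by (simp add: has_wirt_def distrib_left sum_distrib_left mult.assoc)
qed

lemma has_wirt_cong:
  assumes "has_wirt F p q x" "p = p'" "q = q'" shows "has_wirt F p' q' x"
  using assms by simp

section \<open>The invariant Hermitian forms\<close>

definition herm :: "complex^'n \<Rightarrow> complex^'n \<Rightarrow> complex" where
  "herm v u = (\<Sum>i\<in>UNIV. v $ i * cnj (u $ i))"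

text \<open>In a chart \<open>x\<close> with fibre coordinate \<open>x\<^sub>j\<close>, \<open>bnorm\<close> is the squared norm of the affine lift and \<open>wnorm\<close>
  that of the point of the line bundle. Moreover \<open>nuc\<close> are the components of \<open>\<nu> = \<partial> log bnorm\<close>, \<open>xic\<close>
  those of the connection form \<open>\<xi> = dx\<^sub>j + s x\<^sub>j \<nu>\<close>, \<open>fsc\<close> those of the Fubini-Study form, and \<open>mmat\<close> is
  the general invariant tensor \<open>a\<close> (Fubini-Study) \<open>+ b bnorm\<^sup>s |\<xi>|\<^sup>2\<close>; \<open>nu\<close>, \<open>xi\<close>, \<open>fs\<close>, \<open>mform\<close> are the same
  objects evaluated on vectors.\<close>

definition bpart :: "'n \<Rightarrow> complex^'n \<Rightarrow> complex^'n" where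
  "bpart j v = (\<chi> i. if i = j then 0 else v $ i)"

definition bnorm :: "'n::finite \<Rightarrow> complex^'n \<Rightarrow> real" where
  "bnorm j x = 1 + (\<Sum>i\<in>UNIV - {j}. (norm (x $ i))\<^sup>2)"

definition wnorm :: "int \<Rightarrow> 'n::finite \<Rightarrow> complex^'n \<Rightarrow> real" where
  "wnorm s j x = (norm (x $ j))\<^sup>2 * bnorm j x powi s"

definition nuc :: "'n::finite \<Rightarrow> complex^'n \<Rightarrow> 'n \<Rightarrow> complex" where
  "nuc j x i = (if i = j then 0 else cnj (x $ i) / bnorm j x)"

definition xic :: "int \<Rightarrow> 'n::finite \<Rightarrow> complex^'n \<Rightarrow> 'n \<Rightarrow> complex" where
  "xic s j x i = (if i = j then 1 else 0) + of_int s * x $ j * nuc j x i"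

definition fsc :: "'n::finite \<Rightarrow> complex^'n \<Rightarrow> 'n \<Rightarrow> 'n \<Rightarrow> complex" where
  "fsc j x i l = (if i = l \<and> i \<noteq> j then 1 / bnorm j x else 0) - nuc j x i * cnj (nuc j x l)"

definition mmat :: "int \<Rightarrow> 'n::finite \<Rightarrow> real \<Rightarrow> real \<Rightarrow> complex^'n \<Rightarrow> complex^'n^'n" where
  "mmat s j a b x = (\<chi> i l. of_real a * fsc j x i l
     + of_real (b * bnorm j x powi s) * xic s j x i * cnj (xic s j x l))"

definition nu :: "'n::finite \<Rightarrow> complex^'n \<Rightarrow> complex^'n \<Rightarrow> complex" where
  "nu j x v = herm (bpart j v) (affine_lift j x) / bnorm j x"

definition xi :: "int \<Rightarrow> 'n::finite \<Rightarrow> complex^'n \<Rightarrow> complex^'n \<Rightarrow> complex" where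
  "xi s j x v = v $ j + of_int s * x $ j * nu j x v"

definition fs :: "'n::finite \<Rightarrow> complex^'n \<Rightarrow> complex^'n \<Rightarrow> complex^'n \<Rightarrow> complex" where
  "fs j x v u = herm (bpart j v) (bpart j u) / bnorm j x - nu j x v * cnj (nu j x u)"

definition mform :: "int \<Rightarrow> 'n::finite \<Rightarrow> real \<Rightarrow> real \<Rightarrow> complex^'n \<Rightarrow> complex^'n \<Rightarrow> complex^'n \<Rightarrow> complex" where
  "mform s j a b x v u = of_real a * fs j x v u
     + of_real (b * bnorm j x powi s) * xi s j x v * cnj (xi s j x u)"

definition sform :: "complex^'n^'n \<Rightarrow> complex^'n \<Rightarrow> complex^'n \<Rightarrow> complex" where
  "sform M v u = (\<Sum>i\<in>UNIV. \<Sum>l\<in>UNIV. M $ i $ l * v $ i * cnj (u $ l))"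

section \<open>The forms as components and as functions of vectors\<close>

lemma herm_diff: "herm (v - v') u = herm v u - herm v' u" "herm v (u - u') = herm v u - herm v u'"
  by (simp_all add: herm_def algebra_simps sum_subtractf)

lemma herm_scale: "herm (a *s v) u = a * herm v u" "herm v (a *s u) = cnj a * herm v u"
  by (simp_all add: herm_def algebra_simps sum_distrib_left)

lemma cnj_herm: "cnj (herm v u) = herm u v"
  by (simp add: herm_def mult.commute)

lemma bnorm_ge_1: "bnorm j x \<ge> 1"
  unfolding bnorm_def by (simp add: sum_nonneg)

lemma bnorm_pos: "bnorm j x > 0"
  using bnorm_ge_1[of j x] by linarith

lemma bnorm_nz [simp]: "bnorm j x \<noteq> 0" "complex_of_real (bnorm j x) \<noteq> 0"
  using bnorm_pos[of j x] by simp_all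

lemma herm_affine_lift: "herm (affine_lift j x) (affine_lift j x) = of_real (bnorm j x)"
proof -
  have "herm (affine_lift j x) (affine_lift j x) = 1 + (\<Sum>i\<in>UNIV - {j}. x $ i * cnj (x $ i))"
    unfolding herm_def by (subst sum.remove[of _ j]) (auto simp: affine_lift_nth intro!: sum.cong)
  then show ?thesis by (simp add: bnorm_def complex_norm_square del: of_real_power)
qed

lemma nu_eq: "nu j x v = (\<Sum>i\<in>UNIV. nuc j x i * v $ i)"
  unfolding nu_def herm_def sum_divide_distrib
  by (intro sum.cong) (auto simp: nuc_def bpart_def affine_lift_nth)

lemma xi_eq: "xi s j x v = (\<Sum>i\<in>UNIV. xic s j x i * v $ i)"
proof -
  have "(\<Sum>i\<in>UNIV. xic s j x i * v $ i) =
      (\<Sum>i\<in>UNIV. (if i = j then v $ j else 0) + of_int s * x $ j * (nuc j x i * v $ i))"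
    by (intro sum.cong) (auto simp: xic_def algebra_simps)
  also have "\<dots> = xi s j x v"
    by (simp add: sum.distrib xi_def nu_eq flip: sum_distrib_left)
  finally show ?thesis ..
qed

lemma sform_rank1:
  "(\<Sum>i\<in>UNIV. \<Sum>l\<in>UNIV. p i * cnj (q l) * v $ i * cnj (u $ l)) =
    (\<Sum>i\<in>UNIV. p i * v $ i) * cnj (\<Sum>l\<in>UNIV. q l * u $ l)"
  by (simp add: sum_product algebra_simps)

lemma fs_eq: "fs j x v u = (\<Sum>i\<in>UNIV. \<Sum>l\<in>UNIV. fsc j x i l * v $ i * cnj (u $ l))"
proof -
  have "(\<Sum>l\<in>UNIV. (if i = l \<and> i \<noteq> j then 1 / bnorm j x else 0) * v $ i * cnj (u $ l)) =
    bpart j v $ i * cnj (bpart j u $ i) / bnorm j x" for i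
    by (subst sum.remove[of _ i]) (auto simp: bpart_def intro!: sum.neutral)
  then have "(\<Sum>i\<in>UNIV. \<Sum>l\<in>UNIV. (if i = l \<and> i \<noteq> j then 1 / bnorm j x else 0) * v $ i * cnj (u $ l)) =
    herm (bpart j v) (bpart j u) / bnorm j x"
    by (simp add: herm_def sum_divide_distrib)
  then show ?thesis
    by (simp add: fs_def fsc_def left_diff_distrib sum_subtractf nu_eq sform_rank1)
qed

lemma sform_mmat: "sform (mmat s j a b x) v u = mform s j a b x v u"
proof -
  have "sform (mmat s j a b x) v u =
    (\<Sum>i\<in>UNIV. \<Sum>l\<in>UNIV. of_real a * (fsc j x i l * v $ i * cnj (u $ l))
      + of_real (b * bnorm j x powi s) * (xic s j x i * cnj (xic s j x l) * v $ i * cnj (u $ l)))"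
    unfolding sform_def mmat_def by (intro sum.cong) (simp_all add: algebra_simps)
  also have "\<dots> = mform s j a b x v u"
    by (simp only: sum.distrib sum_distrib_left[symmetric] sform_rank1 mform_def fs_eq xi_eq)
       (simp only: mult.assoc)
  finally show ?thesis .
qed

lemma sform_axis: "sform M (axis i 1) (axis l 1) = M $ i $ l"
  by (simp add: sform_def axis_def if_distrib[of "\<lambda>f. _ * f"] if_distrib[of cnj] cong: if_cong)

section \<open>Transition maps\<close>

text \<open>Unitary up to scale. The notion covers the unitary action (\<rho> = 1), plain coordinate
  changes (the identity matrix) and the scalar matrices that realise homotheties of the
  fibres.\<close>

definition similarity :: "complex^'n^'n \<Rightarrow> real \<Rightarrow> bool" where
  "similarity A \<rho> \<longleftrightarrow> 0 < \<rho> \<and> (\<forall>v u. herm (A *v v) (A *v u) = of_real \<rho> * herm v u)"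

text \<open>The action of a matrix from the chart over \<open>U\<^sub>j\<close> to the one over \<open>U\<^sub>j\<^sub>'\<close>, and its derivative. The
  fibre coordinate is homogeneous of degree \<open>s\<close> and gets inverted if \<open>s' = - s\<close>.\<close>

definition Tmap :: "int \<Rightarrow> int \<Rightarrow> 'n::finite \<Rightarrow> 'n \<Rightarrow> complex^'n^'n \<Rightarrow> complex^'n \<Rightarrow> complex^'n" where
  "Tmap s s' j j' A x = (let z = A *v affine_lift j x in
     \<chi> i. if i = j' then (if s = s' then z $ j' powi s * x $ j else inverse (z $ j' powi s * x $ j))
          else z $ i / z $ j')"

definition Dmap :: "int \<Rightarrow> int \<Rightarrow> 'n::finite \<Rightarrow> 'n \<Rightarrow> complex^'n^'n \<Rightarrow> complex^'n \<Rightarrow> complex^'n \<Rightarrow> complex^'n" where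
  "Dmap s s' j j' A x v = (let z = A *v affine_lift j x; p = A *v bpart j v; t = p $ j' / z $ j' in
     \<chi> i. if i = j' then (if s = s' then z $ j' powi s * (v $ j + of_int s * x $ j * t)
                          else - (v $ j + of_int s * x $ j * t) / (z $ j' powi s * (x $ j)\<^sup>2))
          else p $ i / z $ j' - t * (z $ i / z $ j'))"

context
  fixes A :: "complex^'n::finite^'n" and \<rho> :: real and s s' :: int and j j' :: 'n and x :: "complex^'n"
  assumes A: "similarity A \<rho>" and m: "(A *v affine_lift j x) $ j' \<noteq> 0"
begin

lemma lift_Tmap: "affine_lift j' (Tmap s s' j j' A x) =
    (1 / (A *v affine_lift j x) $ j') *s (A *v affine_lift j x)"
  using m by (simp add: vec_eq_iff affine_lift_nth Tmap_def Let_def)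

lemma bpart_Dmap: "bpart j' (Dmap s s' j j' A x v) =
    (1 / (A *v affine_lift j x) $ j') *s (A *v bpart j v)
    - ((A *v bpart j v) $ j' / (A *v affine_lift j x) $ j') *s affine_lift j' (Tmap s s' j j' A x)"
  using m by (simp add: vec_eq_iff affine_lift_nth Tmap_def Dmap_def bpart_def Let_def)

lemma bnorm_Tmap: "bnorm j' (Tmap s s' j j' A x) = \<rho> * bnorm j x / (norm ((A *v affine_lift j x) $ j'))\<^sup>2"
proof -
  let ?m = "(A *v affine_lift j x) $ j'"
  have "complex_of_real (bnorm j' (Tmap s s' j j' A x)) = of_real (\<rho> * bnorm j x) / (?m * cnj ?m)"
    using A by (simp add: herm_affine_lift[symmetric] lift_Tmap herm_scale similarity_def)
  also have "\<dots> = of_real (\<rho> * bnorm j x / (norm ?m)\<^sup>2)"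
    by (simp add: complex_norm_square del: of_real_power)
  finally show ?thesis using of_real_eq_iff by blast
qed

text \<open>\<open>nu\<close> is \<partial> log of the squared norm of the lift. The new lift is the
  image of the old one divided by the holomorphic function
  \<open>(A *v affine_lift j x) $ j'\<close>, so \<open>nu\<close> changes by minus the logarithmic
  derivative of that function.\<close>

lemma nu_Dmap: "nu j' (Tmap s s' j j' A x) (Dmap s s' j j' A x v) =
    nu j x v - (A *v bpart j v) $ j' / (A *v affine_lift j x) $ j'"
proof -
  let ?m = "(A *v affine_lift j x) $ j'"
  have "herm ((1 / ?m) *s (A *v bpart j v)) (affine_lift j' (Tmap s s' j j' A x)) =
    of_real \<rho> * herm (bpart j v) (affine_lift j x) / (?m * cnj ?m)"
    using A by (simp add: lift_Tmap herm_scale similarity_def)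
  also have "\<dots> = nu j x v * bnorm j' (Tmap s s' j j' A x)"
  proof -
    have "complex_of_real (bnorm j' (Tmap s s' j j' A x)) = of_real (\<rho> * bnorm j x) / (?m * cnj ?m)"
      by (simp add: bnorm_Tmap complex_norm_square del: of_real_power)
    then show ?thesis by (simp add: nu_def)
  qed
  finally show ?thesis
    by (subst nu_def) (simp add: bpart_Dmap herm_diff herm_scale herm_affine_lift diff_divide_distrib)
qed

text \<open>The Fubini-Study form comes from the log of the squared norm of the lift, to which a
  similarity followed by division by a holomorphic function only adds pluriharmonic terms.
  Concretely, the multiple \<open>t v\<close> of the lift cancels between the two terms of
  \<open>fs\<close>.\<close>

lemma fs_Dmap: "fs j' (Tmap s s' j j' A x) (Dmap s s' j j' A x v) (Dmap s s' j j' A x u) = fs j x v u"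
proof -
  let ?m = "(A *v affine_lift j x) $ j'" and ?x' = "Tmap s s' j j' A x"
  define t where "t = (\<lambda>v. (A *v bpart j v) $ j' / ?m)"
  define p where "p = (\<lambda>v. (1 / ?m) *s (A *v bpart j v))"
  have N': "complex_of_real (bnorm j' ?x') = of_real (\<rho> * bnorm j x) / (?m * cnj ?m)"
    by (simp add: bnorm_Tmap complex_norm_square del: of_real_power)
  have pl: "herm (p v) (affine_lift j' ?x') = nu j x v * bnorm j' ?x'" for v
    using A by (simp add: p_def lift_Tmap herm_scale similarity_def nu_def N') (simp add: ac_simps)
  then have lp: "herm (affine_lift j' ?x') (p v) = cnj (nu j x v) * bnorm j' ?x'" for v
    by (metis cnj_herm complex_cnj_mult complex_cnj_complex_of_real)
  have pp: "herm (p v) (p u) = herm (bpart j v) (bpart j u) / bnorm j x * bnorm j' ?x'"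
    using A by (simp add: p_def herm_scale similarity_def N') (simp add: ac_simps)
  have D: "bpart j' (Dmap s s' j j' A x v) = p v - t v *s affine_lift j' ?x'" for v
    by (simp add: bpart_Dmap p_def t_def)
  have n: "nu j' ?x' (Dmap s s' j j' A x v) = nu j x v - t v" for v
    by (simp add: nu_Dmap t_def)
  have nz: "complex_of_real (bnorm j' ?x') \<noteq> 0" by simp
  show ?thesis
    unfolding fs_def D n herm_diff herm_scale pl lp pp herm_affine_lift
    using nz by (simp add: field_simps del: bnorm_nz)
qed

lemma powi_norm: "norm (z powi i) = norm (z::complex) powi i"
  by (simp add: norm_power_int)

lemma wnorm_Tmap_same:
  assumes "s' = s"
  shows "wnorm s j' (Tmap s s' j j' A x) = \<rho> powi s * wnorm s j x"
proof -
  let ?m = "(A *v affine_lift j x) $ j'"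
  have "Tmap s s' j j' A x $ j' = ?m powi s * x $ j" using assms by (simp add: Tmap_def Let_def)
  then have n: "norm (Tmap s s' j j' A x $ j') = norm ?m powi s * norm (x $ j)" by (simp add: norm_mult powi_norm)
  define q where "q = norm ?m powi s"
  have q: "q \<noteq> 0" using m by (simp add: q_def)
  have "(\<rho> * bnorm j x / (norm ?m)\<^sup>2) powi s = \<rho> powi s * bnorm j x powi s / q\<^sup>2"
    by (simp add: power_int_divide_distrib power_int_mult_distrib power2_eq_square q_def)
  then show ?thesis using q unfolding wnorm_def bnorm_Tmap n q_def[symmetric]
    by (simp add: power2_eq_square)
qed

text \<open>The connection form \<open>xi\<close> is multiplied by the transition function of the
  line bundle, a power with exponent \<open>s\<close>; the weight \<open>bnorm powi s\<close> undoes
  its squared norm up to \<open>\<rho> powi s\<close>.\<close>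

lemma mform_Dmap_same:
  assumes "s' = s"
  shows "mform s j' a b (Tmap s s' j j' A x) (Dmap s s' j j' A x v) (Dmap s s' j j' A x u) =
    mform s j a (\<rho> powi s * b) x v u"
proof -
  let ?m = "(A *v affine_lift j x) $ j'" and ?x' = "Tmap s s' j j' A x"
  have T: "?x' $ j' = ?m powi s * x $ j" using assms by (simp add: Tmap_def Let_def)
  have xi: "xi s j' ?x' (Dmap s s' j j' A x v) = ?m powi s * xi s j x v" for v
    unfolding xi_def nu_Dmap T using assms by (simp add: Dmap_def Let_def algebra_simps)
  have "complex_of_real (bnorm j' ?x' powi s) * (?m powi s * cnj (?m powi s)) = of_real (\<rho> powi s * bnorm j x powi s)"
  proof -
    have "?m powi s * cnj (?m powi s) = of_real ((norm ?m powi s)\<^sup>2)"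
      by (simp add: complex_norm_square powi_norm[symmetric] del: of_real_power)
    moreover have "bnorm j' ?x' powi s * (norm ?m powi s)\<^sup>2 = \<rho> powi s * bnorm j x powi s"
      using m by (simp add: bnorm_Tmap power_int_divide_distrib power_int_mult_distrib power2_eq_square)
    ultimately show ?thesis by (metis of_real_mult)
  qed
  then show ?thesis unfolding mform_def fs_Dmap xi by (simp add: algebra_simps)
qed

lemma wnorm_Tmap_opp:
  assumes "s' = - s" "s \<noteq> 0" "x $ j \<noteq> 0"
  shows "wnorm s' j' (Tmap s s' j j' A x) = 1 / (\<rho> powi s * wnorm s j x)"
proof -
  let ?m = "(A *v affine_lift j x) $ j'"
  have "Tmap s s' j j' A x $ j' = inverse (?m powi s * x $ j)" using assms by (simp add: Tmap_def Let_def)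
  then have n: "norm (Tmap s s' j j' A x $ j') = inverse (norm ?m powi s * norm (x $ j))"
    by (simp add: norm_mult norm_inverse powi_norm)
  define q where "q = norm ?m powi s"
  have q: "q \<noteq> 0" using m by (simp add: q_def)
  have "(\<rho> * bnorm j x / (norm ?m)\<^sup>2) powi s' = q\<^sup>2 / (\<rho> powi s * bnorm j x powi s)"
    by (simp add: assms power_int_minus power_int_divide_distrib power_int_mult_distrib power2_eq_square q_def)
  then show ?thesis using q assms unfolding wnorm_def bnorm_Tmap n q_def[symmetric]
    by (simp add: power2_eq_square divide_simps)
qed

text \<open>Inverting the fibre coordinate acts on \<open>xi\<close> as in d (1 / y) = - dy / y^2.
  The squared norm of this factor, together with the weight of opposite sign, accounts for
  \<open>(wnorm s j x)\<^sup>2\<close>.\<close>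

lemma mform_Dmap_opp:
  assumes "s' = - s" "s \<noteq> 0" "x $ j \<noteq> 0"
  shows "mform s' j' a b (Tmap s s' j j' A x) (Dmap s s' j j' A x v) (Dmap s s' j j' A x u) =
    mform s j a (b / (\<rho> powi s * (wnorm s j x)\<^sup>2)) x v u"
proof -
  let ?m = "(A *v affine_lift j x) $ j'" and ?x' = "Tmap s s' j j' A x"
  have T: "?x' $ j' = inverse (?m powi s * x $ j)" using assms by (simp add: Tmap_def Let_def)
  have mz: "?m powi s \<noteq> 0" using m by simp
  have xi: "xi s' j' ?x' (Dmap s s' j j' A x v) = - xi s j x v / (?m powi s * (x $ j)\<^sup>2)" for v
    unfolding xi_def nu_Dmap T using assms mz
    by (simp add: Dmap_def Let_def field_simps power2_eq_square)
  have "of_real (bnorm j' ?x' powi s') / ((?m powi s * (x $ j)\<^sup>2) * cnj (?m powi s * (x $ j)\<^sup>2)) =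
    complex_of_real (bnorm j x powi s / (\<rho> powi s * (wnorm s j x)\<^sup>2))"
  proof -
    have "(?m powi s * (x $ j)\<^sup>2) * cnj (?m powi s * (x $ j)\<^sup>2) = of_real ((norm ?m powi s * (norm (x $ j))\<^sup>2)\<^sup>2)"
      by (simp add: complex_norm_square[symmetric] powi_norm[symmetric] norm_mult norm_power del: complex_cnj_mult)
    moreover have "bnorm j' ?x' powi s' / (norm ?m powi s * (norm (x $ j))\<^sup>2)\<^sup>2 =
        bnorm j x powi s / (\<rho> powi s * (wnorm s j x)\<^sup>2)"
      using m assms A bnorm_pos[of j x] unfolding wnorm_def bnorm_Tmap
      by (simp add: similarity_def power_int_divide_distrib power_int_mult_distrib power2_eq_square power_int_minus field_simps)
    ultimately show ?thesis by (metis of_real_divide)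
  qed
  then have "of_real b * (of_real (bnorm j' ?x' powi s') / ((?m powi s * (x $ j)\<^sup>2) * cnj (?m powi s * (x $ j)\<^sup>2)))
      * xi s j x v * cnj (xi s j x u) =
    of_real (b / (\<rho> powi s * (wnorm s j x)\<^sup>2) * bnorm j x powi s) * xi s j x v * cnj (xi s j x u)"
    by simp
  then show ?thesis unfolding mform_def fs_Dmap xi by simp
qed

end

section \<open>Determinants\<close>

lemma det_replace_row: "det (\<chi> i. if i = j then z else axis i (1::complex)) = z $ j"
proof -
  have "row i (mat 1) = axis i (1::complex)" for i :: 'a
    by (simp add: vec_eq_iff row_def mat_def axis_def)
  moreover have "z = (\<Sum>i\<in>UNIV. z $ i *s axis i (1::complex))"
    by (simp add: vec_eq_iff axis_def if_distrib[of "\<lambda>f. _ * f"] cong: if_cong)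
  ultimately show ?thesis using cramer_lemma_transpose[of j z "mat 1 :: complex^'a^'a"] by (simp cong: if_cong)
qed

lemma det_replace_column:
  assumes "c \<noteq> (0::complex)"
  shows "det (\<chi> i l. if l = j then p $ i else if i = l then c else 0 :: complex^'n::finite^'n)
    = p $ j * c ^ (CARD('n) - 1)"
proof -
  define M :: "complex^'n^'n" where "M = (\<chi> i l. if i = l then c else 0)"
  have "det M = (\<Prod>i\<in>UNIV. M $ i $ i)" by (rule det_diagonal) (simp add: M_def)
  then have d: "det M = c ^ CARD('n)" by (simp add: M_def)
  have "(M *v ((1/c) *s p)) = p"
    using assms by (simp add: vec_eq_iff M_def matrix_vector_mult_def if_distrib[of "\<lambda>f. f * _"]
        if_distrib[of "\<lambda>f. f / _"] cong: if_cong)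
  with cramer_lemma[of j M "(1/c) *s p"] d have "det (\<chi> i l. if l = j then p $ i else M $ i $ l) = p $ j / c * c ^ CARD('n)"
    by (simp cong: if_cong)
  moreover have "c ^ CARD('n) = c * c ^ (CARD('n) - 1)" by (simp flip: power_Suc)
  ultimately show ?thesis using assms by (simp add: M_def cong: if_cong)
qed

text \<open>The matrix determinant lemma. Replacing row \<open>j\<close> of the identity by
  \<open>z\<close> gives \<open>P\<close> of determinant \<open>z $ j\<close> = 1, which conjugates
  the matrix to \<open>R\<close>; that one differs from a scalar matrix only in column
  \<open>j\<close>, where Cramer's rule evaluates the determinant.\<close>

lemma det_scalar_plus_rank1:
  fixes z u :: "complex^'n::finite"
  assumes "c \<noteq> 0" "z $ j = 1"
  shows "det (\<chi> i l. (if i = l then c else 0) + u $ i * z $ l) = (c + (\<Sum>i\<in>UNIV. z $ i * u $ i)) * c ^ (CARD('n) - 1)"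
proof -
  define P :: "complex^'n^'n" where "P = (\<chi> i. if i = j then z else axis i 1)"
  define Q :: "complex^'n^'n" where "Q = (\<chi> i l. (if i = l then c else 0) + u $ i * z $ l)"
  define p where "p = (\<chi> i. (if i = j then c else 0) + (P *v u) $ i)"
  define R :: "complex^'n^'n" where "R = (\<chi> i l. if l = j then p $ i else if i = l then c else 0)"
  have P_row: "(\<Sum>m\<in>UNIV. P $ i $ m * f m) = (if i = j then \<Sum>m\<in>UNIV. z $ m * f m else f i)" for i f
    by (simp add: P_def axis_def if_distrib[of "\<lambda>f. f * _"] cong: if_cong)
  have "P ** Q = R ** P"
  proof -
    have "(P ** Q) $ i $ l = (R ** P) $ i $ l" for i l
    proof -
      have 1: "(P ** Q) $ i $ l = (P $ i $ l) * c + (P *v u) $ i * z $ l"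
      proof -
        have "(P ** Q) $ i $ l = (\<Sum>m\<in>UNIV. P $ i $ m * (if m = l then c else 0) + P $ i $ m * u $ m * z $ l)"
          by (simp add: matrix_matrix_mult_def Q_def algebra_simps)
        then show ?thesis by (simp add: sum.distrib matrix_vector_mult_def sum_distrib_right if_distrib[of "\<lambda>f. _ * f"] cong: if_cong)
      qed
      have 2: "(R ** P) $ i $ l = p $ i * z $ l + (\<Sum>m\<in>UNIV - {j}. (if i = m then c else 0) * axis m 1 $ l)"
        unfolding matrix_matrix_mult_def
        by (simp, subst sum.remove[of _ j]) (auto simp: R_def P_def intro!: sum.cong)
      have 3: "(\<Sum>m\<in>UNIV - {j}. (if i = m then c else 0) * axis m 1 $ l) = (if i = j then 0 else c * axis i 1 $ l)"
        by (simp add: if_distrib[of "\<lambda>f. f * _"] cong: if_cong)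
      show ?thesis unfolding 1 2 3 by (simp add: p_def P_def algebra_simps)
    qed
    then show ?thesis by (simp add: vec_eq_iff)
  qed
  then have "det P * det Q = det R * det P" by (metis det_mul)
  moreover have "det P = 1" unfolding P_def using assms by (simp add: det_replace_row)
  moreover have "det R = p $ j * c ^ (CARD('n) - 1)" unfolding R_def by (rule det_replace_column[OF assms(1)])
  moreover have "p $ j = c + (\<Sum>i\<in>UNIV. z $ i * u $ i)"
    by (simp add: p_def P_row matrix_vector_mult_def)
  ultimately show ?thesis by (simp add: Q_def)
qed

lemma det_lift:
  fixes z r :: "complex^'n::finite"
  assumes "z $ j = 1" "r $ j = 1"
  shows "det (\<chi> i m. (if i = m \<and> i \<noteq> j then 1 else 0) + r $ i * z $ m) = 1"
proof -
  define P :: "complex^'n^'n" where "P = (\<chi> i. if i = j then z else axis i 1)"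
  define Q :: "complex^'n^'n" where "Q = (\<chi> i l. if l = j then r $ i else if i = l then 1 else 0)"
  have "(Q ** P) $ i $ m = (if i = m \<and> i \<noteq> j then 1 else 0) + r $ i * z $ m" for i m
  proof -
    have "(Q ** P) $ i $ m = r $ i * z $ m + (\<Sum>l\<in>UNIV - {j}. (if i = l then 1 else 0) * axis l 1 $ m)"
      unfolding matrix_matrix_mult_def
      by (simp, subst sum.remove[of _ j]) (auto simp: Q_def P_def intro!: sum.cong)
    also have "(\<Sum>l\<in>UNIV - {j}. (if i = l then 1 else 0) * axis l (1::complex) $ m) = (if i = j then 0 else axis i 1 $ m)"
      by (simp add: if_distrib[of "\<lambda>f. f * _"] cong: if_cong)
    finally show ?thesis by (auto simp: axis_def)
  qed
  then have "(\<chi> i m. (if i = m \<and> i \<noteq> j then 1 else 0) + r $ i * z $ m) = Q ** P" by (simp add: vec_eq_iff)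
  moreover have "det Q = 1" unfolding Q_def by (subst det_replace_column) (use assms in auto)
  moreover have "det P = 1" unfolding P_def using assms by (simp add: det_replace_row)
  ultimately show ?thesis by (simp add: det_mul)
qed

text \<open>The matrix factors as \<open>P ** Q ** transpose P'\<close>, where \<open>P'\<close> is
  the conjugate of \<open>P\<close>, both have determinant 1 by \<open>det_lift\<close>, and
  \<open>Q\<close> is a scalar matrix plus one of rank one. \<open>P\<close> sends the conjugate of
  the lift to \<open>bnorm\<close> times \<open>xic\<close>, and its product with its adjoint is
  \<open>bnorm\<close> times the sum of \<open>fsc\<close> and the rank one matrix of
  \<open>xic\<close>.\<close>

lemma det_mmat:
  fixes x :: "complex^'n::finite"
  assumes "a > 0"
  shows "det (mmat s j a b x) = of_real (a ^ (CARD('n) - 1) * b * bnorm j x powi (s - int CARD('n)))"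
proof -
  let ?N = "complex_of_real (bnorm j x)" and ?z = "affine_lift j x"
  \<comment> \<open>The scalar part of \<open>Q\<close> puts the coefficient \<open>a\<close> on the
    \<open>xic\<close> term instead of \<open>b * bnorm powi s\<close>; the rank one part corrects
    this, and the division by the square of \<open>?N\<close> cancels what \<open>P\<close>
    produces.\<close>
  define C where "C = (of_real (b * bnorm j x powi s) - of_real a) / ?N\<^sup>2"
  define r where "r = (\<chi> i. xic s j x i - nuc j x i)"
  define P :: "complex^'n^'n" where "P = (\<chi> i m. (if i = m \<and> i \<noteq> j then 1 else 0) + r $ i * ?z $ m)"
  define P' :: "complex^'n^'n" where "P' = (\<chi> i m. (if i = m \<and> i \<noteq> j then 1 else 0) + (\<chi> i. cnj (r $ i)) $ i * (\<chi> i. cnj (?z $ i)) $ m)"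
  define Q :: "complex^'n^'n" where "Q = (\<chi> i l. (if i = l then of_real a / ?N else 0) + (\<chi> i. C * cnj (?z $ i)) $ i * ?z $ l)"
  have zj: "?z $ j = 1" and rj: "r $ j = 1" by (simp_all add: affine_lift_nth r_def xic_def nuc_def)
  have nz: "?N \<noteq> 0" by simp
  have "(P ** Q ** transpose P') $ i $ l = mmat s j a b x $ i $ l" for i l
  proof -
    have Pz: "(\<Sum>m\<in>UNIV. P $ i $ m * cnj (?z $ m)) = xic s j x i * ?N" for i
    proof -
      have "(\<Sum>m\<in>UNIV. P $ i $ m * cnj (?z $ m)) =
          (\<Sum>m\<in>UNIV. (if i = m then if i = j then 0 else cnj (?z $ i) else 0) + r $ i * (?z $ m * cnj (?z $ m)))"
        by (intro sum.cong) (auto simp: P_def algebra_simps)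
      also have "\<dots> = (if i = j then 0 else cnj (?z $ i)) + r $ i * ?N"
        by (simp add: sum.distrib herm_affine_lift[symmetric] herm_def flip: sum_distrib_left)
      also have "\<dots> = xic s j x i * ?N"
        by (auto simp: r_def nuc_def affine_lift_nth algebra_simps)
      finally show ?thesis .
    qed
    have P': "P' $ l $ m = cnj (P $ l $ m)" for l m by (simp add: P'_def P_def)
    have PP: "(\<Sum>m\<in>UNIV. P $ i $ m * P' $ l $ m) = ?N * (fsc j x i l + xic s j x i * cnj (xic s j x l))"
    proof -
      have "P' $ l $ m = (if l = m then if l = j then 0 else 1 else 0) + cnj (r $ l) * cnj (?z $ m)" for m
        by (simp add: P'_def)
      then have "(\<Sum>m\<in>UNIV. P $ i $ m * P' $ l $ m) =
          (if l = j then 0 else P $ i $ l) + cnj (r $ l) * (\<Sum>m\<in>UNIV. P $ i $ m * cnj (?z $ m))"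
        by (simp add: distrib_left sum.distrib if_distrib[of "\<lambda>f. _ * f"] sum_distrib_left algebra_simps cong: if_cong)
      also have "\<dots> = ?N * (fsc j x i l + xic s j x i * cnj (xic s j x l))"
        unfolding Pz by (auto simp: P_def fsc_def r_def affine_lift_nth field_simps nuc_def xic_def)
      finally show ?thesis .
    qed
    have "(P ** Q ** transpose P') $ i $ l = (\<Sum>m'\<in>UNIV. (\<Sum>m\<in>UNIV. P $ i $ m * Q $ m $ m') * P' $ l $ m')"
      by (simp add: matrix_matrix_mult_def transpose_def)
    also have "(\<lambda>m'. \<Sum>m\<in>UNIV. P $ i $ m * Q $ m $ m') = (\<lambda>m'. of_real a / ?N * P $ i $ m' + C * xic s j x i * ?N * ?z $ m')"
    proof
      fix m'
      have "(\<Sum>m\<in>UNIV. P $ i $ m * Q $ m $ m') =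
         (\<Sum>m\<in>UNIV. (if m = m' then of_real a / ?N * P $ i $ m' else 0) + C * ?z $ m' * (P $ i $ m * cnj (?z $ m)))"
        by (intro sum.cong) (auto simp: Q_def algebra_simps)
      then show "(\<Sum>m\<in>UNIV. P $ i $ m * Q $ m $ m') = of_real a / ?N * P $ i $ m' + C * xic s j x i * ?N * ?z $ m'"
        by (simp add: sum.distrib Pz algebra_simps flip: sum_distrib_left)
    qed
    also have "(\<Sum>m'\<in>UNIV. (of_real a / ?N * P $ i $ m' + C * xic s j x i * ?N * ?z $ m') * P' $ l $ m') =
       of_real a / ?N * (\<Sum>m\<in>UNIV. P $ i $ m * P' $ l $ m) + C * xic s j x i * ?N * cnj (\<Sum>m\<in>UNIV. P $ l $ m * cnj (?z $ m))"
      unfolding P' by (simp add: distrib_right sum.distrib sum_distrib_left algebra_simps)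
    also have "\<dots> = mmat s j a b x $ i $ l"
      unfolding PP Pz by (simp add: mmat_def C_def field_simps power2_eq_square)
    finally show ?thesis .
  qed
  then have "mmat s j a b x = P ** Q ** transpose P'" by (simp add: vec_eq_iff)
  moreover have "det P = 1" unfolding P_def by (rule det_lift[OF zj rj])
  moreover have "det P' = 1" unfolding P'_def by (rule det_lift) (simp_all add: zj rj)
  moreover have "det Q = (of_real a / ?N + C * ?N) * (of_real a / ?N) ^ (CARD('n) - 1)"
  proof -
    have "(\<Sum>i\<in>UNIV. ?z $ i * (\<chi> i. C * cnj (?z $ i)) $ i) = C * ?N"
      by (simp add: herm_affine_lift[symmetric] herm_def sum_distrib_left algebra_simps)
    then show ?thesis unfolding Q_def by (subst det_scalar_plus_rank1[OF _ zj]) (use assms in auto)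
  qed
  ultimately have "det (mmat s j a b x) = (of_real a / ?N + C * ?N) * (of_real a / ?N) ^ (CARD('n) - 1)"
    by (simp add: det_mul det_transpose)
  also have "of_real a / ?N + C * ?N = of_real (b * bnorm j x powi s) / ?N"
    by (simp add: C_def field_simps power2_eq_square)
  also have "of_real (b * bnorm j x powi s) / ?N * (of_real a / ?N) ^ (CARD('n) - 1) =
    of_real (b * bnorm j x powi s * a ^ (CARD('n) - 1) / (bnorm j x ^ CARD('n)))"
  proof -
    have "?N ^ CARD('n) = ?N * ?N ^ (CARD('n) - 1)" by (simp flip: power_Suc)
    then show ?thesis by (simp add: power_divide)
  qed
  also have "b * bnorm j x powi s * a ^ (CARD('n) - 1) / (bnorm j x ^ CARD('n)) =
     a ^ (CARD('n) - 1) * b * bnorm j x powi (s - int CARD('n))"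
    by (simp add: power_int_diff)
  finally show ?thesis .
qed

section \<open>Derivatives of the invariant forms\<close>

lemma cnj_nuc: "cnj (nuc j x i) = (if i = j then 0 else x $ i / bnorm j x)"
  by (simp add: nuc_def)

lemma cnj_fsc: "cnj (fsc j x i l) = fsc j x l i"
  by (auto simp: fsc_def)

lemma has_wirt_bnorm:
  "has_wirt (\<lambda>x. of_real (bnorm j x)) (\<lambda>m. bnorm j x * nuc j x m) (\<lambda>m. bnorm j x * cnj (nuc j x m)) x"
proof -
  have "has_wirt (\<lambda>x. 1 + (\<Sum>i\<in>UNIV - {j}. x $ i * cnj (x $ i)))
     (\<lambda>m. 0 + (\<Sum>i\<in>UNIV - {j}. x $ i * cnj 0 + (if m = i then 1 else 0) * cnj (x $ i)))
     (\<lambda>m. 0 + (\<Sum>i\<in>UNIV - {j}. x $ i * cnj (if m = i then 1 else 0) + 0 * cnj (x $ i))) x"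
    by (intro has_wirt_add has_wirt_sum has_wirt_mult has_wirt_const has_wirt_cnj has_wirt_nth)
  moreover have "(\<lambda>m. 0 + (\<Sum>i\<in>UNIV - {j}. x $ i * cnj 0 + (if m = i then 1 else 0) * cnj (x $ i))) =
      (\<lambda>m. bnorm j x * nuc j x m)"
    by (rule ext) (simp add: nuc_def if_distrib[of "\<lambda>f. f * _"] cong: if_cong)
  moreover have "(\<lambda>m. 0 + (\<Sum>i\<in>UNIV - {j}. x $ i * cnj (if m = i then 1 else 0) + 0 * cnj (x $ i))) =
      (\<lambda>m. bnorm j x * cnj (nuc j x m))"
    by (rule ext) (simp add: nuc_def if_distrib[of "\<lambda>f. _ * f"] if_distrib[of cnj] cong: if_cong)
  moreover have "(\<lambda>x. 1 + (\<Sum>i\<in>UNIV - {j}. x $ i * cnj (x $ i))) = (\<lambda>x. of_real (bnorm j x))"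
    by (rule ext) (simp add: bnorm_def complex_norm_square del: of_real_power)
  ultimately show ?thesis by simp
qed

lemma has_wirt_powi:
  "has_wirt (\<lambda>x. of_real (bnorm j x powi s)) (\<lambda>m. of_int s * of_real (bnorm j x powi s) * nuc j x m)
     (\<lambda>m. of_int s * of_real (bnorm j x powi s) * cnj (nuc j x m)) x"
proof -
  have "((\<lambda>t. t powi s) has_real_derivative of_int s * bnorm j x powi (s - 1)) (at (bnorm j x))"
    using bnorm_pos[of j x] by (auto intro!: derivative_eq_intros)
  from has_wirt_of_real[OF has_wirt_bnorm this] show ?thesis
    by (rule has_wirt_cong) (auto simp: power_int_diff)
qed

text \<open>The antiholomorphic part exhibits the Fubini-Study components as the mixed second
  derivatives of log \<open>bnorm\<close>.\<close>

lemma has_wirt_nuc: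
  "has_wirt (\<lambda>x. nuc j x i) (\<lambda>m. - nuc j x i * nuc j x m) (\<lambda>m. fsc j x i m) x"
proof (cases "i = j")
  case True
  then show ?thesis using has_wirt_const[of 0] by (simp add: nuc_def fsc_def)
next
  case False
  have "has_wirt (\<lambda>x. cnj (x $ i) * inverse (of_real (bnorm j x)))
    (\<lambda>m. cnj (x $ i) * (- (bnorm j x * nuc j x m) / (of_real (bnorm j x))\<^sup>2) + cnj 0 * inverse (of_real (bnorm j x)))
    (\<lambda>m. cnj (x $ i) * (- (bnorm j x * cnj (nuc j x m)) / (of_real (bnorm j x))\<^sup>2) + cnj (if m = i then 1 else 0) * inverse (of_real (bnorm j x))) x"
    by (intro has_wirt_mult has_wirt_cnj has_wirt_nth has_wirt_inverse has_wirt_bnorm) simp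
  then have "has_wirt (\<lambda>x. nuc j x i)
    (\<lambda>m. cnj (x $ i) * (- (bnorm j x * nuc j x m) / (of_real (bnorm j x))\<^sup>2) + cnj 0 * inverse (of_real (bnorm j x)))
    (\<lambda>m. cnj (x $ i) * (- (bnorm j x * cnj (nuc j x m)) / (of_real (bnorm j x))\<^sup>2) + cnj (if m = i then 1 else 0) * inverse (of_real (bnorm j x))) x"
    using False by (simp add: nuc_def divide_inverse)
  then show ?thesis
    by (rule has_wirt_cong)
       (use False in \<open>auto simp: fun_eq_iff fsc_def nuc_def power2_eq_square field_simps\<close>)
qed

lemma has_wirt_cnj_nuc:
  "has_wirt (\<lambda>x. cnj (nuc j x i)) (\<lambda>m. fsc j x m i) (\<lambda>m. - cnj (nuc j x i) * cnj (nuc j x m)) x"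
  using has_wirt_cnj[OF has_wirt_nuc] by (rule has_wirt_cong) (auto simp: cnj_fsc)

lemma wnorm_complex: "complex_of_real (wnorm s j x) = x $ j * cnj (x $ j) * of_real (bnorm j x powi s)"
  by (simp add: wnorm_def complex_norm_square del: of_real_power)

lemma wnorm_nonneg: "wnorm s j x \<ge> 0"
  using bnorm_pos[of j x] by (simp add: wnorm_def)

lemma has_wirt_wnorm:
  "has_wirt (\<lambda>x. of_real (wnorm s j x)) (\<lambda>m. of_real (bnorm j x powi s) * cnj (x $ j) * xic s j x m)
     (\<lambda>m. of_real (bnorm j x powi s) * x $ j * cnj (xic s j x m)) x"
  unfolding wnorm_complex
  by (rule has_wirt_cong[OF has_wirt_mult[OF has_wirt_mult[OF has_wirt_nth has_wirt_cnj[OF has_wirt_nth]] has_wirt_powi]])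
     (auto simp: fun_eq_iff xic_def algebra_simps cnj_nuc)

lemma has_wirt_xic:
  "has_wirt (\<lambda>x. xic s j x i)
     (\<lambda>m. of_int s * (if m = j then nuc j x i else 0) - of_int s * x $ j * nuc j x i * nuc j x m)
     (\<lambda>m. of_int s * x $ j * fsc j x i m) x"
  unfolding xic_def
  by (rule has_wirt_cong[OF has_wirt_add[OF has_wirt_const has_wirt_mult[OF has_wirt_mult[OF has_wirt_const has_wirt_nth] has_wirt_nuc]]])
     (auto simp: fun_eq_iff algebra_simps)

lemma has_wirt_cnj_xic:
  "has_wirt (\<lambda>x. cnj (xic s j x i))
     (\<lambda>m. of_int s * cnj (x $ j) * fsc j x m i)
     (\<lambda>m. of_int s * (if m = j then cnj (nuc j x i) else 0) - of_int s * cnj (x $ j) * cnj (nuc j x i) * cnj (nuc j x m)) x"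
  using has_wirt_cnj[OF has_wirt_xic] by (rule has_wirt_cong) (auto simp: fun_eq_iff cnj_fsc)

lemma has_wirt_fsc:
  "has_wirt (\<lambda>x. fsc j x i l) (\<lambda>m. - nuc j x m * fsc j x i l - nuc j x i * fsc j x m l)
     (\<lambda>m. - cnj (nuc j x m) * fsc j x i l - cnj (nuc j x l) * fsc j x i m) x"
proof -
  define c :: complex where "c = (if i = l \<and> i \<noteq> j then 1 else 0)"
  have 1: "(\<lambda>x. fsc j x i l) = (\<lambda>x. c * inverse (of_real (bnorm j x)) - nuc j x i * cnj (nuc j x l))"
    by (auto simp: fsc_def c_def divide_inverse)
  have 2: "fsc j x i l = c * inverse (of_real (bnorm j x)) - nuc j x i * cnj (nuc j x l)"
    using 1 by metis
  have nz: "complex_of_real (bnorm j x) \<noteq> 0" by simp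
  show ?thesis unfolding 1
    by (rule has_wirt_cong[OF has_wirt_diff[OF has_wirt_mult[OF has_wirt_const has_wirt_inverse[OF has_wirt_bnorm nz]]
          has_wirt_mult[OF has_wirt_nuc has_wirt_cnj_nuc]]])
       (use nz in \<open>auto simp: fun_eq_iff 2 power2_eq_square divide_inverse algebra_simps\<close>)
qed

lemma has_wirt_wnorm_fun:
  assumes "(h has_real_derivative h') (at (wnorm s j x))"
  shows "has_wirt (\<lambda>x. of_real (h (wnorm s j x)))
     (\<lambda>m. of_real (h' * bnorm j x powi s) * cnj (x $ j) * xic s j x m)
     (\<lambda>m. of_real (h' * bnorm j x powi s) * x $ j * cnj (xic s j x m)) x"
  using has_wirt_of_real[OF has_wirt_wnorm assms] by (rule has_wirt_cong) (auto simp: fun_eq_iff)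

lemma has_wirt_mmat:
  assumes a: "(a has_real_derivative a') (at (wnorm s j x))" and b: "(b has_real_derivative b') (at (wnorm s j x))"
  shows "\<exists>q. has_wirt (\<lambda>x. mmat s j (a (wnorm s j x)) (b (wnorm s j x)) x $ i $ l)
    (\<lambda>m. of_real (a' * bnorm j x powi s) * cnj (x $ j) * xic s j x m * fsc j x i l
       + of_real (a (wnorm s j x)) * (- nuc j x m * fsc j x i l - nuc j x i * fsc j x m l)
       + of_real (b' * bnorm j x powi s * bnorm j x powi s) * cnj (x $ j) * xic s j x m * xic s j x i * cnj (xic s j x l)
       + of_real (b (wnorm s j x) * bnorm j x powi s) * of_int s *
           (nuc j x m * xic s j x i * cnj (xic s j x l)
            + (if m = j then nuc j x i else 0) * cnj (xic s j x l)
            - x $ j * nuc j x i * nuc j x m * cnj (xic s j x l)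
            + cnj (x $ j) * xic s j x i * fsc j x m l)) q x"
proof -
  have eq: "(\<lambda>x. mmat s j (a (wnorm s j x)) (b (wnorm s j x)) x $ i $ l) =
    (\<lambda>x. of_real (a (wnorm s j x)) * fsc j x i l
     + of_real (b (wnorm s j x)) * of_real (bnorm j x powi s) * xic s j x i * cnj (xic s j x l))"
    by (simp add: mmat_def)
  note 1 = has_wirt_add[OF has_wirt_mult[OF has_wirt_wnorm_fun[OF a] has_wirt_fsc[of j i l]]
      has_wirt_mult[OF has_wirt_mult[OF has_wirt_mult[OF has_wirt_wnorm_fun[OF b] has_wirt_powi] has_wirt_xic[of s j i]]
          has_wirt_cnj_xic[of s j l]]]
  show ?thesis unfolding eq
    by (rule exI, rule has_wirt_cong[OF 1 _ refl]) (auto simp: fun_eq_iff algebra_simps)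
qed

text \<open>The relation \<open>a' = s b\<close> is the closedness of the Kaehler form.\<close>

lemma mmat_closed:
  assumes a: "(a has_real_derivative of_int s * b (wnorm s j x)) (at (wnorm s j x))"
    and b: "(b has_real_derivative b') (at (wnorm s j x))"
  shows "wirt m (\<lambda>x. mmat s j (a (wnorm s j x)) (b (wnorm s j x)) x $ i $ l) x =
         wirt i (\<lambda>x. mmat s j (a (wnorm s j x)) (b (wnorm s j x)) x $ m $ l) x"
proof -
  have w: "wirt m (\<lambda>x. mmat s j (a (wnorm s j x)) (b (wnorm s j x)) x $ i $ l) x =
      of_real (of_int s * b (wnorm s j x) * bnorm j x powi s) * cnj (x $ j) * xic s j x m * fsc j x i l
       + of_real (a (wnorm s j x)) * (- nuc j x m * fsc j x i l - nuc j x i * fsc j x m l)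
       + of_real (b' * bnorm j x powi s * bnorm j x powi s) * cnj (x $ j) * xic s j x m * xic s j x i * cnj (xic s j x l)
       + of_real (b (wnorm s j x) * bnorm j x powi s) * of_int s *
           (nuc j x m * xic s j x i * cnj (xic s j x l)
            + (if m = j then nuc j x i else 0) * cnj (xic s j x l)
            - x $ j * nuc j x i * nuc j x m * cnj (xic s j x l)
            + cnj (x $ j) * xic s j x i * fsc j x m l)" for i m
    using has_wirt_mmat[OF a b, of i l] has_wirt_eqs(1) by blast
  show ?thesis unfolding w by (simp add: xic_def algebra_simps)
qed

lemma has_wirt_potential:
  assumes V: "(V has_real_derivative V' (wnorm s j x)) (at (wnorm s j x))"
  shows "has_wirt (\<lambda>x. of_real (c * ln (bnorm j x) + V (wnorm s j x)))
     (\<lambda>m. of_real c * nuc j x m + of_real (V' (wnorm s j x) * bnorm j x powi s) * cnj (x $ j) * xic s j x m)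
     (\<lambda>m. of_real c * cnj (nuc j x m) + of_real (V' (wnorm s j x) * bnorm j x powi s) * x $ j * cnj (xic s j x m)) x"
proof -
  have "((\<lambda>t. c * ln t) has_real_derivative c / bnorm j x) (at (bnorm j x))"
    using bnorm_pos[of j x] by (auto intro!: derivative_eq_intros)
  from has_wirt_add[OF has_wirt_of_real[OF has_wirt_bnorm this] has_wirt_wnorm_fun[OF V]] show ?thesis
    unfolding of_real_add by (rule has_wirt_cong) (auto simp: fun_eq_iff)
qed

text \<open>Differentiates the antiholomorphic derivatives of \<open>has_wirt_potential\<close> once
  more. A potential c log \<open>bnorm\<close> + V(\<open>wnorm\<close>) thus gives an invariant
  tensor with base component c + s w V' and fibre component (w V')'. It is applied to the Ricci
  potential after the soliton potential has been split off.\<close>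

lemma has_wirt_potential2:
  assumes V': "(V' has_real_derivative V'') (at (wnorm s j x))"
    and a: "a = c + s * wnorm s j x * V' (wnorm s j x)"
    and b: "b = V' (wnorm s j x) + wnorm s j x * V''"
  shows "\<exists>q. has_wirt (\<lambda>x. of_real c * cnj (nuc j x l) +
        of_real (V' (wnorm s j x) * bnorm j x powi s) * x $ j * cnj (xic s j x l))
      (\<lambda>m. mmat s j a b x $ m $ l) q x"
proof -
  note 1 = has_wirt_add[OF has_wirt_mult[OF has_wirt_const has_wirt_cnj_nuc[of j l]]
     has_wirt_mult[OF has_wirt_mult[OF has_wirt_mult[OF has_wirt_wnorm_fun[OF V'] has_wirt_powi] has_wirt_nth[of j]]
        has_wirt_cnj_xic[of s j l]]]
  show ?thesis unfolding of_real_mult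
    by (rule exI, rule has_wirt_cong[OF 1[unfolded of_real_mult] _ refl])
       (auto simp: fun_eq_iff mmat_def a b wnorm_complex xic_def algebra_simps)
qed

section \<open>Pullbacks in the charts\<close>

text \<open>Indexes the atlas by a boolean and a base index: \<open>True\<close> stands for the
  fibre coordinate y, \<open>False\<close> for 1 / y. Negation exchanges the neighbourhoods of the
  two sections.\<close>

definition ch :: "nat \<Rightarrow> bool \<Rightarrow> 'n \<Rightarrow> complex^'n \<Rightarrow> 'n::finite piece_point set" where
  "ch k b j = Mk_chart k (if b then Some else sphere_recip) j"

text \<open>In the charts around the infinity section the fibre coordinate is \<open>1 / y\<close>, of degree \<open>- k\<close>.\<close>

definition sg :: "nat \<Rightarrow> bool \<Rightarrow> int" where
  "sg k b = (if b then int k else - int k)"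

lemma sg_nz: "k \<ge> 1 \<Longrightarrow> sg k b \<noteq> 0" by (simp add: sg_def)
lemma sg_eq_iff: "k \<ge> 1 \<Longrightarrow> sg k b = sg k b' \<longleftrightarrow> b = b'" by (auto simp: sg_def)
lemma sg_opp: "b' \<noteq> b \<Longrightarrow> sg k b' = - sg k b" by (auto simp: sg_def)

lemma Mk_atlas_eq: "Mk_atlas k = {ch k b (j :: 'n::finite) | b j. True}"
proof -
  have c: "Mk_chart k Some j = ch k True j" "Mk_chart k sphere_recip j = ch k False j" for j :: 'n
    by (simp_all add: ch_def)
  have "Mk_chart k (if b then Some else sphere_recip) j = ch k b j" for b and j :: 'n by (simp add: ch_def)
  then show ?thesis unfolding Mk_atlas_def using c by (auto simp: ch_def)
qed

lemma ball_atlas: "(\<forall>c\<in>Mk_atlas k. P c) \<longleftrightarrow> (\<forall>b j. P (ch k b j))"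
  by (auto simp: Mk_atlas_eq)

lemma ch_in_atlas: "ch k b j \<in> Mk_atlas k"
  by (auto simp: Mk_atlas_eq)

lemma inj_ch: "inj (ch k b j)"
  unfolding ch_def by (rule inj_Mk_chart) (auto simp: inj_sphere_recip)

lemma act_ch_eq_iff:
  assumes "(A *v affine_lift j x) $ i \<noteq> 0"
  shows "Mk_act k A (ch k b j x) = ch k b' j' x' \<longleftrightarrow>
    (A *v affine_lift j x) $ j' \<noteq> 0 \<and>
    (\<forall>l. l \<noteq> j' \<longrightarrow> x' $ l = (A *v affine_lift j x) $ l / (A *v affine_lift j x) $ j') \<and>
    (if b' then Some else sphere_recip) (x' $ j') =
      sphere_scale ((A *v affine_lift j x) $ j' ^ k) ((if b then Some else sphere_recip) (x $ j))"
proof -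
  let ?z = "A *v affine_lift j x"
  have "Mk_act k A (ch k b j x) =
    Mk_point k i ?z (sphere_scale (?z $ i ^ k) ((if b then Some else sphere_recip) (x $ j)))"
    unfolding ch_def Mk_chart_def using assms by (subst Mk_act_point) (auto simp: affine_lift_nth)
  then show ?thesis unfolding ch_def using assms
    by (simp add: Mk_chart_eq_Mk_point_iff sphere_scale_scale flip: power_mult_distrib)
qed

lemma act_ch:
  assumes "(A *v affine_lift j x) $ j' \<noteq> 0" "b = b' \<or> x $ j \<noteq> 0" "k \<ge> 1"
  shows "Mk_act k A (ch k b j x) = ch k b' j' (Tmap (sg k b) (sg k b') j j' A x)"
  unfolding act_ch_eq_iff[OF assms(1)]
  using assms
  by (auto simp: Tmap_def Let_def sg_eq_iff sphere_scale_simps sphere_recip_def sg_def power_int_minus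
      field_simps split: if_splits)

lemma act_ch_range:
  assumes "A *v affine_lift j x \<noteq> 0" "k \<ge> 1"
  shows "Mk_act k A (ch k b j x) \<in> range (ch k b' j') \<longleftrightarrow>
    (A *v affine_lift j x) $ j' \<noteq> 0 \<and> (b = b' \<or> x $ j \<noteq> 0)"
proof
  assume "Mk_act k A (ch k b j x) \<in> range (ch k b' j')"
  then obtain x' where x': "Mk_act k A (ch k b j x) = ch k b' j' x'" by auto
  obtain i where "(A *v affine_lift j x) $ i \<noteq> 0" using assms by (auto simp: vec_eq_iff)
  note x'[unfolded act_ch_eq_iff[OF this]]
  then show "(A *v affine_lift j x) $ j' \<noteq> 0 \<and> (b = b' \<or> x $ j \<noteq> 0)"
    by (auto simp: sphere_scale_simps sphere_recip_def split: if_splits)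
next
  assume "(A *v affine_lift j x) $ j' \<noteq> 0 \<and> (b = b' \<or> x $ j \<noteq> 0)"
  then show "Mk_act k A (ch k b j x) \<in> range (ch k b' j')" using act_ch assms(2) by blast
qed

lemma similarity_nz:
  assumes "similarity A \<rho>" shows "A *v affine_lift j x \<noteq> 0"
proof
  assume "A *v affine_lift j x = 0"
  moreover have "herm (A *v affine_lift j x) (A *v affine_lift j x) = of_real (\<rho> * bnorm j x)" "\<rho> > 0"
    using assms by (auto simp: similarity_def herm_affine_lift)
  ultimately show False by (simp add: herm_def)
qed

section \<open>Derivatives of the transition maps\<close>

lemma has_derivative_vecI:
  fixes F :: "'a::real_normed_vector \<Rightarrow> complex^'n::finite"
  assumes "\<And>i. ((\<lambda>x. F x $ i) has_derivative (\<lambda>v. D v $ i)) (at x)"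
  shows "(F has_derivative D) (at x)"
proof -
  have "(\<Sum>i\<in>UNIV. axis i (w $ i)) = w" for w :: "complex^'n"
    by (auto simp: vec_eq_iff axis_def if_distrib[of "\<lambda>f. f _"] cong: if_cong)
  moreover have "((\<lambda>x. \<Sum>i\<in>UNIV. axis i (F x $ i)) has_derivative (\<lambda>v. \<Sum>i\<in>UNIV. axis i (D v $ i))) (at x)"
    by (intro has_derivative_sum bounded_linear.has_derivative[OF bounded_linear_axis] assms)
  ultimately show ?thesis by simp
qed

lemma has_derivative_act_lift:
  "((\<lambda>x. (A *v affine_lift j x) $ i) has_derivative (\<lambda>v. (A *v bpart j v) $ i)) (at x)"
proof -
  have "((\<lambda>x. affine_lift j x $ l) has_derivative (\<lambda>v. bpart j v $ l)) (at x)" for l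
    by (cases "l = j")
       (auto simp: affine_lift_nth bpart_def intro: bounded_linear_imp_has_derivative[OF bounded_linear_vec_nth])
  then show ?thesis
    unfolding matrix_vector_mult_def vec_lambda_beta
    by (intro has_derivative_sum has_derivative_mult_right)
qed

lemma has_derivative_Tmap:
  fixes A :: "complex^'n::finite^'n"
  assumes m: "(A *v affine_lift j x) $ j' \<noteq> 0" and s: "s = s' \<or> x $ j \<noteq> 0"
  shows "(Tmap s s' j j' A has_derivative Dmap s s' j j' A x) (at x)"
proof (rule has_derivative_vecI)
  fix i
  note lift = has_derivative_act_lift[of A j _ x]
  have xj: "((\<lambda>x. x $ j) has_derivative (\<lambda>v. v $ j)) (at x)"
    by (rule bounded_linear_imp_has_derivative[OF bounded_linear_vec_nth])
  have pw: "((\<lambda>x. (A *v affine_lift j x) $ j' powi s) has_derivative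
     (\<lambda>v. (A *v bpart j v) $ j' * (of_int s * (A *v affine_lift j x) $ j' powi (s - 1)))) (at x)"
    by (rule has_derivative_power_int[OF m lift])
  have pw1: "(A *v affine_lift j x) $ j' powi (s - 1) = (A *v affine_lift j x) $ j' powi s / (A *v affine_lift j x) $ j'"
    using m by (simp add: power_int_diff)
  have mz: "(A *v affine_lift j x) $ j' powi s \<noteq> 0" using m by simp
  consider "i \<noteq> j'" | "i = j'" "s = s'" | "i = j'" "s \<noteq> s'" by blast
  then show "((\<lambda>x. Tmap s s' j j' A x $ i) has_derivative (\<lambda>v. Dmap s s' j j' A x v $ i)) (at x)"
  proof cases
    case 1
    have "((\<lambda>x. (A *v affine_lift j x) $ i / (A *v affine_lift j x) $ j') has_derivative
       (\<lambda>v. Dmap s s' j j' A x v $ i)) (at x)"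
      by (rule has_derivative_eq_rhs[OF has_derivative_divide[OF lift lift m]])
         (use 1 m in \<open>auto simp: fun_eq_iff Dmap_def Let_def field_simps\<close>)
    then show ?thesis using 1 by (simp add: Tmap_def Let_def)
  next
    case 2
    then have s': "s' = s" and i: "i = j'" by simp_all
    have "((\<lambda>x. (A *v affine_lift j x) $ j' powi s * x $ j) has_derivative (\<lambda>v. Dmap s s' j j' A x v $ i)) (at x)"
      by (rule has_derivative_eq_rhs[OF has_derivative_mult[OF pw xj]])
         (use m in \<open>auto simp: fun_eq_iff Dmap_def Let_def pw1 s' i algebra_simps\<close>)
    then show ?thesis using 2 by (simp add: Tmap_def Let_def)
  next
    case 3
    with s have xn: "x $ j \<noteq> 0" by simp
    have "((\<lambda>x. inverse ((A *v affine_lift j x) $ j' powi s * x $ j)) has_derivative (\<lambda>v. Dmap s s' j j' A x v $ i)) (at x)"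
      by (rule has_derivative_eq_rhs[OF Deriv.has_derivative_inverse[OF _ has_derivative_mult[OF pw xj]]])
         (use 3 m mz xn in \<open>auto simp: fun_eq_iff Dmap_def Let_def pw1 field_simps power2_eq_square\<close>)
    then show ?thesis using 3 by (simp add: Tmap_def Let_def)
  qed
qed

lemma Dmap_scale: "Dmap s s' j j' A x (c *s v) = c *s Dmap s s' j j' A x v"
proof -
  have b: "bpart j (c *s v) = c *s bpart j v" by (simp add: bpart_def vec_eq_iff)
  show ?thesis
    unfolding Dmap_def b vec.scale Let_def
    by (simp add: vec_eq_iff divide_inverse algebra_simps)
qed

lemma wirt_holomorphic:
  assumes "(T has_derivative D) (at x)" "\<And>c v. D (c *s v) = c *s D v"
  shows "wirt i (\<lambda>u. T u $ a) x = D (axis i 1) $ a"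
proof -
  have "((\<lambda>u. T u $ a) has_derivative (\<lambda>v. D v $ a)) (at x)"
    by (rule bounded_linear.has_derivative[OF bounded_linear_vec_nth assms(1)])
  moreover have "axis i \<i> = \<i> *s axis i (1::complex)" by (simp add: vec_eq_iff axis_def)
  ultimately show ?thesis
    by (simp add: wirt_def frechet_derivative_eqI assms(2))
qed

lemma open_dom:
  fixes A :: "complex^'n::finite^'n"
  shows "open {x. (A *v affine_lift j x) $ j' \<noteq> 0 \<and> (b \<or> x $ j \<noteq> 0)}"
proof -
  have "continuous_on UNIV (\<lambda>x. (A *v affine_lift j x) $ j')"
    by (rule has_derivative_continuous_on, rule has_derivative_at_withinI, rule has_derivative_act_lift)
  then have "open {x. (A *v affine_lift j x) $ j' \<noteq> 0}"
    by (intro open_Collect_neq) auto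
  moreover have "open {x :: complex^'n. x $ j \<noteq> 0}"
    by (intro open_Collect_neq) (auto intro: continuous_intros)
  ultimately have "open {x. (A *v affine_lift j x) $ j' \<noteq> 0 \<and> x $ j \<noteq> 0}" "open {x. (A *v affine_lift j x) $ j' \<noteq> 0}"
    by (auto intro: open_Collect_conj)
  then show ?thesis by (cases b) auto
qed

text \<open>Replaces inverses of charts by the explicit \<open>Tmap\<close> and \<open>Dmap\<close>,
  over exactly those points that the action moves into the target chart. With \<open>mat 1\<close>
  it becomes the transformation law of a tensor field.\<close>

lemma is_pullback_act_iff:
  assumes k: "k \<ge> 1" and A: "similarity A \<rho>"
  shows "is_pullback (Mk_atlas k) (Mk_act k A) g h \<longleftrightarrow>
    (\<forall>b j b' j' x. (A *v affine_lift j x) $ j' \<noteq> 0 \<longrightarrow> b = b' \<or> x $ j \<noteq> 0 \<longrightarrow>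
       (\<forall>i l. h (ch k b j) x $ i $ l = sform (g (ch k b' j') (Tmap (sg k b) (sg k b') j j' A x))
          (Dmap (sg k b) (sg k b') j j' A x (axis i 1)) (Dmap (sg k b) (sg k b') j j' A x (axis l 1))))"
proof -
  define L where "L = (\<lambda>b j b' j' x. let T = inv (ch k b' j') \<circ> Mk_act k A \<circ> ch k b j in
         \<forall>i l. h (ch k b j) x $ i $ l =
           (\<Sum>a\<in>UNIV. \<Sum>e\<in>UNIV.
              wirt i (\<lambda>u. T u $ a) x * cnj (wirt l (\<lambda>u. T u $ e) x) * g (ch k b' j') (T x) $ a $ e))"
  define R where "R = (\<lambda>b j b' j' x. \<forall>i l. h (ch k b j) x $ i $ l = sform (g (ch k b' j') (Tmap (sg k b) (sg k b') j j' A x))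
          (Dmap (sg k b) (sg k b') j j' A x (axis i 1)) (Dmap (sg k b) (sg k b') j j' A x (axis l 1)))"
  have *: "L b j b' j' x = R b j b' j' x"
    if x: "(A *v affine_lift j x) $ j' \<noteq> 0" "b = b' \<or> x $ j \<noteq> 0" for b j b' j' x
  proof -
    define S where "S = {x. (A *v affine_lift j x) $ j' \<noteq> 0 \<and> (b = b' \<or> x $ j \<noteq> 0)}"
    define T where "T = inv (ch k b' j') \<circ> Mk_act k A \<circ> ch k b j"
    have S: "open S" "x \<in> S" using open_dom[of A j j' "b = b'"] x by (auto simp: S_def)
    \<comment> \<open>The abstract coordinate expression agrees with \<open>Tmap\<close> on an open
      set around \<open>x\<close>, so both have the same derivative there.\<close>
    have T: "T u = Tmap (sg k b) (sg k b') j j' A u" if "u \<in> S" for u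
      using that act_ch[of A j u j' b b' k] k by (auto simp: T_def S_def inv_f_f[OF inj_ch])
    have "(Tmap (sg k b) (sg k b') j j' A has_derivative Dmap (sg k b) (sg k b') j j' A x) (at x)"
      by (rule has_derivative_Tmap) (use x k in \<open>auto simp: sg_eq_iff\<close>)
    then have "(T has_derivative Dmap (sg k b) (sg k b') j j' A x) (at x)"
      by (rule has_derivative_transform_within_open[OF _ S]) (use T in auto)
    then have w: "wirt i (\<lambda>u. T u $ a) x = Dmap (sg k b) (sg k b') j j' A x (axis i 1) $ a" for i a
      by (rule wirt_holomorphic) (rule Dmap_scale)
    show ?thesis
      unfolding L_def R_def T_def[symmetric] Let_def w T[OF S(2)] sform_def by (simp add: mult_ac)
  qed
  have "is_pullback (Mk_atlas k) (Mk_act k A) g h \<longleftrightarrow>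
    (\<forall>b j b' j' x. Mk_act k A (ch k b j x) \<in> range (ch k b' j') \<longrightarrow> L b j b' j' x)"
    by (simp only: is_pullback_def ball_atlas L_def)
  also have "\<dots> \<longleftrightarrow> (\<forall>b j b' j' x. (A *v affine_lift j x) $ j' \<noteq> 0 \<longrightarrow> b = b' \<or> x $ j \<noteq> 0 \<longrightarrow> R b j b' j' x)"
    unfolding act_ch_range[OF similarity_nz[OF A] k] using * by metis
  finally show ?thesis unfolding R_def .
qed

section \<open>Coordinate changes and unitary matrices as similarities\<close>

lemma similarity_1: "similarity (mat 1) 1"
  by (simp add: similarity_def)

lemma act_1:
  assumes "k \<ge> 1" shows "Mk_act k (mat 1) (ch k b j x) = ch k b j x"
proof -
  have "Tmap (sg k b) (sg k b) j j (mat 1) x = x"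
    by (simp add: Tmap_def Let_def vec_eq_iff affine_lift_nth)
  then show ?thesis using act_ch[of "mat 1" j x j b b k] assms by (simp add: affine_lift_nth)
qed

lemma is_pullback_id_iff:
  fixes g h :: "('n::finite, 'n piece_point set) tensor_field"
  assumes k: "k \<ge> 1"
  shows "is_pullback (Mk_atlas k) id g h \<longleftrightarrow> is_pullback (Mk_atlas k) (Mk_act k (mat 1)) g h"
proof -
  have "d \<circ> Mk_act k (mat 1) \<circ> c = d \<circ> id \<circ> c" "Mk_act k (mat 1) (c x) = c x"
    if "c \<in> Mk_atlas k" for c :: "complex^'n \<Rightarrow> 'n piece_point set" and x and d :: "'n piece_point set \<Rightarrow> complex^'n"
    using that by (auto simp: Mk_atlas_eq fun_eq_iff act_1[OF k])
  then show ?thesis by (simp add: is_pullback_def Let_def cong: ball_cong)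
qed

lemma herm_unitary:
  assumes "unitary_matrix U" shows "herm (U *v v) (U *v u) = herm v u"
proof -
  define Us where "Us = (\<chi> i j. cnj (U $ j $ i))"
  have adj: "herm (U *v v) w = herm v (Us *v w)" for v w
  proof -
    have "herm (U *v v) w = (\<Sum>i\<in>UNIV. \<Sum>j\<in>UNIV. U $ i $ j * v $ j * cnj (w $ i))"
      by (simp add: herm_def matrix_vector_mult_def sum_distrib_right)
    also have "\<dots> = (\<Sum>j\<in>UNIV. \<Sum>i\<in>UNIV. U $ i $ j * v $ j * cnj (w $ i))"
      by (rule sum.swap)
    also have "\<dots> = herm v (Us *v w)"
      by (simp add: herm_def matrix_vector_mult_def Us_def sum_distrib_left mult_ac)
    finally show ?thesis .
  qed
  have "Us ** U = mat 1" using assms by (simp add: unitary_matrix_def Us_def)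
  then show ?thesis by (simp add: adj matrix_vector_mul_assoc)
qed

lemma similarity_unitary: "unitary_matrix U \<Longrightarrow> similarity U 1"
  by (simp add: similarity_def herm_unitary)

text \<open>The data of a \<open>U(n)\<close>-invariant tensor: its components \<open>a\<close> along the base and \<open>b\<close> along the
  fibre, as functions of the squared norm \<open>wnorm\<close> on the line bundle (for \<open>True\<close>) and its dual.\<close>

definition radial_tensor ::
  "nat \<Rightarrow> (bool \<Rightarrow> real \<Rightarrow> real) \<Rightarrow> (bool \<Rightarrow> real \<Rightarrow> real) \<Rightarrow> ('n::finite, 'n piece_point set) tensor_field \<Rightarrow> bool" where
  "radial_tensor k a b g \<longleftrightarrow> (\<forall>e j x. g (ch k e j) x =
     mmat (sg k e) j (a e (wnorm (sg k e) j x)) (b e (wnorm (sg k e) j x)) x)"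

text \<open>\<open>a_opp\<close> and \<open>b_opp\<close> say that the data around the two sections
  describe a single tensor; the square in \<open>b_opp\<close> stems from d (1 / y) = - dy / y^2. A
  similarity multiplies \<open>wnorm\<close> by \<open>\<rho> powi sg k e\<close>, and the fibre
  component acquires the same factor once more.\<close>

lemma radial_pullback:
  assumes k: "k \<ge> 1" and A: "similarity A \<rho>"
    and g: "radial_tensor k a b g" and h: "radial_tensor k a' b' h"
    and a_opp: "\<And>e w. w > 0 \<Longrightarrow> a (\<not> e) (1 / w) = a e w"
    and b_opp: "\<And>e w. w > 0 \<Longrightarrow> b (\<not> e) (1 / w) = w\<^sup>2 * b e w"
    and a': "\<And>e w. w \<ge> 0 \<Longrightarrow> a' e w = a e (\<rho> powi sg k e * w)"
    and b': "\<And>e w. w \<ge> 0 \<Longrightarrow> b' e w = \<rho> powi sg k e * b e (\<rho> powi sg k e * w)"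
  shows "is_pullback (Mk_atlas k) (Mk_act k A) g h"
  unfolding is_pullback_act_iff[OF k A]
proof (intro allI impI)
  fix e e' :: bool and j j' x i l
  assume m: "(A *v affine_lift j x) $ j' \<noteq> 0" and e: "e = e' \<or> x $ j \<noteq> 0"
  let ?s = "sg k e" and ?s' = "sg k e'" and ?x' = "Tmap (sg k e) (sg k e') j j' A x"
  let ?D = "Dmap (sg k e) (sg k e') j j' A x"
  have "sform (g (ch k e' j') ?x') (?D v) (?D u) = mform ?s j (a' e (wnorm ?s j x)) (b' e (wnorm ?s j x)) x v u" for v u
  proof (cases "e' = e")
    case True
    then show ?thesis using g
      by (simp add: radial_tensor_def sform_mmat mform_Dmap_same[OF A m] wnorm_Tmap_same[OF A m]
          a'[OF wnorm_nonneg] b'[OF wnorm_nonneg])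
  next
    case False
    then have s: "?s' = - ?s" and e': "e' = (\<not> e)" and xj: "x $ j \<noteq> 0" using e sg_opp by auto
    define w where "w = \<rho> powi ?s * wnorm ?s j x"
    have "\<rho> > 0" using A by (simp add: similarity_def)
    moreover have "wnorm ?s j x > 0" using xj bnorm_pos[of j x] by (simp add: wnorm_def)
    ultimately have w: "w > 0" and wn: "wnorm ?s j x \<noteq> 0" and r: "\<rho> powi ?s \<noteq> 0" by (simp_all add: w_def)
    have T: "wnorm ?s' j' ?x' = 1 / w"
      unfolding w_def by (rule wnorm_Tmap_opp[OF A m s sg_nz[OF k] xj])
    have bb: "b e' (1 / w) / (\<rho> powi ?s * (wnorm ?s j x)\<^sup>2) = b' e (wnorm ?s j x)"
      unfolding e' b_opp[OF w] b'[OF wnorm_nonneg] w_def[symmetric]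
    proof -
      define q where "q = \<rho> powi ?s"
      have "q \<noteq> 0" unfolding q_def by (rule r)
      then show "w\<^sup>2 * b e w / (\<rho> powi ?s * (wnorm ?s j x)\<^sup>2) = \<rho> powi ?s * b e w"
        using wn unfolding w_def q_def[symmetric] by (simp add: power2_eq_square)
    qed
    have g': "g (ch k e' j') ?x' = mmat ?s' j' (a e' (1 / w)) (b e' (1 / w)) ?x'"
      using g unfolding radial_tensor_def by (simp only: T)
    show ?thesis
      unfolding g' sform_mmat mform_Dmap_opp[OF A m s sg_nz[OF k] xj] bb
      by (simp only: e' a_opp[OF w] a'[OF wnorm_nonneg] w_def[symmetric])
  qed
  then show "h (ch k e j) x $ i $ l = sform (g (ch k e' j') ?x') (?D (axis i 1)) (?D (axis l 1))"
    using h by (simp add: radial_tensor_def flip: sform_mmat) (simp add: sform_axis)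
qed

section \<open>A soliton from a profile function\<close>

lemma smooth_on_norm2: "smooth_on UNIV (\<lambda>x :: complex^'n::finite. (norm (x $ j))\<^sup>2)"
proof -
  have "smooth_on UNIV (\<lambda>x :: complex^'n. Re (x $ j))" "smooth_on UNIV (\<lambda>x :: complex^'n. Im (x $ j))"
    by (intro smooth_on_linear_compose[OF bounded_linear_Re] smooth_on_linear_compose[OF bounded_linear_Im]
        open_UNIV smooth_on_linear[OF bounded_linear_vec_nth])+
  from smooth_on_add[OF open_UNIV smooth_on_mult[OF open_UNIV this(1,1)] smooth_on_mult[OF open_UNIV this(2,2)]]
  show ?thesis unfolding cmod_power2 by (simp only: power2_eq_square)
qed

lemma smooth_on_bnorm: "smooth_on UNIV (bnorm j)"
  unfolding bnorm_def[abs_def]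
  by (intro smooth_on_add open_UNIV smooth_on_const smooth_on_sum smooth_on_norm2)

lemma smooth_on_bnorm_powi: "smooth_on UNIV (\<lambda>x. bnorm j x powi s)"
  by (rule smooth_on_compose_real[OF open_UNIV smooth_on_power_int smooth_on_bnorm]) (auto simp: bnorm_pos)

lemma smooth_on_wnorm: "smooth_on UNIV (wnorm s j)"
  unfolding wnorm_def[abs_def]
  by (intro smooth_on_mult open_UNIV smooth_on_norm2 smooth_on_bnorm_powi)

lemma smooth_on_of_real: "open S \<Longrightarrow> smooth_on S f \<Longrightarrow> smooth_on S (\<lambda>x. complex_of_real (f x))"
  by (rule smooth_on_linear_compose[OF bounded_linear_of_real])

lemma smooth_on_cnj: "open S \<Longrightarrow> smooth_on S f \<Longrightarrow> smooth_on S (\<lambda>x. cnj (f x))"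
  by (rule smooth_on_linear_compose[OF bounded_linear_cnj])

lemma smooth_on_nuc: "smooth_on UNIV (\<lambda>x. nuc j x i)"
proof (cases "i = j")
  case True
  then show ?thesis by (simp add: nuc_def smooth_on_const)
next
  case False
  have "smooth_on UNIV (\<lambda>x. cnj (x $ i) * of_real (bnorm j x powi - 1))"
    by (intro smooth_on_mult open_UNIV smooth_on_cnj smooth_on_of_real smooth_on_bnorm_powi
        smooth_on_linear[OF bounded_linear_vec_nth])
  then show ?thesis using False by (simp add: nuc_def power_int_minus divide_inverse)
qed

lemma smooth_on_fsc: "smooth_on UNIV (\<lambda>x. fsc j x i l)"
proof -
  define d :: complex where "d = (if i = l \<and> i \<noteq> j then 1 else 0)"
  have "smooth_on UNIV (\<lambda>x. d * of_real (bnorm j x powi - 1) + (- 1) * (nuc j x i * cnj (nuc j x l)))"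
    by (intro smooth_on_add smooth_on_mult open_UNIV smooth_on_cnj smooth_on_of_real smooth_on_bnorm_powi
        smooth_on_nuc smooth_on_const)
  moreover have "(\<lambda>x. d * of_real (bnorm j x powi - 1) + (- 1) * (nuc j x i * cnj (nuc j x l))) = (\<lambda>x. fsc j x i l)"
    by (auto simp: fun_eq_iff fsc_def d_def power_int_minus divide_inverse)
  ultimately show ?thesis by simp
qed

lemma smooth_on_xic: "smooth_on UNIV (\<lambda>x. xic s j x i)"
  unfolding xic_def
  by (intro smooth_on_add smooth_on_mult open_UNIV smooth_on_nuc smooth_on_const smooth_on_linear[OF bounded_linear_vec_nth])

lemma wnorm_image:
  assumes "\<epsilon> > 0" shows "wnorm s j ` UNIV \<subseteq> {-\<epsilon><..}"
proof -
  have "-\<epsilon> < wnorm s j x" for x using wnorm_nonneg[of s j x] assms by linarith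
  then show ?thesis by auto
qed

lemma smooth_on_mmat:
  assumes "smooth_on {-\<epsilon><..} a" "smooth_on {-\<epsilon><..} b" "\<epsilon> > 0"
  shows "smooth_on UNIV (\<lambda>x. mmat s j (a (wnorm s j x)) (b (wnorm s j x)) x)"
proof -
  have w: "wnorm s j ` UNIV \<subseteq> {-\<epsilon><..}" by (rule wnorm_image[OF assms(3)])
  have "smooth_on UNIV (\<lambda>x. a (wnorm s j x))" "smooth_on UNIV (\<lambda>x. b (wnorm s j x))"
    by (rule smooth_on_compose_real[OF open_UNIV assms(1) smooth_on_wnorm w]
        smooth_on_compose_real[OF open_UNIV assms(2) smooth_on_wnorm w])+
  note ab = smooth_on_of_real[OF open_UNIV this(1)]
    smooth_on_of_real[OF open_UNIV smooth_on_mult[OF open_UNIV this(2) smooth_on_bnorm_powi[of j s]]]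
  have "smooth_on UNIV (\<lambda>x. mmat s j (a (wnorm s j x)) (b (wnorm s j x)) x $ i $ l)" for i l
    unfolding mmat_def vec_lambda_beta
    by (rule smooth_on_add[OF open_UNIV smooth_on_mult[OF open_UNIV ab(1) smooth_on_fsc]
      smooth_on_mult[OF open_UNIV smooth_on_mult[OF open_UNIV ab(2) smooth_on_xic] smooth_on_cnj[OF open_UNIV smooth_on_xic]]])
  then show ?thesis by (rule smooth_on_vecI[OF open_UNIV smooth_on_vecI[OF open_UNIV]])
qed

text \<open>By Cauchy-Schwarz the Fubini-Study part is at least
  \<open>Re (herm p p) / bnorm^2\<close> for the base part \<open>p\<close> of a vector, because the
  lift without its entry 1 has squared norm \<open>bnorm - 1\<close>. Where \<open>p\<close>
  vanishes, \<open>xi\<close> reduces to the nonzero fibre entry and the second summand is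
  positive.\<close>

lemma pos_def_mmat:
  assumes "a > 0" "b > 0" shows "pos_def_hermitian (mmat s j a b x)"
  unfolding pos_def_hermitian_def
proof (intro conjI allI impI)
  show "mmat s j a b x $ l $ i = cnj (mmat s j a b x $ i $ l)" for i l
    by (simp add: mmat_def cnj_fsc)
  fix v :: "complex^'a" assume v: "v \<noteq> 0"
  let ?N = "bnorm j x" and ?p = "bpart j v"
  have "Re (fs j x v v) \<ge> Re (herm ?p ?p) / ?N\<^sup>2"
  proof -
    have hp: "herm ?p ?p = of_real (Re (herm ?p ?p))"
      by (simp add: complex_eq_iff herm_def)
    define q where "q = bpart j x"
    have hx: "herm ?p (affine_lift j x) = herm ?p q"
      unfolding herm_def q_def by (intro sum.cong) (auto simp: bpart_def affine_lift_nth)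
    have qq: "Re (herm q q) = ?N - 1"
    proof -
      have "herm q q = (\<Sum>i\<in>UNIV - {j}. x $ i * cnj (x $ i))"
        unfolding herm_def by (subst sum.remove[of _ j]) (auto simp: q_def bpart_def intro!: sum.cong)
      then show ?thesis by (simp add: bnorm_def complex_norm_square[symmetric] del: of_real_power)
    qed
    have CS: "(norm (herm ?p q))\<^sup>2 \<le> Re (herm ?p ?p) * Re (herm q q)"
    proof -
      have "norm (herm ?p q) \<le> (\<Sum>i\<in>UNIV. norm (?p $ i) * norm (q $ i))"
        unfolding herm_def by (rule order_trans[OF norm_sum]) (simp add: norm_mult)
      also have "\<dots> \<le> L2_set (\<lambda>i. norm (?p $ i)) UNIV * L2_set (\<lambda>i. norm (q $ i)) UNIV"
        using L2_set_mult_ineq[of "\<lambda>i. norm (?p $ i)" "\<lambda>i. norm (q $ i)" UNIV] by simp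
      finally have "(norm (herm ?p q))\<^sup>2 \<le> (L2_set (\<lambda>i. norm (?p $ i)) UNIV * L2_set (\<lambda>i. norm (q $ i)) UNIV)\<^sup>2"
        by (intro power_mono) auto
      moreover have "(L2_set (\<lambda>i. norm (u $ i)) UNIV)\<^sup>2 = Re (herm u u)" for u :: "complex^'a"
        unfolding L2_set_def herm_def by (simp add: sum_nonneg cmod_power2) (simp add: power2_eq_square)
      ultimately show ?thesis by (simp add: power_mult_distrib)
    qed
    have "Re (fs j x v v) = Re (herm ?p ?p) / ?N - (norm (herm ?p q))\<^sup>2 / ?N\<^sup>2"
    proof -
      have "nu j x v * cnj (nu j x v) = of_real ((norm (herm ?p q))\<^sup>2 / ?N\<^sup>2)"
        unfolding nu_def hx complex_norm_square[symmetric] by (simp add: norm_divide power_divide)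
      then show ?thesis unfolding fs_def by (subst hp) simp
    qed
    also have "\<dots> \<ge> Re (herm ?p ?p) / ?N - Re (herm ?p ?p) * (?N - 1) / ?N\<^sup>2"
      using CS qq bnorm_pos[of j x] by (intro diff_left_mono divide_right_mono) auto
    also have "Re (herm ?p ?p) / ?N - Re (herm ?p ?p) * (?N - 1) / ?N\<^sup>2 = Re (herm ?p ?p) / ?N\<^sup>2"
      using bnorm_pos[of j x] by (simp add: field_simps power2_eq_square)
    finally show ?thesis .
  qed
  moreover have pp: "Re (herm ?p ?p) \<ge> 0" by (simp add: herm_def sum_nonneg)
  ultimately have fs0: "Re (fs j x v v) \<ge> 0" by (meson divide_nonneg_nonneg order_trans zero_le_power2)
  have "mform s j a b x v v = of_real a * fs j x v v + of_real (b * ?N powi s * (norm (xi s j x v))\<^sup>2)"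
    by (simp only: mform_def mult.assoc complex_norm_square of_real_mult)
  then have "Re (mform s j a b x v v) = a * Re (fs j x v v) + b * ?N powi s * (norm (xi s j x v))\<^sup>2"
    by (simp only: plus_complex.sel Re_complex_of_real times_complex.sel Im_complex_of_real mult_zero_left diff_zero)
  moreover have "a * Re (fs j x v v) > 0 \<or> b * ?N powi s * (norm (xi s j x v))\<^sup>2 > 0"
  proof (cases "?p = 0")
    case True
    then have "xi s j x v = v $ j" by (simp add: xi_def nu_def herm_def)
    moreover have "v $ j \<noteq> 0" using True v by (auto simp: vec_eq_iff bpart_def split: if_splits)
    ultimately show ?thesis using assms bnorm_pos[of j x] by simp
  next
    case False
    then obtain i where "?p $ i \<noteq> 0" by (auto simp: vec_eq_iff)
    then have "Re (herm ?p ?p) > 0"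
      unfolding herm_def Re_sum by (intro sum_pos2[of _ i]) (auto simp: complex_eq_iff sum_squares_gt_zero_iff)
    then have "Re (fs j x v v) > 0"
      using \<open>Re (fs j x v v) \<ge> Re (herm ?p ?p) / ?N\<^sup>2\<close> bnorm_pos[of j x]
      by (meson divide_pos_pos less_le_trans zero_less_power)
    then show ?thesis using assms by simp
  qed
  moreover have "a * Re (fs j x v v) \<ge> 0" "b * ?N powi s * (norm (xi s j x v))\<^sup>2 \<ge> 0"
    using assms fs0 bnorm_pos[of j x] by simp_all
  ultimately have "Re (mform s j a b x v v) > 0" by linarith
  then show "0 < Re (\<Sum>i\<in>UNIV. \<Sum>l\<in>UNIV. mmat s j a b x $ i $ l * v $ i * cnj (v $ l))"
    using sform_mmat[of s j a b x v v] by (simp add: sform_def)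
qed

text \<open>A left null vector would annihilate the Hermitian form evaluated on itself, since the
  form pairs the first index of \<open>G\<close> with the vector and the second with its
  conjugate.\<close>

lemma invertible_pos_def:
  assumes "pos_def_hermitian (G :: complex^'n::finite^'n)" shows "invertible G"
proof -
  have "u = 0" if "u v* G = 0" for u
  proof (rule ccontr)
    assume "u \<noteq> 0"
    then have "0 < Re (\<Sum>i\<in>UNIV. \<Sum>j\<in>UNIV. G $ i $ j * u $ i * cnj (u $ j))"
      using assms unfolding pos_def_hermitian_def by blast
    also have "(\<Sum>i\<in>UNIV. \<Sum>j\<in>UNIV. G $ i $ j * u $ i * cnj (u $ j)) = (\<Sum>j\<in>UNIV. (u v* G) $ j * cnj (u $ j))"
      by (subst sum.swap) (simp add: vector_matrix_mult_def sum_distrib_right sum_distrib_left mult_ac)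
    finally show False using that by simp
  qed
  then have "\<forall>u. transpose G *v u = 0 \<longrightarrow> u = 0" by (simp add: transpose_matrix_vector)
  then obtain B where "B ** transpose G = mat 1" using matrix_left_invertible_ker[of "transpose G"] by blast
  then have "G ** transpose B = mat 1"
    by (metis matrix_transpose_mul transpose_mat transpose_transpose)
  moreover from this have "transpose B ** G = mat 1" by (simp add: matrix_left_right_inverse)
  ultimately show ?thesis unfolding invertible_def by blast
qed

lemma matrix_inv_left: "invertible A \<Longrightarrow> matrix_inv A ** A = mat 1"
  unfolding invertible_def matrix_inv_def by (metis (mono_tags, lifting) someI_ex)

text \<open>The gradient field of \<open>f\<close> is holomorphic, here \<open>C\<close> times the \<open>j\<close>-th Euler field; hence the pure part
  of the Hessian of \<open>f\<close> vanishes.\<close>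

lemma hess_pure_zero:
  fixes G :: "complex^'n::finite \<Rightarrow> complex^'n^'n"
  assumes inv: "invertible (G x)"
    and G: "\<And>i l. (\<lambda>u. G u $ i $ l) differentiable (at x)"
    and F: "\<And>l u. wirt l F u = C * cnj (u $ j) * G u $ l $ j"
  shows "hess_pure G F i l x = 0"
proof -
  have "wirt l F = (\<lambda>u. C * cnj (u $ j) * G u $ l $ j)" by (rule ext) (rule F)
  moreover have "has_wirt (\<lambda>u. C * cnj (u $ j) * G u $ l $ j)
     (\<lambda>m. C * cnj (x $ j) * wirt m (\<lambda>u. G u $ l $ j) x)
     (\<lambda>m. C * cnj (x $ j) * wirt_bar m (\<lambda>u. G u $ l $ j) x + C * (if m = j then 1 else 0) * G x $ l $ j) x"
    by (rule has_wirt_cong[OF has_wirt_mult[OF has_wirt_mult[OF has_wirt_const has_wirt_cnj[OF has_wirt_nth]] has_wirtI[OF G]]])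
       (auto simp: fun_eq_iff)
  ultimately have 1: "wirt i (wirt l F) x = C * cnj (x $ j) * wirt i (\<lambda>u. G u $ l $ j) x"
    by (simp add: has_wirt_eqs(1))
  have mi: "(\<Sum>m\<in>UNIV. matrix_inv (G x) $ p $ m * G x $ m $ j) = (if p = j then 1 else 0)" for p
  proof -
    have "(matrix_inv (G x) ** G x) $ p $ j = mat 1 $ p $ j" using matrix_inv_left[OF inv] by simp
    then show ?thesis by (simp add: matrix_matrix_mult_def mat_def)
  qed
  have "(\<Sum>m\<in>UNIV. christoffel G m i l x * wirt m F x) =
     (\<Sum>m\<in>UNIV. \<Sum>p\<in>UNIV. C * cnj (x $ j) * wirt i (\<lambda>u. G u $ l $ p) x * (matrix_inv (G x) $ p $ m * G x $ m $ j))"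
    by (simp add: christoffel_def F sum_distrib_right sum_distrib_left mult_ac)
  also have "\<dots> = (\<Sum>p\<in>UNIV. C * cnj (x $ j) * wirt i (\<lambda>u. G u $ l $ p) x * (if p = j then 1 else 0))"
    by (subst sum.swap) (simp add: mi flip: sum_distrib_left)
  also have "\<dots> = C * cnj (x $ j) * wirt i (\<lambda>u. G u $ l $ j) x"
    by (simp add: if_distrib[of "\<lambda>f. _ * f"] cong: if_cong)
  finally show ?thesis by (simp add: hess_pure_def 1)
qed

text \<open>A tensor field receives the chart as a function, so data given in terms of (e, j) need
  the pair to be recoverable. The image of the origin suffices: it tells the section and the
  coordinate point of the base.\<close>

lemma ch_inj:
  assumes "ch k e j = ch k e' j'" shows "e = e'" "j = j'"
proof -
  have *: "ch k e j 0 = ch k e' j' 0" using assms by simp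
  show j: "j = j'" using *[unfolded ch_def Mk_chart_eq_iff] by (auto simp: affine_lift_nth split: if_splits)
  show "e = e'" using *[unfolded ch_def Mk_chart_eq_iff j]
    by (auto simp: affine_lift_nth sphere_recip_def sphere_scale_simps split: if_splits)
qed

lemma ch_eq_imp:
  assumes k: "k \<ge> 1" and eq: "ch k e j x = ch k e' j' x'"
  shows "(affine_lift j x) $ j' \<noteq> 0" "e = e' \<or> x $ j \<noteq> 0" "x' = Tmap (sg k e) (sg k e') j j' (mat 1) x"
proof -
  have "Mk_act k (mat 1) (ch k e j x) \<in> range (ch k e' j')" unfolding act_1[OF k] by (simp add: eq)
  then have *: "(mat 1 *v affine_lift j x) $ j' \<noteq> 0 \<and> (e = e' \<or> x $ j \<noteq> 0)"
    using act_ch_range[OF similarity_nz[OF similarity_1] k] by blast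
  then show "(affine_lift j x) $ j' \<noteq> 0" "e = e' \<or> x $ j \<noteq> 0" by auto
  have "ch k e' j' x' = ch k e' j' (Tmap (sg k e) (sg k e') j j' (mat 1) x)"
    using act_ch[OF conjunct1[OF *] conjunct2[OF *] k] unfolding act_1[OF k] eq .
  then show "x' = Tmap (sg k e) (sg k e') j j' (mat 1) x" by (rule injD[OF inj_ch])
qed

text \<open>A change of chart preserves or inverts \<open>wnorm\<close>, so functions compatible
  with inversion descend to the manifold.\<close>

lemma wnorm_ch_eq:
  assumes k: "k \<ge> 1" and eq: "ch k e j x = ch k e' j' x'"
    and opp: "\<And>e w. w > 0 \<Longrightarrow> \<Phi> (\<not> e) (1 / w) = \<Phi> e (w :: real)"
  shows "\<Phi> e (wnorm (sg k e) j x) = \<Phi> e' (wnorm (sg k e') j' x')"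
proof -
  note c = ch_eq_imp[OF k eq]
  have m: "(mat 1 *v affine_lift j x) $ j' \<noteq> 0" using c(1) by simp
  show ?thesis
  proof (cases "e' = e")
    case True
    then show ?thesis using wnorm_Tmap_same[OF similarity_1 m] c(3) by simp
  next
    case False
    then have s: "sg k e' = - sg k e" and e': "e' = (\<not> e)" and xj: "x $ j \<noteq> 0" using c(2) sg_opp by auto
    then have "wnorm (sg k e) j x > 0" using bnorm_pos[of j x] by (simp add: wnorm_def)
    then show ?thesis using wnorm_Tmap_opp[OF similarity_1 m s sg_nz[OF k] xj] c(3) opp
      by (simp add: e')
  qed
qed

text \<open>\<Phi> is to be the base component a of the metric and its derivative divided by
  \<open>sg k e\<close> the fibre component b. The bracket in \<open>ode\<close> is the derivative
  V' of - log (a^(n-1) b) - c a, so \<open>ode\<close> reads a = n - s + s w V', the base part of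
  the mixed equation; the fibre part is its derivative. The margin \<epsilon> provides two-sided
  derivatives at w = 0, that is, on the sections.\<close>

locale soliton_profile =
  fixes k :: nat and n :: nat and \<Phi> :: "bool \<Rightarrow> real \<Rightarrow> real" and c \<epsilon> :: real
  assumes k: "k \<ge> 1"
    and eps: "\<epsilon> > 0"
    and smooth_profile: "smooth_on {-\<epsilon><..} (\<Phi> e)"
    and pos: "w \<ge> 0 \<Longrightarrow> \<Phi> e w > 0"
    and deriv_pos: "w \<ge> 0 \<Longrightarrow> deriv (\<Phi> e) w / sg k e > 0"
    and opp: "w > 0 \<Longrightarrow> \<Phi> (\<not> e) (1 / w) = \<Phi> e w"
    and ode: "w \<ge> 0 \<Longrightarrow> of_int (sg k e) * w *
      (- (real n - 1) * (deriv (\<Phi> e) w / \<Phi> e w) - deriv (deriv (\<Phi> e)) w / deriv (\<Phi> e) w - c * deriv (\<Phi> e) w)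
      = \<Phi> e w - (real n - of_int (sg k e))"
begin

abbreviation "B e w \<equiv> deriv (\<Phi> e) w / sg k e"
definition "V' e w = - (real n - 1) * (deriv (\<Phi> e) w / \<Phi> e w) - deriv (deriv (\<Phi> e)) w / deriv (\<Phi> e) w - c * deriv (\<Phi> e) w"
definition "V0 e w = - (real n - 1) * ln (\<Phi> e w) - ln (B e w)"

lemma s_nz: "sg k e \<noteq> 0" "real_of_int (sg k e) \<noteq> 0"
  using sg_nz[OF k, of e] by simp_all

lemma smooth1: "smooth_on {-\<epsilon><..} (deriv (\<Phi> e))" and smooth2: "smooth_on {-\<epsilon><..} (deriv (deriv (\<Phi> e)))"
  using smooth_on_real_deriv(1)[OF _ open_greaterThan] smooth_profile by blast+

lemma D: "w \<ge> 0 \<Longrightarrow> (\<Phi> e has_real_derivative deriv (\<Phi> e) w) (at w)"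
  "w \<ge> 0 \<Longrightarrow> (deriv (\<Phi> e) has_real_derivative deriv (deriv (\<Phi> e)) w) (at w)"
  "w \<ge> 0 \<Longrightarrow> (deriv (deriv (\<Phi> e)) has_real_derivative deriv (deriv (deriv (\<Phi> e))) w) (at w)"
  using smooth_on_real_deriv(2)[OF _ open_greaterThan] smooth_profile smooth1 smooth2 eps by force+

lemma D_nz: "w \<ge> 0 \<Longrightarrow> deriv (\<Phi> e) w \<noteq> 0"
  using deriv_pos[of w e] by auto

lemma smooth_B: "smooth_on {-\<epsilon><..} (B e)"
  using smooth_on_mult[OF open_greaterThan smooth1 smooth_on_const, of e "1 / sg k e"] by simp

lemma D_B: "w \<ge> 0 \<Longrightarrow> (B e has_real_derivative deriv (deriv (\<Phi> e)) w / sg k e) (at w)"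
  using D(2) by (intro DERIV_cdivide)

lemma D_V0:
  assumes "w \<ge> 0" shows "(V0 e has_real_derivative V' e w + c * deriv (\<Phi> e) w) (at w)"
  unfolding V0_def[abs_def] V'_def
  using pos[OF assms, of e] deriv_pos[OF assms, of e] D_nz[OF assms, of e] s_nz[of e]
  by (auto intro!: derivative_eq_intros D[OF assms] D_B[OF assms] simp: field_simps)

text \<open>The fibre part of the mixed equation, obtained by differentiating \<open>ode\<close>. As
  \<open>ode\<close> is known only for \<open>w \<ge> 0\<close>, the derivatives are compared within
  the half-line, where they are still unique at 0.\<close>

lemma D_V':
  assumes "w \<ge> 0"
  obtains V'' where "(V' e has_real_derivative V'') (at w)" "B e w = V' e w + w * V''"
proof -
  have "\<exists>V''. (V' e has_real_derivative V'') (at w)"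
    unfolding V'_def[abs_def]
    using pos[OF assms, of e] D_nz[OF assms, of e]
    by (intro exI) (auto intro!: derivative_eq_intros D[OF assms])
  then obtain V'' where V: "(V' e has_real_derivative V'') (at w)" by blast
  have 1: "((\<lambda>w. of_int (sg k e) * w * V' e w) has_real_derivative (of_int (sg k e) * (V' e w + w * V''))) (at w within {0..})"
    by (rule has_field_derivative_at_within) (auto intro!: derivative_eq_intros V simp: algebra_simps)
  have 2: "((\<lambda>w. \<Phi> e w - (real n - of_int (sg k e))) has_real_derivative deriv (\<Phi> e) w) (at w within {0..})"
    by (rule has_field_derivative_at_within) (auto intro!: derivative_eq_intros D[OF assms])
  have "((\<lambda>w. of_int (sg k e) * w * V' e w) has_real_derivative deriv (\<Phi> e) w) (at w within {0..})"
    unfolding has_field_derivative_def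
    by (rule has_derivative_transform[OF _ _ 2[unfolded has_field_derivative_def]])
       (use assms ode in \<open>auto simp: V'_def\<close>)
  moreover have "at w within {0..} \<noteq> bot"
  proof -
    have "{0::real..} \<noteq> {x}" for x
      by (metis atLeast_iff order_refl singletonD zero_le_one zero_neq_one)
    then have "w islimpt {0..}" using assms by (intro connected_imp_perfect) auto
    then show ?thesis by (simp add: trivial_limit_within)
  qed
  ultimately have "of_int (sg k e) * (V' e w + w * V'') = deriv (\<Phi> e) w"
    using 1 vector_derivative_unique_within has_real_derivative_iff_has_vector_derivative by blast
  then show ?thesis using that[OF V] s_nz[of e] by (simp add: field_simps)
qed

text \<open>The choice operator recovers (e, j) from the chart; \<open>ch_inj\<close> makes the pair
  unique.\<close>

definition metric :: "('n::finite, 'n piece_point set) tensor_field" where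
  "metric d x = (case (SOME (e, j). d = ch k e j) of (e, j) \<Rightarrow>
     mmat (sg k e) j (\<Phi> e (wnorm (sg k e) j x)) (B e (wnorm (sg k e) j x)) x)"

lemma metric_ch: "metric (ch k e j) x = mmat (sg k e) j (\<Phi> e (wnorm (sg k e) j x)) (B e (wnorm (sg k e) j x)) x"
proof -
  have "(SOME (e', j'). ch k e j = ch k e' j') = (e, j)"
    by (rule some_equality) (auto dest: ch_inj)
  then show ?thesis unfolding metric_def by simp
qed

lemma radial_metric: "radial_tensor k \<Phi> B metric"
  by (simp add: radial_tensor_def metric_ch)

lemma metric_pullback:
  assumes "similarity A 1" shows "is_pullback (Mk_atlas k) (Mk_act k A) metric metric"
proof (rule radial_pullback[OF k assms radial_metric radial_metric])
  show "\<Phi> (\<not> e) (1 / w) = \<Phi> e w" if "w > 0" for e w using opp that .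
  \<comment> \<open>The gluing of the fibre components is the derivative of that of the momentum;
    the sign of \<open>sg\<close> reverses together with the sign of d (1 / w).\<close>
  show "B (\<not> e) (1 / w) = w\<^sup>2 * B e w" if "w > 0" for e w
  proof -
    have "((\<lambda>w. \<Phi> (\<not> e) (1 / w)) has_real_derivative deriv (\<Phi> (\<not> e)) (1 / w) * (- 1 / w\<^sup>2)) (at w)"
      using that by (intro DERIV_chain2[OF D(1)]) (auto intro!: derivative_eq_intros simp: power2_eq_square)
    moreover have "((\<lambda>w. \<Phi> (\<not> e) (1 / w)) has_real_derivative deriv (\<Phi> e) w) (at w)"
      by (rule has_field_derivative_transform_within_open[OF D(1) open_greaterThan[of 0]]) (use that opp in auto)
    ultimately have "deriv (\<Phi> (\<not> e)) (1 / w) * (- 1 / w\<^sup>2) = deriv (\<Phi> e) w" by (rule DERIV_unique)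
    moreover have "real_of_int (sg k (\<not> e)) = - of_int (sg k e)" by (simp add: sg_def)
    ultimately show ?thesis using that s_nz[of e] by (simp add: field_simps power2_eq_square)
  qed
qed auto

text \<open>The soliton potential is \<open>c\<close> times the momentum; by
  \<open>wnorm_ch_eq\<close> the chosen value does not depend on the chart.\<close>

definition pot :: "'n::finite piece_point set \<Rightarrow> real" where
  "pot P = c * (SOME r. \<exists>e j x. P = ch k e j x \<and> r = \<Phi> e (wnorm (sg k e) j x))"

lemma pot_ch: "pot (ch k e j x) = c * \<Phi> e (wnorm (sg k e) j x)"
proof -
  have "(SOME r. \<exists>e' j' x'. ch k e j x = ch k e' j' x' \<and> r = \<Phi> e' (wnorm (sg k e') j' x')) = \<Phi> e (wnorm (sg k e) j x)"
    by (rule some_equality) (use wnorm_ch_eq[OF k, of _ _ _ _ _ _ \<Phi>] opp in \<open>blast, metis\<close>)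
  then show ?thesis by (simp add: pot_def)
qed

lemma soliton:
  assumes n: "n = CARD('n::finite)"
  shows "kahler_ricci_soliton (Mk_atlas k) (metric :: ('n, 'n piece_point set) tensor_field)"
proof -
  have kahler: "kahler_metric (Mk_atlas k) (metric :: ('n, 'n piece_point set) tensor_field)"
    unfolding kahler_metric_def is_pullback_id_iff[OF k] ball_atlas
  proof (intro conjI allI)
    show "is_pullback (Mk_atlas k) (Mk_act k (mat 1)) metric (metric :: ('n, 'n piece_point set) tensor_field)"
      by (rule metric_pullback[OF similarity_1])
    fix e and j :: 'n
    show "smooth (metric (ch k e j))"
      unfolding smooth_iff_smooth_on metric_ch[abs_def]
      by (rule smooth_on_mmat[OF smooth_profile smooth_B eps])
    fix x
    note w = wnorm_nonneg[of "sg k e" j x]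
    show "pos_def_hermitian (metric (ch k e j) x)"
      unfolding metric_ch using pos[OF w] deriv_pos[OF w] by (rule pos_def_mmat)
    show "wirt m (\<lambda>u. metric (ch k e j) u $ i $ l) x = wirt i (\<lambda>u. metric (ch k e j) u $ m $ l) x" for i l m
      unfolding metric_ch
      by (rule mmat_closed[OF _ D_B[OF w]]) (use D(1)[OF w, of e] s_nz[of e] in simp)
  qed
  have "\<forall>e (j :: 'n). smooth (pot \<circ> ch k e j) \<and> (\<forall>x i l.
      ricci (metric (ch k e j)) i l x - metric (ch k e j) x $ i $ l =
        hess_mixed (\<lambda>u. complex_of_real (pot (ch k e j u))) i l x \<and>
      hess_pure (metric (ch k e j)) (\<lambda>u. complex_of_real (pot (ch k e j u))) i l x = 0)"
  proof (intro allI conjI)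
    fix e and j :: 'n
    define s where "s = sg k e"
    have W: "wnorm s j ` UNIV \<subseteq> {-\<epsilon><..}" by (rule wnorm_image[OF eps])
    show "smooth (pot \<circ> ch k e j)"
      unfolding smooth_iff_smooth_on o_def pot_ch s_def[symmetric]
      by (intro smooth_on_mult open_UNIV smooth_on_const smooth_on_compose_real[OF _ smooth_profile smooth_on_wnorm W])
    fix x :: "complex^'n" and i l
    let ?w = "wnorm s j x" and ?G = "metric (ch k e j)" and ?F = "\<lambda>u. complex_of_real (pot (ch k e j u))"
    note w = wnorm_nonneg[of s j]
    have DF: "(( \<lambda>t. c * \<Phi> e t) has_real_derivative c * deriv (\<Phi> e) (wnorm s j u)) (at (wnorm s j u))" for u
      by (rule DERIV_cmult[OF D(1)[OF w]])
    have F: "has_wirt ?F (\<lambda>m. of_real (c * deriv (\<Phi> e) (wnorm s j u) * bnorm j u powi s) * cnj (u $ j) * xic s j u m)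
        (\<lambda>m. of_real (c * deriv (\<Phi> e) (wnorm s j u) * bnorm j u powi s) * u $ j * cnj (xic s j u m)) u" for u
      using has_wirt_wnorm_fun[OF DF] by (simp only: pot_ch s_def[symmetric])
    \<comment> \<open>By \<open>det_mmat\<close> the determinant is positive, and minus its
      logarithm is a potential of the shape required by \<open>has_wirt_potential\<close>, with
      coefficient n - s.\<close>
    have L: "Ln (det (?G u)) = - of_real ((real n - s) * ln (bnorm j u) + V0 e (wnorm s j u))" for u
    proof -
      have p: "\<Phi> e (wnorm s j u) > 0" "B e (wnorm s j u) > 0" using pos[OF w] deriv_pos[OF w] by auto
      have d1: "det (?G u) = of_real (\<Phi> e (wnorm s j u) ^ (n - 1) * B e (wnorm s j u) * bnorm j u powi (s - int n))"
        unfolding metric_ch s_def[symmetric] by (subst det_mmat[OF p(1)]) (simp add: n)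
      have d2: "\<Phi> e (wnorm s j u) ^ (n - 1) * B e (wnorm s j u) * bnorm j u powi (s - int n) =
         exp (- ((real n - s) * ln (bnorm j u) + V0 e (wnorm s j u)))"
      proof -
        have "n \<ge> 1" using n by simp
        have "bnorm j u powi m = exp (of_int m * ln (bnorm j u))" for m
          using powr_real_of_int'[of "bnorm j u" m] bnorm_pos[of j u] by (simp add: powr_def)
        from this[of "s - int n"] have "bnorm j u powi (s - int n) = exp ((s - real n) * ln (bnorm j u))" by simp
        moreover have "\<Phi> e (wnorm s j u) ^ (n - 1) = exp ((real n - 1) * ln (\<Phi> e (wnorm s j u)))"
          using exp_of_nat_mult[of "n - 1" "ln (\<Phi> e (wnorm s j u))"] p(1) \<open>n \<ge> 1\<close> by (simp add: of_nat_diff)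
        moreover have "B e (wnorm s j u) = exp (ln (B e (wnorm s j u)))" using p(2) by simp
        ultimately have "\<Phi> e (wnorm s j u) ^ (n - 1) * B e (wnorm s j u) * bnorm j u powi (s - int n) =
          exp ((real n - 1) * ln (\<Phi> e (wnorm s j u))) * exp (ln (B e (wnorm s j u))) * exp ((s - real n) * ln (bnorm j u))"
          by metis
        also have "\<dots> = exp (- ((real n - s) * ln (bnorm j u) + V0 e (wnorm s j u)))"
          unfolding exp_add[symmetric] V0_def by (simp add: algebra_simps)
        finally show ?thesis .
      qed
      show ?thesis unfolding d1 d2 Ln_of_real[OF exp_gt_zero] ln_exp by (simp only: of_real_minus)
    qed
    define K where "K = (\<lambda>u. of_real (real n - s) * cnj (nuc j u l) + of_real (V' e (wnorm s j u) * bnorm j u powi s) * u $ j * cnj (xic s j u l))"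
    define H where "H = (\<lambda>u. of_real (c * deriv (\<Phi> e) (wnorm s j u) * bnorm j u powi s) * u $ j * cnj (xic s j u l))"
    have wb: "wirt_bar l (\<lambda>u. Ln (det (?G u))) = (\<lambda>u. - (K u + H u))"
    proof
      fix u
      note hw = has_wirt_minus[OF has_wirt_potential[where V' = "\<lambda>w. V' e w + c * deriv (\<Phi> e) w"
            and V = "V0 e" and c = "real n - s", OF D_V0[OF w]]]
      show "wirt_bar l (\<lambda>u. Ln (det (?G u))) u = - (K u + H u)"
        unfolding L has_wirt_eqs(2)[OF hw] K_def H_def by (simp add: algebra_simps)
    qed
    have H: "wirt_bar l ?F = H"
      by (rule ext) (simp add: has_wirt_eqs(2)[OF F] H_def)
    obtain V'' where V'': "(V' e has_real_derivative V'') (at ?w)" "B e ?w = V' e ?w + ?w * V''"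
      using D_V'[OF w] by blast
    \<comment> \<open>Here the equation enters: the base component produced by the remaining
      potential is that of the metric, and \<open>V''(2)\<close> says the same of the fibre
      component.\<close>
    have "\<Phi> e ?w = real n - s + s * ?w * V' e ?w"
      using ode[where w = "?w" and e = e, OF w] unfolding V'_def s_def by simp
    from has_wirt_potential2[OF V''(1) this V''(2)]
    obtain q where K: "has_wirt K (\<lambda>m. ?G x $ m $ l) q x"
      unfolding K_def metric_ch s_def[symmetric] by blast
    have DH: "((\<lambda>t. c * deriv (\<Phi> e) t) has_real_derivative c * deriv (deriv (\<Phi> e)) ?w) (at ?w)"
      by (rule DERIV_cmult[OF D(2)[OF w]])
    have H_eq: "H = (\<lambda>u. of_real (c * deriv (\<Phi> e) (wnorm s j u)) * of_real (bnorm j u powi s) * u $ j * cnj (xic s j u l))"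
      by (simp add: H_def)
    have "\<exists>p q. has_wirt H p q x"
      unfolding H_eq
      by (intro exI, rule has_wirt_mult[OF has_wirt_mult[OF has_wirt_mult[OF has_wirt_wnorm_fun[OF DH] has_wirt_powi] has_wirt_nth]
        has_wirt_cnj_xic])
    then obtain p' q' where H': "has_wirt H p' q' x" by blast
    have "ricci ?G i l x = ?G x $ i $ l + p' i"
      unfolding ricci_def wb using has_wirt_eqs(1)[OF has_wirt_minus[OF has_wirt_add[OF K H']]] by simp
    moreover have "hess_mixed ?F i l x = p' i"
      unfolding hess_mixed_def H using has_wirt_eqs(1)[OF H'] by simp
    ultimately show "ricci ?G i l x - ?G x $ i $ l = hess_mixed ?F i l x" by simp
    show "hess_pure ?G ?F i l x = 0"
    proof (rule hess_pure_zero)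
      show "invertible (?G x)"
        unfolding metric_ch s_def[symmetric] using deriv_pos[OF w]
        by (intro invertible_pos_def pos_def_mmat pos[OF w]) (simp add: s_def)
      show "(\<lambda>u. ?G u $ i $ l) differentiable at x" for i l
        unfolding metric_ch
        using has_wirt_mmat[OF D(1)[OF wnorm_nonneg] D_B[OF wnorm_nonneg]] has_wirt_differentiable by blast
      \<comment> \<open>In column \<open>j\<close> the \<open>fsc\<close> part vanishes and the
        conjugated factor \<open>xic\<close> is 1, so the derivative of the potential is
        proportional to that column.\<close>
      show "wirt l ?F u = complex_of_real (c * s) * cnj (u $ j) * ?G u $ l $ j" for l u
        unfolding has_wirt_eqs(1)[OF F] metric_ch s_def[symmetric]
        using s_nz[of e] by (simp add: mmat_def fsc_def nuc_def xic_def s_def[symmetric])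
    qed
  qed
  with kahler show ?thesis unfolding kahler_ricci_soliton_def ball_atlas by blast
qed

end

section \<open>The soliton constant\<close>

text \<open>The integral of P' times the positive factor \<open>exp (- c * n)\<close>. Centring the
  exponential at the midpoint n makes the integrand decrease in \<open>c\<close> at every positive x
  other than n.\<close>

definition moment :: "nat \<Rightarrow> nat \<Rightarrow> real \<Rightarrow> real" where
  "moment n k c = integral {real n - k..real n + k} (\<lambda>x. (real n - x) * x ^ (n - 1) * exp (c * (x - real n)))"

lemma moment_integrable:
  "(\<lambda>x. (real n - x) * x ^ (n - 1) * exp (c * (x - real n))) integrable_on {a..b}"
  by (intro integrable_continuous_interval continuous_intros)

lemma linear_moment: "((\<lambda>x. (real n - x) * C) has_integral 0) {real n - k..real n + k}" if "k \<ge> 0"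
proof -
  have "((\<lambda>x. (real n - x) * C) has_integral
      (- ((real n - (real n + k))\<^sup>2 / 2 * C)) - (- ((real n - (real n - k))\<^sup>2 / 2 * C))) {real n - k..real n + k}"
    using that
    by (intro fundamental_theorem_of_calculus)
       (auto intro!: derivative_eq_intros simp: has_real_derivative_iff_has_vector_derivative[symmetric] field_simps)
  then show ?thesis by simp
qed

text \<open>x^(n-1) is at most n^(n-1) to the left of the midpoint, where n - x is positive, and at
  least that to the right. Replacing it by the constant can only increase the integral, which then
  vanishes by symmetry.\<close>

lemma moment_0_le:
  assumes "k \<le> n"
  shows "moment n k 0 \<le> 0"
proof -
  have "moment n k 0 \<le> integral {real n - k..real n + k} (\<lambda>x. (real n - x) * real n ^ (n - 1))"
    unfolding moment_def
  proof (rule integral_le[OF moment_integrable])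
    show "(\<lambda>x. (real n - x) * real n ^ (n - 1)) integrable_on {real n - k..real n + k}"
      using linear_moment[of k n] by (auto simp: integrable_on_def)
    fix x assume x: "x \<in> {real n - k..real n + k}"
    have "(real n - x) * x ^ (n - 1) \<le> (real n - x) * real n ^ (n - 1)"
    proof (cases "x \<le> n")
      case True
      then show ?thesis using x assms by (intro mult_left_mono power_mono) auto
    next
      case False
      then show ?thesis by (intro mult_left_mono_neg power_mono) auto
    qed
    then show "(real n - x) * x ^ (n - 1) * exp (0 * (x - real n)) \<le> (real n - x) * real n ^ (n - 1)" by simp
  qed
  also have "\<dots> = 0" using linear_moment[of k n] by (intro integral_unique) auto
  finally show ?thesis .
qed

text \<open>For c = - (n - 1) the weight is (x exp (n - x))^(n-1). Its base decreases for x \<ge> 1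
  and equals n at the midpoint, which reverses the comparison with n^(n-1). The interval lies in x
  \<ge> 1 because k < n.\<close>

lemma moment_neg_ge:
  assumes "k < n"
  shows "moment n k (- (real n - 1)) \<ge> 0"
proof -
  have "0 = integral {real n - k..real n + k} (\<lambda>x. (real n - x) * real n ^ (n - 1))"
    using linear_moment[of k n] by (intro integral_unique[symmetric]) auto
  also have "\<dots> \<le> moment n k (- (real n - 1))"
    unfolding moment_def
  proof (rule integral_le[OF _ moment_integrable])
    show "(\<lambda>x. (real n - x) * real n ^ (n - 1)) integrable_on {real n - k..real n + k}"
      using linear_moment[of k n] by (auto simp: integrable_on_def)
    fix x assume x: "x \<in> {real n - k..real n + k}"
    then have x1: "x \<ge> 1" using assms by auto
    have n1: "real n \<ge> 1" using assms by simp
    have e: "x ^ (n - 1) * exp (- (real n - 1) * (x - real n)) = (x * exp (real n - x)) ^ (n - 1)"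
    proof -
      have "- (real n - 1) * (x - real n) = real (n - 1) * (real n - x)"
        using assms by (simp add: of_nat_diff algebra_simps)
      then show ?thesis by (simp only: exp_of_nat_mult power_mult_distrib)
    qed
    have "(real n - x) * real n ^ (n - 1) \<le> (real n - x) * (x * exp (real n - x)) ^ (n - 1)"
    proof (cases "x \<le> n")
      case True
      \<comment> \<open>The difference of the two sides is (n - x) (x - 1).\<close>
      have "real n \<le> x * (1 + (real n - x))"
        using mult_nonneg_nonneg[of "real n - x" "x - 1"] x1 True by (simp add: algebra_simps)
      also have "\<dots> \<le> x * exp (real n - x)"
        using exp_ge_add_one_self[of "real n - x"] x1 by (intro mult_left_mono) auto
      finally show ?thesis using True by (intro mult_left_mono power_mono) auto
    next
      case False
      have "x \<le> real n * (1 + (x - real n) / real n)" using n1 by (simp add: field_simps)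
      also have "\<dots> \<le> real n * exp ((x - real n) / real n)"
        using exp_ge_add_one_self[of "(x - real n) / real n"] n1 by (intro mult_left_mono) auto
      also have "\<dots> \<le> real n * exp (x - real n)"
      proof -
        have "x - real n \<le> (x - real n) * real n" using False n1 mult_left_mono[of 1 "real n" "x - real n"] by simp
        then have "(x - real n) / real n \<le> x - real n" using n1 by (simp add: divide_le_eq)
        then show ?thesis by (intro mult_left_mono) auto
      qed
      finally have "x * exp (real n - x) \<le> real n * exp (x - real n) * exp (real n - x)"
        by (intro mult_right_mono) auto
      also have "\<dots> = real n" by (simp flip: exp_add add: mult.assoc)
      finally show ?thesis using False x1 by (intro mult_left_mono_neg power_mono) auto
    qed
    then show "(real n - x) * real n ^ (n - 1) \<le> (real n - x) * x ^ (n - 1) * exp (- (real n - 1) * (x - real n))"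
      unfolding mult.assoc e .
  qed
  finally show ?thesis .
qed

lemma moment_zero_exists:
  assumes "k < n"
  obtains c where "moment n k c = 0"
proof -
  have "continuous_on UNIV (\<lambda>c. integral (cbox (real n - k) (real n + k)) (\<lambda>x. (real n - x) * x ^ (n - 1) * exp (c * (x - real n))))"
    by (rule integral_continuous_on_param) (auto simp: case_prod_unfold intro!: continuous_intros)
  then have "continuous_on UNIV (moment n k)" by (simp add: moment_def[abs_def])
  then have "continuous_on {- (real n - 1)..0} (moment n k)" by (rule continuous_on_subset) auto
  from IVT2'[OF moment_0_le moment_neg_ge _ this] that assms show ?thesis by auto
qed

text \<open>In the difference of the integrands, n - x and exp (c1 (x - n)) - exp (c2 (x - n)) have
  the same sign, so it is positive except at x = n.\<close>

lemma moment_strict: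
  assumes k: "k \<ge> 1" "k < n" and c: "c1 < c2"
  shows "moment n k c2 < moment n k c1"
proof -
  define d where "d = (\<lambda>x. (real n - x) * x ^ (n - 1) * exp (c1 * (x - n)) - (real n - x) * x ^ (n - 1) * exp (c2 * (x - n)))"
  have cont: "continuous_on {real n - k..real n + k} d" unfolding d_def by (intro continuous_intros)
  have d: "d x \<ge> 0" "x \<noteq> n \<Longrightarrow> d x > 0" if "x \<in> {real n - k..real n + k}" for x
  proof -
    have x: "x > 0" using that k by auto
    have eq: "d x = x ^ (n - 1) * ((real n - x) * (exp (c1 * (x - n)) - exp (c2 * (x - n))))"
      by (simp add: d_def algebra_simps)
    have "(real n - x) * (exp (c1 * (x - n)) - exp (c2 * (x - n))) > 0" if "x \<noteq> n"
    proof (cases "x < n")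
      case True
      then have "c2 * (x - n) < c1 * (x - n)" using c by (intro mult_strict_right_mono_neg) auto
      then show ?thesis using True by (intro mult_pos_pos) auto
    next
      case False
      then have "c1 * (x - n) < c2 * (x - n)" using c that by (intro mult_strict_right_mono) auto
      then show ?thesis using False that by (intro mult_neg_neg) auto
    qed
    then show "x \<noteq> n \<Longrightarrow> d x > 0" using x unfolding eq by simp
    then show "d x \<ge> 0" by (cases "x = n") (auto simp: d_def)
  qed
  have eq: "integral {real n - k..real n + k} d = moment n k c1 - moment n k c2"
    unfolding d_def moment_def by (rule integral_diff[OF moment_integrable moment_integrable])
  have "integral {real n - k..real n + k} d \<noteq> 0"
  proof
    assume "integral {real n - k..real n + k} d = 0"
    moreover have "real n - k < real n + k" using k by simp
    ultimately have "\<forall>x\<in>{real n - k..real n + k}. d x = 0"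
      using integral_eq_0_iff[OF cont, of] d(1) by auto
    then have "d (real n + k) = 0" by auto
    then show False using d(2)[of "real n + k"] k by auto
  qed
  moreover have "integral {real n - k..real n + k} d \<ge> 0" using d(1) by (intro integral_nonneg integrable_continuous_interval cont) auto
  ultimately show ?thesis using eq by linarith
qed

lemma moment_eq_0_iff:
  assumes k: "k < n" and P: "\<And>x. x \<in> {real n - k..real n + k} \<Longrightarrow>
      (P has_real_derivative (real n - x) * x ^ (n - 1) * exp (c * x)) (at x)"
  shows "moment n k c = 0 \<longleftrightarrow> P (real n + k) = P (real n - k)"
proof -
  have "((\<lambda>x. (real n - x) * x ^ (n - 1) * exp (c * x)) has_integral P (real n + k) - P (real n - k)) {real n - k..real n + k}"
  proof (rule fundamental_theorem_of_calculus)
    show "(P has_vector_derivative (real n - x) * x ^ (n - 1) * exp (c * x)) (at x within {real n - k..real n + k})"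
      if "x \<in> {real n - k..real n + k}" for x :: real
      using has_field_derivative_at_within[OF P[OF that]]
      by (simp only: has_real_derivative_iff_has_vector_derivative)
  qed simp
  then have "((\<lambda>x. (real n - x) * x ^ (n - 1) * exp (c * x) * exp (- c * real n)) has_integral
      (P (real n + k) - P (real n - k)) * exp (- c * real n)) {real n - k..real n + k}"
    by (rule has_integral_mult_left)
  moreover have "(\<lambda>x. (real n - x) * x ^ (n - 1) * exp (c * x) * exp (- c * real n)) = (\<lambda>x. (real n - x) * x ^ (n - 1) * exp (c * (x - real n)))"
    by (simp add: fun_eq_iff right_diff_distrib mult.assoc flip: exp_add)
  ultimately have "moment n k c = (P (real n + k) - P (real n - k)) * exp (- c * real n)"
    unfolding moment_def by (intro integral_unique) simp
  then show ?thesis by simp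
qed

section \<open>The profile function\<close>

text \<open>The invariant coordinate \<open>W\<close> with \<open>W' / W = \<kappa> / f\<close> extends smoothly across the simple zero \<open>0\<close> of
  \<open>f\<close>: removing singularities twice shows that \<open>\<kappa> / f - 1 / t\<close> is regular.\<close>

lemma endpoint_coordinate:
  fixes f :: "complex \<Rightarrow> complex" and fr :: "real \<Rightarrow> real"
  assumes hol: "f holomorphic_on D" "open D" and f0: "f 0 = 0" "(f has_field_derivative of_real \<kappa>) (at 0)"
    and \<kappa>: "\<kappa> > 0" and L: "L > 0" "of_real ` {0..<L} \<subseteq> D"
    and fr: "\<And>t. t \<in> {0<..<L} \<Longrightarrow> f (of_real t) = of_real (fr t)" "\<And>t. t \<in> {0<..<L} \<Longrightarrow> fr t > 0"
  obtains \<delta> W where "\<delta> > 0" "smooth_on {-\<delta><..<L} W" "\<And>t. t \<in> {-\<delta><..<L} \<Longrightarrow> deriv W t > 0"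
    "W 0 = 0" "\<And>t. t \<in> {0<..<L} \<Longrightarrow> deriv W t * fr t = \<kappa> * W t"
proof -
  \<comment> \<open>f z / z with the singularity removed; its value at 0 is \<kappa>.\<close>
  define H where "H = (\<lambda>z. if z = 0 then deriv f 0 else (f z - f 0) / (z - 0))"
  have H: "H holomorphic_on D" unfolding H_def by (rule pole_lemma_open[OF hol])
  have d0: "deriv f 0 = of_real \<kappa>" using f0(2) by (rule DERIV_imp_deriv)
  \<comment> \<open>A positive real part keeps \<open>H\<close> away from 0 and passes to \<kappa> /
    H, where it becomes the sign of \<open>deriv W\<close>. The real interval lies in
    \<open>D1\<close>, since \<open>f\<close> is positive on it off 0 and H 0 = \<kappa>.\<close>
  define D1 where "D1 = D \<inter> {z. Re (H z) > 0}"
  have "continuous_on D (\<lambda>z. Re (H z))" by (intro continuous_intros holomorphic_on_imp_continuous_on H)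
  then have "open (D \<inter> (\<lambda>z. Re (H z)) -` {0<..})"
    using continuous_on_open_vimage[OF hol(2)] by (metis Int_commute open_greaterThan)
  moreover have "D \<inter> (\<lambda>z. Re (H z)) -` {0<..} = D1" by (auto simp: D1_def)
  ultimately have oD1: "open D1" by simp
  have Ht: "H (of_real t) = of_real (fr t / t)" if "t \<in> {0<..<L}" for t
    using that fr f0 by (simp add: H_def)
  have in_D1: "of_real t \<in> D1" if "t \<in> {0..<L}" for t
  proof (cases "t = 0")
    case True
    then show ?thesis using that L d0 \<kappa> by (auto simp: D1_def H_def)
  next
    case False
    then have t: "t \<in> {0<..<L}" using that by auto
    then show ?thesis using Ht[OF t] fr(2)[OF t] that L by (auto simp: D1_def)
  qed
  define q where "q = (\<lambda>z. of_real \<kappa> / H z)"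
  have Hnz: "H z \<noteq> 0" if "z \<in> D1" for z using that by (auto simp: D1_def)
  have q: "q holomorphic_on D1"
    unfolding q_def using Hnz by (intro holomorphic_intros holomorphic_on_subset[OF H]) (auto simp: D1_def)
  define e where "e = (\<lambda>z. if z = 0 then deriv q 0 else (q z - q 0) / (z - 0))"
  have e: "e holomorphic_on D1" unfolding e_def by (rule pole_lemma_open[OF q oD1])
  have q0: "q 0 = 1" using \<kappa> by (simp add: q_def H_def d0)
  have qe: "q z = 1 + z * e z" for z by (simp add: e_def q0)
  have "0 \<in> D1" using in_D1[of 0] L by simp
  then obtain \<delta> where \<delta>: "\<delta> > 0" "ball 0 \<delta> \<subseteq> D1" using oD1 open_contains_ball by blast
  define J where "J = {-\<delta><..<L}"
  have J: "of_real ` J \<subseteq> D1"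
  proof
    fix z assume "z \<in> complex_of_real ` J"
    then obtain t where t: "z = of_real t" "t \<in> J" by auto
    show "z \<in> D1"
    proof (cases "t < 0")
      case True
      then have "z \<in> ball 0 \<delta>" using t by (auto simp: J_def)
      then show ?thesis using \<delta> by blast
    next
      case False
      then show ?thesis using t in_D1 by (auto simp: J_def)
    qed
  qed
  define r where "r = (\<lambda>t. Re (e (of_real t)))"
  have r: "smooth_on J r" unfolding r_def
    by (rule smooth_on_Re_holomorphic[OF e oD1 _ J]) (simp add: J_def)
  have oJ: "open J" by (simp add: J_def)
  have "isCont r t" if "t \<in> J" for t
    using smooth_on_differentiable[OF r that] differentiable_imp_continuous_within by blast
  then have "\<exists>E. \<forall>t. ereal (-\<delta>) < t \<longrightarrow> t < ereal L \<longrightarrow> (E has_vector_derivative r t) (at t)"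
    using \<delta> L by (intro einterval_antiderivative) (auto simp: J_def)
  then obtain E where E: "\<And>t. t \<in> J \<Longrightarrow> (E has_real_derivative r t) (at t)"
    by (auto simp: J_def has_real_derivative_iff_has_vector_derivative)
  have smE: "smooth_on J E" by (rule smooth_on_real_derivI[OF oJ E r])
  \<comment> \<open>With q = \<kappa> / H the function E has derivative (q - 1) / t on the positive
    part of the interval, so W' / W = 1 / t + E' = q / t = \<kappa> / f there.\<close>
  define W where "W = (\<lambda>t. t * exp (E t))"
  have smW: "smooth_on J W"
    unfolding W_def
    by (intro smooth_on_mult oJ smooth_on_linear[OF bounded_linear_ident] smooth_on_compose_real[OF oJ smooth_on_exp smE]) auto
  have dW: "deriv W t = exp (E t) * Re (q (of_real t))" if "t \<in> J" for t
  proof (rule DERIV_imp_deriv)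
    have "(W has_real_derivative exp (E t) * (1 + t * r t)) (at t)"
      unfolding W_def by (auto intro!: derivative_eq_intros E[OF that] simp: algebra_simps)
    then show "(W has_real_derivative exp (E t) * Re (q (of_real t))) (at t)"
      by (simp add: qe r_def)
  qed
  have "deriv W t > 0" if "t \<in> J" for t
  proof -
    have "Re (H (of_real t)) > 0" using J that by (auto simp: D1_def)
    then have "Re (q (of_real t)) > 0" using \<kappa>
      by (simp add: q_def Re_divide sum_power2_gt_zero_iff)
    then show ?thesis by (simp add: dW[OF that])
  qed
  moreover have "deriv W t * fr t = \<kappa> * W t" if "t \<in> {0<..<L}" for t
  proof -
    have "t \<in> J" using that \<delta> by (auto simp: J_def)
    moreover have "q (of_real t) = of_real (\<kappa> * t / fr t)" unfolding q_def Ht[OF that] by simp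
    ultimately show ?thesis using dW[of t] fr(2)[OF that] by (simp add: W_def)
  qed
  moreover have "W 0 = 0" by (simp add: W_def)
  ultimately show ?thesis using that[of \<delta> W] \<delta> smW by (simp add: J_def)
qed

text \<open>\<open>W\<close> increases and by \<open>unb\<close> takes every value above W (-
  \<delta> / 2), so its inverse \<open>T\<close> lives on a half-line reaching below 0. Since T' = 1
  / W'(T) is autonomous, \<open>smooth_on_autonomous\<close> applies.\<close>

lemma inverse_coordinate:
  fixes W :: "real \<Rightarrow> real"
  assumes \<delta>: "\<delta> > 0" "L > 0" and W: "smooth_on {-\<delta><..<L} W" "\<And>t. t \<in> {-\<delta><..<L} \<Longrightarrow> deriv W t > 0" "W 0 = 0"
    and unb: "\<And>y. \<exists>t\<in>{0<..<L}. W t > y"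
  obtains \<epsilon> T where "\<epsilon> > 0" "smooth_on {-\<epsilon><..} T"
    "\<And>w. w > -\<epsilon> \<Longrightarrow> T w \<in> {-\<delta><..<L} \<and> W (T w) = w \<and> (T has_real_derivative 1 / deriv W (T w)) (at w)"
    "\<And>w. w \<ge> 0 \<Longrightarrow> T w \<in> {0..<L}" "\<And>w. w > 0 \<Longrightarrow> T w \<in> {0<..<L}" "\<And>t. t \<in> {0..<L} \<Longrightarrow> T (W t) = t"
proof -
  let ?J = "{-\<delta><..<L}"
  have dW: "(W has_real_derivative deriv W t) (at t)" if "t \<in> ?J" for t
    using smooth_on_real_deriv(2)[OF W(1)] that by auto
  have mono: "W t < W u" if "t \<in> ?J" "u \<in> ?J" "t < u" for t u
  proof (rule DERIV_pos_imp_increasing[OF that(3)])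
    fix v assume "t \<le> v" "v \<le> u"
    then have "v \<in> ?J" using that by auto
    then show "\<exists>y. (W has_real_derivative y) (at v) \<and> 0 < y" using dW W(2) by blast
  qed
  have inj: "t = u" if "t \<in> ?J" "u \<in> ?J" "W t = W u" for t u
    using mono[of t u] mono[of u t] that by (cases t u rule: linorder_cases) auto
  \<comment> \<open>Only half of the margin is used: the endpoint - \<delta> / 2 still belongs to
    the domain of \<open>W\<close>, as the intermediate value theorem and the continuity of the
    inverse require.\<close>
  define \<epsilon> where "\<epsilon> = - W (- \<delta> / 2)"
  have \<epsilon>: "\<epsilon> > 0" using mono[of "- \<delta> / 2" 0] \<delta> W(3) by (simp add: \<epsilon>_def)
  have cont: "isCont W t" if "t \<in> ?J" for t using DERIV_isCont[OF dW[OF that]] .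
  have ex: "\<exists>t\<in>?J. W t = w" if w: "w > -\<epsilon>" for w
  proof -
    obtain u where u: "u \<in> {0<..<L}" "W u > w" using unb by blast
    have "\<exists>t\<ge>- \<delta> / 2. t \<le> u \<and> W t = w"
      by (rule IVT) (use u w \<delta> cont in \<open>auto simp: \<epsilon>_def\<close>)
    then obtain t where "- \<delta> / 2 \<le> t" "t \<le> u" "W t = w" by blast
    then show ?thesis using u \<delta> by (intro bexI[of _ t]) auto
  qed
  define T where "T = (\<lambda>w. SOME t. t \<in> ?J \<and> W t = w)"
  have T: "T w \<in> ?J" "W (T w) = w" if "w > -\<epsilon>" for w
    using someI_ex[of "\<lambda>t. t \<in> ?J \<and> W t = w"] ex[OF that] unfolding T_def by blast+
  have TW: "T (W t) = t" if "t \<in> ?J" "W t > -\<epsilon>" for t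
    using inj[OF T(1)[OF that(2)] that(1) T(2)[OF that(2)]] .
  have dT: "(T has_real_derivative 1 / deriv W (T w)) (at w)" if w: "w > -\<epsilon>" for w
  proof -
    define t where "t = T w"
    have t: "t \<in> ?J" "W t = w" using T[OF w] by (auto simp: t_def)
    have t2: "- \<delta> / 2 < t"
    proof (rule ccontr)
      assume "\<not> - \<delta> / 2 < t"
      then have "W t \<le> W (- \<delta> / 2)" using mono[of t "- \<delta> / 2"] t \<delta> by (cases "t = - \<delta> / 2") auto
      then show False using t w by (simp add: \<epsilon>_def)
    qed
    have "isCont T (W t)"
    proof (rule isCont_inverse_function2[of "- \<delta> / 2" t "(t + L) / 2"])
      show "t < (t + L) / 2" using t by simp
      \<comment> \<open>At the left endpoint the value is exactly -\<epsilon>, which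
        \<open>TW\<close> excludes, but the choice defining \<open>T\<close> still has a witness
        there.\<close>
      show "T (W z) = z" if "- \<delta> / 2 \<le> z" "z \<le> (t + L) / 2" for z
      proof (cases "z = - \<delta> / 2")
        case False
        then have "W z > - \<epsilon>" using mono[of "- \<delta> / 2" z] that \<delta> t by (simp add: \<epsilon>_def)
        then show ?thesis using that \<delta> t by (intro TW) auto
      next
        case True
        have "z \<in> ?J" using that \<delta> t by auto
        have "\<exists>t. t \<in> ?J \<and> W t = W z" using \<open>z \<in> ?J\<close> by blast
        from someI_ex[OF this] have "T (W z) \<in> ?J" "W (T (W z)) = W z" by (auto simp: T_def)
        then show ?thesis using inj \<open>z \<in> ?J\<close> by blast
      qed
      show "isCont W z" if "- \<delta> / 2 \<le> z" "z \<le> (t + L) / 2" for z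
        using that \<delta> t by (intro cont) auto
    qed (rule t2)
    then have iT: "isCont T w" using t by simp
    have "(W has_real_derivative deriv W t) (at (T w))" using dW[OF t(1)] by (simp add: t_def)
    then have "(T has_real_derivative inverse (deriv W t)) (at w)"
      by (rule DERIV_inverse_function[where a = "-\<epsilon>" and b = "w + 1"])
         (use w W(2)[OF t(1)] T(2) iT in auto)
    then show ?thesis by (simp add: t_def inverse_eq_divide)
  qed
  have smT: "smooth_on {-\<epsilon><..} T"
  proof (rule smooth_on_autonomous[where R = "\<lambda>t. 1 / deriv W t" and J = ?J])
    have "smooth_on ?J (\<lambda>t. deriv W t powi - 1)"
      by (rule smooth_on_compose_real[OF _ smooth_on_power_int smooth_on_real_deriv(1)[OF W(1)]]) (use W(2) in auto)
    then show "smooth_on ?J (\<lambda>t. 1 / deriv W t)" by (simp add: power_int_minus divide_inverse)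
  qed (use dT T in auto)
  have T0: "T 0 = 0" using TW[of 0] W(3) \<delta> \<epsilon> by simp
  have Tpos: "T w \<in> {0<..<L}" if "w > 0" for w
  proof -
    have w: "w > -\<epsilon>" using that \<epsilon> by simp
    have "T w > 0"
    proof (rule ccontr)
      assume "\<not> T w > 0"
      then have "W (T w) \<le> W 0" using mono[of "T w" 0] T(1)[OF w] \<delta> by (cases "T w = 0") auto
      then show False using T(2)[OF w] W(3) that by simp
    qed
    then show ?thesis using T(1)[OF w] by simp
  qed
  show ?thesis
  proof (rule that[OF \<epsilon> smT])
    show "T w \<in> ?J \<and> W (T w) = w \<and> (T has_real_derivative 1 / deriv W (T w)) (at w)" if "w > -\<epsilon>" for w
      using T[OF that] dT[OF that] by blast
    show "T w \<in> {0..<L}" if "w \<ge> 0" for w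
      using Tpos[of w] T0 that \<delta> by (cases "w = 0") auto
    show "T (W t) = t" if "t \<in> {0..<L}" for t
    proof (rule TW)
      show "W t > -\<epsilon>" using mono[of 0 t] W(3) \<epsilon> that \<delta> by (cases "t = 0") auto
    qed (use that \<delta> in auto)
  qed (rule Tpos)
qed

text \<open>Both ends are treated alike through the distance t of the momentum from the endpoint
  \<open>p e\<close>, in the direction \<open>\<sigma> e\<close> and over the length
  \<open>L\<close> = 2 k. At each end \<open>endpoint_coordinate\<close> linearises the flow s w a'
  = F(a), and \<open>inverse_coordinate\<close> yields the momentum as a function of w. The
  primitive is taken over the complex numbers because removing singularities needs holomorphic
  functions.\<close>

lemma profile_exists:
  fixes n k :: nat
  assumes k: "k \<ge> 1" "k < n"
  obtains \<Phi> c \<epsilon> where "soliton_profile k n \<Phi> c \<epsilon>"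
proof -
  obtain c where c: "moment n k c = 0" using moment_zero_exists[OF k(2)] by blast
  define a where "a = real n - k"
  define b where "b = real n + k"
  have ab: "0 < a" "a < b" using k by (auto simp: a_def b_def)
  have "(\<lambda>z. (of_nat n - z) * z ^ (n - 1) * exp (of_real c * z)) holomorphic_on UNIV"
    by (intro holomorphic_intros)
  from holomorphic_convex_primitive'[OF convex_UNIV open_UNIV this] obtain G :: "complex \<Rightarrow> complex"
    where G: "\<And>z. (G has_field_derivative (of_nat n - z) * z ^ (n - 1) * exp (of_real c * z)) (at z)"
    by (metis UNIV_I)
  define I where "I = (\<lambda>z. G z - G (of_real a))"
  have dI: "(I has_field_derivative (of_nat n - z) * z ^ (n - 1) * exp (of_real c * z)) (at z)" for z
    unfolding I_def by (auto intro!: derivative_eq_intros G)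
  have I_line: "((\<lambda>x. I (of_real x)) has_vector_derivative of_real ((real n - x) * x ^ (n - 1) * exp (c * x))) (at x)" for x
    using has_vector_derivative_real_field[OF dI[of "of_real x"]] by (simp flip: exp_of_real)
  define Ir where "Ir = (\<lambda>x. Re (I (of_real x)))"
  have dIr: "(Ir has_real_derivative (real n - x) * x ^ (n - 1) * exp (c * x)) (at x)" for x
    using bounded_linear.has_vector_derivative[OF bounded_linear_Re I_line[of x]]
    by (simp only: Ir_def has_real_derivative_iff_has_vector_derivative Re_complex_of_real)
  have "((\<lambda>x. Im (I (of_real x))) has_real_derivative 0) (at x)" for x
    using bounded_linear.has_vector_derivative[OF bounded_linear_Im I_line[of x]]
    by (simp only: has_real_derivative_iff_has_vector_derivative Im_complex_of_real)
  then have "Im (I (of_real x)) = Im (I (of_real a))" for x by (rule DERIV_isconst_all[rule_format])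
  then have I_real: "I (of_real x) = of_real (Ir x)" for x
    by (simp add: complex_eq_iff Ir_def) (simp add: I_def)
  have Ira: "Ir a = 0" by (simp add: Ir_def I_def)
  have Irb: "Ir b = 0" using moment_eq_0_iff[OF k(2) dIr] c Ira by (simp add: a_def b_def)
  \<comment> \<open>The integrand is positive to the left of n and negative to the right, and the
    primitive vanishes at both ends, at b by the choice of \<open>c\<close>.\<close>
  have Irpos: "Ir x > 0" if "a < x" "x < b" for x
  proof (cases "x \<le> n")
    case True
    have "Ir a < Ir x"
    proof (rule DERIV_pos_imp_increasing_open[OF that(1)])
      fix y assume y: "a < y" "y < x"
      have "(real n - y) * y ^ (n - 1) * exp (c * y) > 0" using y True ab by simp
      then show "\<exists>d. (Ir has_real_derivative d) (at y) \<and> 0 < d" using dIr by blast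
    next
      show "continuous_on {a..x} Ir" by (intro continuous_at_imp_continuous_on ballI DERIV_isCont[OF dIr])
    qed
    then show ?thesis using Ira by simp
  next
    case False
    have "Ir x > Ir b"
    proof (rule DERIV_neg_imp_decreasing_open[OF that(2)])
      fix y assume y: "x < y" "y < b"
      have "(real n - y) * (y ^ (n - 1) * exp (c * y)) < 0" using y False that ab by (intro mult_neg_pos) auto
      then show "\<exists>d. (Ir has_real_derivative d) (at y) \<and> d < 0" using dIr unfolding mult.assoc by blast
    next
      show "continuous_on {x..b} Ir" by (intro continuous_at_imp_continuous_on ballI DERIV_isCont[OF dIr])
    qed
    then show ?thesis using Irb by simp
  qed
  \<comment> \<open>The twice integrated equation solved for k^2 w b, which equals s w a' because a'
    = s b; \<open>Fc\<close> is the complex and \<open>F\<close> the real version.\<close>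
  define Fc where "Fc = (\<lambda>z. I z * exp (- of_real c * z) / z ^ (n - 1))"
  define F where "F = (\<lambda>x. Ir x * exp (- c * x) / x ^ (n - 1))"
  have Fc_real: "Fc (of_real x) = of_real (F x)" for x
    by (simp add: Fc_def F_def I_real exp_of_real flip: of_real_mult of_real_minus)
  have F0: "F a = 0" "F b = 0" by (simp_all add: F_def Ira Irb)
  have Fpos: "F x > 0" if "a < x" "x < b" for x using Irpos[OF that] that ab by (simp add: F_def)
  have dF: "(F has_real_derivative (real n - x) - ((real n - 1) / x + c) * F x) (at x)" if "x > 0" for x
  proof -
    have "n - 1 = Suc (n - 2)" using k by simp
    then have p: "x ^ (n - 1) = x * x ^ (n - 2)" "x ^ (n - 1 - 1) = x ^ (n - 2)" by simp_all
    have "(F has_real_derivative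
        (((real n - x) * x ^ (n - 1) * exp (c * x) * exp (- c * x) + Ir x * (exp (- c * x) * - c)) * x ^ (n - 1)
          - Ir x * exp (- c * x) * (real (n - 1) * x ^ (n - 1 - 1))) / (x ^ (n - 1) * x ^ (n - 1))) (at x)"
      unfolding F_def using that by (auto intro!: derivative_eq_intros dIr simp: algebra_simps)
    moreover have "exp (c * x) * exp (- c * x) = 1" by (simp flip: exp_add)
    then have "(((real n - x) * x ^ (n - 1) * exp (c * x) * exp (- c * x) + Ir x * (exp (- c * x) * - c)) * x ^ (n - 1)
          - Ir x * exp (- c * x) * (real (n - 1) * x ^ (n - 1 - 1))) / (x ^ (n - 1) * x ^ (n - 1)) =
        (real n - x) - ((real n - 1) / x + c) * F x"
    proof -
      define y where "y = x ^ (n - 2)"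
      define E where "E = exp (- c * x)"
      have y: "y > 0" using that by (simp add: y_def)
      have 1: "real (n - 1) = real n - 1" using k by simp
      have 2: "(real n - x) * x ^ (n - 1) * exp (c * x) * exp (- c * x) = (real n - x) * x ^ (n - 1)"
        using \<open>exp (c * x) * exp (- c * x) = 1\<close> by (simp only: mult.assoc mult_1_right)
      show ?thesis unfolding F_def 2 unfolding p y_def[symmetric] E_def[symmetric] 1
        using that y by (simp add: field_simps)
    qed
    ultimately show ?thesis by simp
  qed
  define \<sigma> where "\<sigma> = (\<lambda>e. if e then 1 else - 1 :: real)"
  define p where "p = (\<lambda>e. real n - of_int (sg k e))"
  define L where "L = 2 * real k"
  have \<sigma>: "\<sigma> e * \<sigma> e = 1" "of_int (sg k e) = \<sigma> e * real k" for e by (simp_all add: \<sigma>_def sg_def)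
  have p_pm: "p True = a" "p False = b" by (simp_all add: p_def sg_def a_def b_def)
  have rng: "a < p e + \<sigma> e * t \<and> p e + \<sigma> e * t < b" if "t \<in> {0<..<L}" for e t
    using that by (cases e) (auto simp: p_pm \<sigma>_def a_def b_def L_def)
  have "\<exists>\<delta> W. \<delta> > 0 \<and> smooth_on {-\<delta><..<L} W \<and> (\<forall>t\<in>{-\<delta><..<L}. deriv W t > 0) \<and> W 0 = 0 \<and>
     (\<forall>t\<in>{0<..<L}. deriv W t * F (p e + \<sigma> e * t) = real k * W t)" for e
  proof -
    define D where "D = {z. Re (of_real (p e) + of_real (\<sigma> e) * z) > 0}"
    define f where "f = (\<lambda>z. Fc (of_real (p e) + of_real (\<sigma> e) * z))"
    have "open D" unfolding D_def by (intro open_Collect_less continuous_intros)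
    moreover have "f holomorphic_on D"
    proof -
      have "I holomorphic_on {z. Re z > 0}"
        unfolding holomorphic_on_def field_differentiable_def using has_field_derivative_at_within[OF dI] by blast
      then have hF: "Fc holomorphic_on {z. Re z > 0}"
        unfolding Fc_def by (intro holomorphic_intros) auto
      have "(\<lambda>z. of_real (p e) + of_real (\<sigma> e) * z) holomorphic_on D" by (intro holomorphic_intros)
      moreover have "(\<lambda>z. of_real (p e) + of_real (\<sigma> e) * z) ` D \<subseteq> {z. Re z > 0}" by (auto simp: D_def)
      ultimately have "(Fc \<circ> (\<lambda>z. of_real (p e) + of_real (\<sigma> e) * z)) holomorphic_on D"
        by (rule holomorphic_on_compose_gen[OF _ hF])
      then show ?thesis by (simp add: f_def o_def)
    qed
    moreover have Fp: "F (p e) = 0" using F0 p_pm by (cases e) auto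
    then have f0: "f 0 = 0" by (simp add: f_def Fc_real)
    \<comment> \<open>The primitive vanishes at an endpoint, so only its derivative contributes and
      F' = n - p = s there; the direction \<sigma> turns this into k at both ends.\<close>
    moreover have "(f has_field_derivative of_real (real k)) (at 0)"
    proof -
      have pp: "p e > 0" using ab p_pm by (cases e) auto
      have Ip: "I (of_real (p e)) = 0" using Ira Irb p_pm by (cases e) (auto simp: I_real)
      have "(Fc has_field_derivative of_int (sg k e)) (at (of_real (p e)))"
      proof -
        have "(Fc has_field_derivative (of_nat n - of_real (p e)) * (of_real (p e)) ^ (n - 1) * exp (of_real c * of_real (p e)) *
           (exp (- of_real c * of_real (p e)) / of_real (p e) ^ (n - 1))) (at (of_real (p e)))"
        proof -
          have "\<exists>d. ((\<lambda>z. exp (- of_real c * z) / z ^ (n - 1)) has_field_derivative d) (at (complex_of_real (p e)))"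
            using pp by (intro exI) (auto intro!: derivative_eq_intros)
          then obtain d where d: "((\<lambda>z. exp (- of_real c * z) / z ^ (n - 1)) has_field_derivative d) (at (complex_of_real (p e)))"
            by blast
          from DERIV_mult[OF dI d] show ?thesis by (simp add: Fc_def Ip)
        qed
        moreover have "exp (of_real c * of_real (p e)) * exp (- of_real c * of_real (p e)) = (1 :: complex)"
          by (simp flip: exp_add)
        moreover have "A * q * X * (Y / q) = A" if "X * Y = 1" "q \<noteq> 0" for A q X Y :: complex
        proof -
          have "A * q * X * (Y / q) = A * (X * Y)" using that(2) by (simp add: field_simps)
          then show ?thesis by (simp add: that(1))
        qed
        moreover have "complex_of_real (p e) ^ (n - 1) \<noteq> 0" using pp by simp
        moreover have "of_nat n - complex_of_real (p e) = of_int (sg k e)" by (simp add: p_def)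
        ultimately show ?thesis by (metis (no_types))
      qed
      then have 1: "(Fc has_field_derivative of_int (sg k e)) (at (of_real (p e) + of_real (\<sigma> e) * 0))" by simp
      have 2: "((\<lambda>z. of_real (p e) + of_real (\<sigma> e) * z) has_field_derivative of_real (\<sigma> e)) (at (0::complex))"
        by (auto intro!: derivative_eq_intros)
      have "(f has_field_derivative of_int (sg k e) * of_real (\<sigma> e)) (at 0)"
        unfolding f_def by (rule DERIV_chain2[where g = "\<lambda>z. of_real (p e) + of_real (\<sigma> e) * z", OF 1 2])
      moreover have "complex_of_int (sg k e) * of_real (\<sigma> e) = of_real (real k)"
        by (simp add: \<sigma>_def sg_def)
      ultimately show ?thesis by simp
    qed
    moreover have "of_real ` {0..<L} \<subseteq> D"
    proof -
      have "p e + \<sigma> e * t > 0" if "t \<in> {0..<L}" for t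
        using rng[of t e] that ab p_pm by (cases "t = 0"; cases e) auto
      then show ?thesis by (auto simp: D_def)
    qed
    moreover have "f (of_real t) = of_real (F (p e + \<sigma> e * t))" for t
      using Fc_real[of "p e + \<sigma> e * t"] by (simp add: f_def)
    moreover have "F (p e + \<sigma> e * t) > 0" if "t \<in> {0<..<L}" for t using rng[OF that, of e] Fpos by blast
    moreover have "real k > 0" "L > 0" using k by (simp_all add: L_def)
    ultimately show ?thesis
      using endpoint_coordinate[of f D "real k" L "\<lambda>t. F (p e + \<sigma> e * t)"] by metis
  qed
  then obtain \<delta> W where \<delta>: "\<And>e. \<delta> e > 0" and W: "\<And>e. smooth_on {-\<delta> e<..<L} (W e)"
      "\<And>e t. t \<in> {-\<delta> e<..<L} \<Longrightarrow> deriv (W e) t > 0" "\<And>e. W e 0 = 0"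
      "\<And>e t. t \<in> {0<..<L} \<Longrightarrow> deriv (W e) t * F (p e + \<sigma> e * t) = real k * W e t"
    by metis
  have L: "L > 0" using k by (simp add: L_def)
  have dW: "(W e has_real_derivative deriv (W e) t) (at t)" if "t \<in> {-\<delta> e<..<L}" for e t
    using smooth_on_real_deriv(2)[OF W(1)] that by auto
  have Wpos: "W e t > 0" if "t \<in> {0<..<L}" for e t
  proof -
    have "deriv (W e) t * F (p e + \<sigma> e * t) > 0"
      using W(2)[of t e] that \<delta>[of e] rng[OF that, of e] Fpos by auto
    then show ?thesis using W(4)[OF that, of e] k by (simp add: zero_less_mult_iff)
  qed
  text \<open>The two coordinates are inverse to each other up to a constant factor.\<close>
  obtain m where m: "\<And>t. t \<in> {0<..<L} \<Longrightarrow> W True t * W False (L - t) = m"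
  proof -
    have "\<exists>m. \<forall>t\<in>{0<..<L}. W True t * W False (L - t) = m"
    proof (rule has_field_derivative_zero_constant[OF convex_real_interval(8)])
      fix t assume t: "t \<in> {0<..<L}"
      then have t': "L - t \<in> {0<..<L}" by auto
      have d1: "(W True has_real_derivative deriv (W True) t) (at t)" using dW t \<delta>[of True] by auto
      have l: "((\<lambda>t. L - t) has_real_derivative - 1) (at t)" by (auto intro!: derivative_eq_intros)
      have "(W False has_real_derivative deriv (W False) (L - t)) (at (L - t))"
        using dW t' \<delta>[of False] by auto
      from DERIV_chain2[where g = "\<lambda>t. L - t", OF this l]
      have d2: "((\<lambda>t. W False (L - t)) has_real_derivative - deriv (W False) (L - t)) (at t)" by simp
      define x where "x = a + t"
      have "p True + \<sigma> True * t = x" "p False + \<sigma> False * (L - t) = x"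
        by (simp_all add: p_pm \<sigma>_def x_def L_def a_def b_def)
      then have e: "deriv (W True) t * F x = real k * W True t" "deriv (W False) (L - t) * F x = real k * W False (L - t)"
        using W(4)[OF t, of True] W(4)[OF t', of False] by simp_all
      have "F x > 0" using rng[OF t, of True] Fpos by (simp add: p_pm \<sigma>_def x_def)
      then have "deriv (W True) t = real k * W True t / F x" "deriv (W False) (L - t) = real k * W False (L - t) / F x"
        using e by (simp_all add: field_simps)
      then have "deriv (W True) t * W False (L - t) + (- deriv (W False) (L - t)) * W True t = 0" by simp
      with DERIV_mult[OF d1 d2]
      have "((\<lambda>t. W True t * W False (L - t)) has_real_derivative 0) (at t)" by (simp add: mult.commute)
      then show "((\<lambda>t. W True t * W False (L - t)) has_real_derivative 0) (at t within {0<..<L})"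
        by (rule has_field_derivative_at_within)
    qed
    then show ?thesis using that by blast
  qed
  have mpos: "m > 0"
  proof -
    have h: "L / 2 \<in> {0<..<L}" "L - L / 2 \<in> {0<..<L}" using L by auto
    then show ?thesis using m[OF h(1)] mult_pos_pos[OF Wpos[OF h(1), of True] Wpos[OF h(2), of False]] by simp
  qed
  have m': "W e t * W (\<not> e) (L - t) = m" if "t \<in> {0<..<L}" for e t
    using m[OF that] m[of "L - t"] that by (cases e) (auto simp: mult.commute)
  \<comment> \<open>Near 0 the other coordinate is small, so its partner
    \<open>m / W (\<not> e) t\<close> = \<open>W e (L - t)\<close> is large; \<eta> is chosen to
    make the bound |y| + 1.\<close>
  have unb: "\<exists>t\<in>{0<..<L}. W e t > y" for e y
  proof -
    define \<eta> where "\<eta> = m / (\<bar>y\<bar> + 1)"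
    have \<eta>: "\<eta> > 0" using mpos by (simp add: \<eta>_def)
    have "isCont (W (\<not> e)) 0" using DERIV_isCont[OF dW[of 0]] \<delta>[of "\<not> e"] L by auto
    then have "\<exists>d>0. \<forall>t. \<bar>t - 0\<bar> < d \<longrightarrow> \<bar>W (\<not> e) t - W (\<not> e) 0\<bar> < \<eta>"
      using \<eta> unfolding continuous_at_eps_delta dist_real_def by blast
    then obtain d where d: "d > 0" "\<And>t. \<bar>t\<bar> < d \<Longrightarrow> \<bar>W (\<not> e) t\<bar> < \<eta>" using W(3) by auto
    define t where "t = min (d / 2) (L / 2)"
    have t: "t \<in> {0<..<L}" "\<bar>t\<bar> < d" using d L by (auto simp: t_def)
    then have t': "L - t \<in> {0<..<L}" by auto
    have "W e (L - t) = m / W (\<not> e) t"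
      using m'[OF t', of e] Wpos[OF t(1), of "\<not> e"] by (simp add: field_simps)
    also have "\<dots> > m / \<eta>" using d(2)[OF t(2)] Wpos[OF t(1), of "\<not> e"] mpos by (intro divide_strict_left_mono) auto
    also have "m / \<eta> = \<bar>y\<bar> + 1" using mpos by (simp add: \<eta>_def)
    finally show ?thesis using t' by (intro bexI[of _ "L - t"]) auto
  qed
  have "\<exists>\<epsilon> T. \<epsilon> > 0 \<and> smooth_on {-\<epsilon><..} T \<and>
    (\<forall>w>-\<epsilon>. T w \<in> {-\<delta> e<..<L} \<and> W e (T w) = w \<and> (T has_real_derivative 1 / deriv (W e) (T w)) (at w)) \<and>
    (\<forall>w\<ge>0. T w \<in> {0..<L}) \<and> (\<forall>w>0. T w \<in> {0<..<L}) \<and> (\<forall>t\<in>{0..<L}. T (W e t) = t)" for e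
    using inverse_coordinate[OF \<delta>[of e] L W(1)[of e] W(2)[of _ e] W(3)[of e] unb[of _ e]] by metis
  then obtain \<epsilon> T where \<epsilon>: "\<And>e. \<epsilon> e > 0" and T: "\<And>e. smooth_on {-\<epsilon> e<..} (T e)"
     "\<And>e w. w > -\<epsilon> e \<Longrightarrow> T e w \<in> {-\<delta> e<..<L} \<and> W e (T e w) = w \<and> (T e has_real_derivative 1 / deriv (W e) (T e w)) (at w)"
     "\<And>e w. w \<ge> 0 \<Longrightarrow> T e w \<in> {0..<L}" "\<And>e w. w > 0 \<Longrightarrow> T e w \<in> {0<..<L}"
     "\<And>e t. t \<in> {0..<L} \<Longrightarrow> T e (W e t) = t"
    by metis
  \<comment> \<open>Rescaling only the infinity chart by m turns the two coordinates into exact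
    inverses, so that the profiles glue by inversion of w.\<close>
  define C where "C = (\<lambda>e. if e then 1 else m)"
  have C: "C e > 0" "C e * C (\<not> e) = m" for e using mpos by (simp_all add: C_def)
  define \<Phi> where "\<Phi> = (\<lambda>e w. p e + \<sigma> e * T e (C e * w))"
  define \<epsilon>' where "\<epsilon>' = min (\<epsilon> True) (\<epsilon> False / m)"
  have "C e * w > - \<epsilon> e" if "w > -\<epsilon>'" for e w
  proof (cases e)
    case False
    have "- (\<epsilon> False / m) < w" using that by (simp add: \<epsilon>'_def)
    then have "m * - (\<epsilon> False / m) < m * w" using mpos by (rule mult_strict_left_mono)
    then show ?thesis using False mpos by (simp add: C_def)
  qed (use that in \<open>simp add: \<epsilon>'_def C_def\<close>)
  moreover have "\<epsilon>' > 0" using \<epsilon> mpos by (simp add: \<epsilon>'_def)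
  ultimately have \<epsilon>': "\<epsilon>' > 0" "w > -\<epsilon>' \<Longrightarrow> C e * w > - \<epsilon> e" for e w by blast+
  have dPhi: "(\<Phi> e has_real_derivative \<sigma> e * C e / deriv (W e) (T e (C e * w))) (at w)" if "w > -\<epsilon>'" for e w
  proof -
    have "(T e has_real_derivative 1 / deriv (W e) (T e (C e * w))) (at (C e * w))"
      using T(2)[OF \<epsilon>'(2)[OF that]] by blast
    moreover have "((\<lambda>w. C e * w) has_real_derivative C e) (at w)" by (auto intro!: derivative_eq_intros)
    ultimately have "((\<lambda>w. T e (C e * w)) has_real_derivative 1 / deriv (W e) (T e (C e * w)) * C e) (at w)"
      by (rule DERIV_chain2[where g = "\<lambda>w. C e * w"])
    then show ?thesis unfolding \<Phi>_def by (auto intro!: derivative_eq_intros)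
  qed
  have smooth: "smooth_on {-\<epsilon>'<..} (\<Phi> e)" for e
    unfolding \<Phi>_def
    by (intro smooth_on_add smooth_on_const smooth_on_mult open_greaterThan
        smooth_on_compose_linear[OF bounded_linear_mult_right _ T(1)]) (auto intro: \<epsilon>'(2))
  have deriv_Phi: "deriv (\<Phi> e) w = \<sigma> e * C e / deriv (W e) (T e (C e * w))" if "w > -\<epsilon>'" for e w
    by (rule DERIV_imp_deriv[OF dPhi[OF that]])
  have flow: "of_int (sg k e) * w * deriv (\<Phi> e) w = F (\<Phi> e w)" if "w > 0" for e w
  proof -
    have w: "w > -\<epsilon>'" and Cw: "C e * w > 0" using that \<epsilon>'(1) C(1)[of e] by auto
    define t where "t = T e (C e * w)"
    have t: "t \<in> {0<..<L}" "W e t = C e * w" using T(2)[OF \<epsilon>'(2)[OF w]] T(4)[OF Cw] by (auto simp: t_def)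
    have d: "deriv (W e) t > 0" using W(2)[of t e] t \<delta>[of e] by auto
    have "\<Phi> e w = p e + \<sigma> e * t" by (simp add: \<Phi>_def t_def)
    then have "deriv (W e) t * F (\<Phi> e w) = real k * (C e * w)" using W(4)[OF t(1), of e] t(2) by simp
    then have "F (\<Phi> e w) = \<sigma> e * \<sigma> e * (real k * (C e * w)) / deriv (W e) t"
      using d \<sigma>(1)[of e] by (simp add: field_simps)
    then show ?thesis unfolding deriv_Phi[OF w] t_def[symmetric] \<sigma>(2) by (simp add: mult_ac)
  qed
  have Phi_pos: "\<Phi> e w > 0" if "w \<ge> 0" for e w
  proof -
    have "T e (C e * w) \<in> {0..<L}" using T(3) that C(1)[of e] by simp
    then show ?thesis unfolding \<Phi>_def using rng[of "T e (C e * w)" e] ab p_pm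
      by (cases "T e (C e * w) = 0"; cases e) auto
  qed
  have dpos: "deriv (\<Phi> e) w / of_int (sg k e) > 0" if "w \<ge> 0" for e w
  proof -
    have w: "w > -\<epsilon>'" using that \<epsilon>'(1) by simp
    have "deriv (W e) (T e (C e * w)) > 0" using W(2) T(2)[OF \<epsilon>'(2)[OF w]] by blast
    then show ?thesis unfolding deriv_Phi[OF w] \<sigma>(2) using C(1)[of e] k by (auto simp: \<sigma>_def)
  qed
  have "soliton_profile k n \<Phi> c \<epsilon>'"
  proof
    show "\<Phi> (\<not> e) (1 / w) = \<Phi> e w" if "w > 0" for e w
    proof -
      have Cw: "C e * w > 0" and w: "w > -\<epsilon>'" using that C(1)[of e] \<epsilon>'(1) by auto
      define t where "t = T e (C e * w)"
      have t: "t \<in> {0<..<L}" "W e t = C e * w" using T(2)[OF \<epsilon>'(2)[OF w]] T(4)[OF Cw] by (auto simp: t_def)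
      then have t': "L - t \<in> {0..<L}" by auto
      have "W (\<not> e) (L - t) = C (\<not> e) * (1 / w)"
      proof -
        have "C e * (w * W (\<not> e) (L - t)) = C e * C (\<not> e)"
          using m'[OF t(1), of e] t(2) C(2)[of e] by (simp add: mult_ac)
        then have "w * W (\<not> e) (L - t) = C (\<not> e)" using C(1)[of e] by simp
        then show ?thesis using that by (simp add: field_simps)
      qed
      then have "T (\<not> e) (C (\<not> e) * (1 / w)) = L - t" using T(5)[OF t', of "\<not> e"] by simp
      then show ?thesis unfolding \<Phi>_def t_def[symmetric]
        by (cases e) (simp_all add: p_pm \<sigma>_def L_def a_def b_def)
    qed
    show "of_int (sg k e) * w *
      (- (real n - 1) * (deriv (\<Phi> e) w / \<Phi> e w) - deriv (deriv (\<Phi> e)) w / deriv (\<Phi> e) w - c * deriv (\<Phi> e) w)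
      = \<Phi> e w - (real n - of_int (sg k e))" if "w \<ge> 0" for e w
    proof (cases "w = 0")
      case True
      have "W e 0 = 0" "0 \<in> {0..<L}" using W(3) L by auto
      then have "T e 0 = 0" using T(5)[of 0 e] by simp
      then show ?thesis using True by (simp add: \<Phi>_def p_def)
    next
      case False
      then have w: "w > 0" using that by simp
      define s :: real where "s = of_int (sg k e)"
      have w': "w \<in> {-\<epsilon>'<..}" using w \<epsilon>'(1) by simp
      have D1: "(\<Phi> e has_real_derivative deriv (\<Phi> e) w) (at w)"
        by (rule smooth_on_real_deriv(2)[OF smooth open_greaterThan w'])
      have D2: "(deriv (\<Phi> e) has_real_derivative deriv (deriv (\<Phi> e)) w) (at w)"
        by (rule smooth_on_real_deriv(2)[OF smooth_on_real_deriv(1)[OF smooth open_greaterThan] open_greaterThan w'])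
      \<comment> \<open>\<open>dF\<close> expresses F' through F. Differentiating the flow equation
        and eliminating F by it again leaves the second-order equation of
        \<open>ode\<close>.\<close>
      have "((\<lambda>w. F (\<Phi> e w)) has_real_derivative
          ((real n - \<Phi> e w) - ((real n - 1) / \<Phi> e w + c) * F (\<Phi> e w)) * deriv (\<Phi> e) w) (at w)"
        by (rule DERIV_chain2[OF dF[OF Phi_pos[OF that]] D1])
      moreover have "((\<lambda>w. F (\<Phi> e w)) has_real_derivative s * deriv (\<Phi> e) w + s * w * deriv (deriv (\<Phi> e)) w) (at w)"
      proof (rule has_field_derivative_transform_within_open[OF _ open_greaterThan[of 0]])
        show "((\<lambda>w. s * w * deriv (\<Phi> e) w) has_real_derivative s * deriv (\<Phi> e) w + s * w * deriv (deriv (\<Phi> e)) w) (at w)"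
          by (auto intro!: derivative_eq_intros D2 simp: algebra_simps)
      qed (use w flow in \<open>auto simp: s_def\<close>)
      ultimately have "((real n - \<Phi> e w) - ((real n - 1) / \<Phi> e w + c) * (s * w * deriv (\<Phi> e) w)) * deriv (\<Phi> e) w =
          s * deriv (\<Phi> e) w + s * w * deriv (deriv (\<Phi> e)) w"
        using DERIV_unique flow[OF w, of e] s_def by metis
      moreover have "deriv (\<Phi> e) w \<noteq> 0" "\<Phi> e w \<noteq> 0" using dpos[OF that, of e] Phi_pos[OF that, of e] by auto
      ultimately show ?thesis unfolding s_def[symmetric] by (simp add: field_simps)
    qed
  qed (use k \<epsilon>' smooth Phi_pos dpos in auto)
  then show ?thesis by (rule that)
qed

section \<open>Restriction to complex lines\<close>

text \<open>The Wirtinger calculus repeated on the type of complex numbers itself, where primitives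
  and Liouville's theorem are available; \<open>line_wirt\<close> connects it with coordinate
  space.\<close>

definition w1 :: "(complex \<Rightarrow> complex) \<Rightarrow> complex \<Rightarrow> complex" where
  "w1 F x = (frechet_derivative F (at x) 1 - \<i> * frechet_derivative F (at x) \<i>) / 2"

definition w1b :: "(complex \<Rightarrow> complex) \<Rightarrow> complex \<Rightarrow> complex" where
  "w1b F x = (frechet_derivative F (at x) 1 + \<i> * frechet_derivative F (at x) \<i>) / 2"

definition has_w1 :: "(complex \<Rightarrow> complex) \<Rightarrow> complex \<Rightarrow> complex \<Rightarrow> complex \<Rightarrow> bool" where
  "has_w1 F p q x \<longleftrightarrow> (F has_derivative (\<lambda>v. p * v + q * cnj v)) (at x)"

lemma has_w1_eqs: "has_w1 F p q x \<Longrightarrow> w1 F x = p" "has_w1 F p q x \<Longrightarrow> w1b F x = q"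
  by (simp_all add: has_w1_def w1_def w1b_def frechet_derivative_eqI algebra_simps)

lemma has_w1I:
  assumes "F differentiable (at x)" shows "has_w1 F (w1 F x) (w1b F x) x"
proof -
  have d: "(F has_derivative frechet_derivative F (at x)) (at x)" using assms frechet_derivative_works by blast
  then have lin: "linear (frechet_derivative F (at x))" by (rule has_derivative_linear)
  have "frechet_derivative F (at x) v = w1 F x * v + w1b F x * cnj v" for v
  proof -
    have v: "v = Re v *\<^sub>R 1 + Im v *\<^sub>R \<i>" by (simp add: complex_eq_iff)
    have *: "Re v *\<^sub>R a + Im v *\<^sub>R b = (a - \<i> * b) / 2 * v + (a + \<i> * b) / 2 * cnj v" for a b :: complex
      by (simp add: complex_eq_iff field_simps)
    show ?thesis unfolding w1_def w1b_def *[symmetric]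
      by (subst v) (simp only: linear_add[OF lin] linear_scale[OF lin])
  qed
  then have "frechet_derivative F (at x) = (\<lambda>v. w1 F x * v + w1b F x * cnj v)" by blast
  with d show ?thesis by (simp add: has_w1_def)
qed

lemma has_w1_const: "has_w1 (\<lambda>_. c) 0 0 x"
  by (simp add: has_w1_def)

lemma has_w1_id: "has_w1 (\<lambda>x. x) 1 0 x"
  by (simp add: has_w1_def)

lemma has_w1_cnj: "has_w1 F p q x \<Longrightarrow> has_w1 (\<lambda>x. cnj (F x)) (cnj q) (cnj p) x"
  unfolding has_w1_def
  by (drule bounded_linear.has_derivative[OF bounded_linear_cnj]) (simp add: add.commute)

lemma has_w1_add: "has_w1 F p q x \<Longrightarrow> has_w1 G p' q' x \<Longrightarrow> has_w1 (\<lambda>x. F x + G x) (p + p') (q + q') x"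
  unfolding has_w1_def by (drule (1) has_derivative_add) (simp add: algebra_simps)

lemma has_w1_mult: "has_w1 F p q x \<Longrightarrow> has_w1 G p' q' x \<Longrightarrow>
    has_w1 (\<lambda>x. F x * G x) (F x * p' + p * G x) (F x * q' + q * G x) x"
  unfolding has_w1_def by (drule (1) has_derivative_mult) (simp add: algebra_simps)

lemma has_w1_inverse:
  assumes "has_w1 F p q x" "F x \<noteq> 0"
  shows "has_w1 (\<lambda>x. inverse (F x)) (- p / (F x)\<^sup>2) (- q / (F x)\<^sup>2) x"
proof -
  have *: "-(inverse a * (s + t) * inverse a) = - s / a\<^sup>2 + - t / a\<^sup>2" for a s t :: complex
    by (simp add: divide_inverse algebra_simps power2_eq_square)
  show ?thesis
    using Deriv.has_derivative_inverse[OF assms(2) assms(1)[unfolded has_w1_def]]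
    unfolding has_w1_def * by simp
qed

lemma has_w1_of_real:
  assumes u: "has_w1 (\<lambda>x. complex_of_real (u x)) p q x"
    and h: "(h has_real_derivative h') (at (u x))"
  shows "has_w1 (\<lambda>x. complex_of_real (h (u x))) (of_real h' * p) (of_real h' * q) x"
proof -
  let ?D = "\<lambda>v. p * v + q * cnj v"
  have 1: "(u has_derivative (\<lambda>v. Re (?D v))) (at x)"
    using bounded_linear.has_derivative[OF bounded_linear_Re u[unfolded has_w1_def]] by simp
  have "((\<lambda>x. complex_of_real (u x)) has_derivative (\<lambda>v. of_real (Re (?D v)))) (at x)"
    by (rule bounded_linear.has_derivative[OF bounded_linear_of_real 1])
  then have re: "complex_of_real (Re (?D v)) = ?D v" for v
    using fun_cong[OF has_derivative_unique[OF _ u[unfolded has_w1_def]], of _ v] by simp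
  have "((\<lambda>x. h (u x)) has_derivative (\<lambda>v. h' * Re (?D v))) (at x)"
    using has_derivative_compose[OF 1 h[unfolded has_field_derivative_def]] by simp
  from bounded_linear.has_derivative[OF bounded_linear_of_real[where 'a = complex] this]
  have "((\<lambda>x. complex_of_real (h (u x))) has_derivative (\<lambda>v. of_real h' * ?D v)) (at x)"
    unfolding of_real_mult re .
  then show ?thesis by (simp add: has_w1_def distrib_left mult.assoc)
qed

lemma has_w1_cong: "has_w1 F p q x \<Longrightarrow> p = p' \<Longrightarrow> q = q' \<Longrightarrow> has_w1 F p' q' x"
  by simp

lemma has_w1_transform:
  assumes "has_w1 F p q x" "open S" "x \<in> S" "\<And>y. y \<in> S \<Longrightarrow> F y = G y"
  shows "has_w1 G p q x"
  using has_derivative_transform_within_open[OF assms(1)[unfolded has_w1_def] assms(2,3)] assms(4)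
  by (simp add: has_w1_def)

section \<open>Wirtinger derivatives along coordinate lines\<close>

lemma has_w1_line:
  fixes F :: "complex^'n::finite \<Rightarrow> complex"
  assumes "F differentiable (at (axis j x))"
  shows "has_w1 (\<lambda>x. F (axis j x)) (wirt j F (axis j x)) (wirt_bar j F (axis j x)) x"
proof -
  have "((\<lambda>x. F (axis j x)) has_derivative
     (\<lambda>v. (\<Sum>i\<in>UNIV. wirt i F (axis j x) * axis j v $ i) + (\<Sum>i\<in>UNIV. wirt_bar i F (axis j x) * cnj (axis j v $ i)))) (at x)"
    by (rule has_derivative_compose[OF bounded_linear_imp_has_derivative[OF bounded_linear_axis]
          has_wirtI[OF assms, unfolded has_wirt_def]])
  then show ?thesis
    by (simp add: has_w1_def axis_def if_distrib[of "\<lambda>f. _ * f"] if_distrib[of cnj] cong: if_cong)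
qed

lemma has_w1_rot:
  assumes "has_w1 F p q (t * x)"
  shows "has_w1 (\<lambda>x. F (t * x)) (p * t) (q * cnj t) x"
proof -
  have "((\<lambda>x. F (t * x)) has_derivative (\<lambda>v. p * (t * v) + q * cnj (t * v))) (at x)"
    by (rule has_derivative_compose[where f = "\<lambda>x. t * x" and f' = "\<lambda>v. t * v", OF _ assms[unfolded has_w1_def]])
       (auto intro!: derivative_eq_intros)
  then show ?thesis by (simp add: has_w1_def mult.assoc)
qed

lemma smooth_on_w1:
  assumes "smooth_on UNIV F" shows "smooth_on UNIV (w1 F)" "smooth_on UNIV (w1b F)"
proof -
  have "smooth_on UNIV (\<lambda>x. frechet_derivative F (at x) 1 * (1 / 2) + frechet_derivative F (at x) \<i> * (- \<i> / 2))"
    "smooth_on UNIV (\<lambda>x. frechet_derivative F (at x) 1 * (1 / 2) + frechet_derivative F (at x) \<i> * (\<i> / 2))"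
    by (rule smooth_on_add[OF open_UNIV smooth_on_mult[OF open_UNIV smooth_on_frechet[OF assms] smooth_on_const]
          smooth_on_mult[OF open_UNIV smooth_on_frechet[OF assms] smooth_on_const]])+
  then show "smooth_on UNIV (w1 F)" "smooth_on UNIV (w1b F)"
    by (simp_all add: w1_def[abs_def] w1b_def[abs_def] diff_divide_distrib add_divide_distrib mult.commute)
qed

lemma smooth_on_wirt_bar:
  assumes "smooth_on UNIV F" shows "smooth_on UNIV (wirt_bar j F)" "smooth_on UNIV (wirt j F)"
proof -
  have "smooth_on UNIV (\<lambda>x. frechet_derivative F (at x) (axis j 1) * (1 / 2) + frechet_derivative F (at x) (axis j \<i>) * (\<i> / 2))"
    "smooth_on UNIV (\<lambda>x. frechet_derivative F (at x) (axis j 1) * (1 / 2) + frechet_derivative F (at x) (axis j \<i>) * (- \<i> / 2))"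
    by (rule smooth_on_add[OF open_UNIV smooth_on_mult[OF open_UNIV smooth_on_frechet[OF assms] smooth_on_const]
          smooth_on_mult[OF open_UNIV smooth_on_frechet[OF assms] smooth_on_const]])+
  then show "smooth_on UNIV (wirt_bar j F)" "smooth_on UNIV (wirt j F)"
    by (simp_all add: wirt_bar_def[abs_def] wirt_def[abs_def] diff_divide_distrib add_divide_distrib mult.commute)
qed

lemma line_wirt:
  fixes F :: "complex^'n::finite \<Rightarrow> complex"
  assumes "smooth_on UNIV F"
  shows "w1 (\<lambda>x. F (axis j x)) = (\<lambda>x. wirt j F (axis j x))"
    "w1b (\<lambda>x. F (axis j x)) = (\<lambda>x. wirt_bar j F (axis j x))"
  using has_w1_line[OF smooth_on_differentiable[OF assms UNIV_I], THEN has_w1_eqs(1)]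
    has_w1_line[OF smooth_on_differentiable[OF assms UNIV_I], THEN has_w1_eqs(2)] by blast+

lemma line_hess:
  fixes F :: "complex^'n::finite \<Rightarrow> complex"
  assumes "smooth_on UNIV F"
  shows "w1 (w1b (\<lambda>x. F (axis j x))) x = wirt j (wirt_bar j F) (axis j x)"
    "w1 (w1 (\<lambda>x. F (axis j x))) x = wirt j (wirt j F) (axis j x)"
  unfolding line_wirt[OF assms] line_wirt[OF smooth_on_wirt_bar(1)[OF assms]] line_wirt[OF smooth_on_wirt_bar(2)[OF assms]]
  by simp_all

text \<open>Liouville's theorem for a harmonic function \<open>q\<close>, the real part of an entire function \<open>S\<close>: \<open>exp S\<close> is
  bounded.\<close>

lemma harmonic_bounded_above:
  fixes q :: "complex \<Rightarrow> real"
  assumes sm: "smooth_on UNIV (\<lambda>x. complex_of_real (q x))"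
    and harm: "\<And>x. w1 (w1b (\<lambda>x. complex_of_real (q x))) x = 0"
    and bdd: "\<And>x. q x \<le> M"
  shows "q x = q 0"
proof -
  let ?Q = "\<lambda>x. complex_of_real (q x)"
  \<comment> \<open>The entire function will be a primitive of \<partial>q. Harmonicity makes
    \<partial>q holomorphic; as q is real, its antiholomorphic derivative is the conjugate, so 2 Re
    S and q have the same real derivative.\<close>
  define h where "h = w1 ?Q"
  have dQ: "has_w1 ?Q (w1 ?Q x) (w1b ?Q x) x" for x
    by (rule has_w1I[OF smooth_on_differentiable[OF sm UNIV_I]])
  have cQ: "w1b ?Q x = cnj (h x)" for x
    using has_w1_eqs(2)[OF has_w1_cnj[OF dQ[of x]]] by (simp add: h_def)
  have dh: "has_w1 h (w1 h x) (w1b h x) x" for x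
    unfolding h_def by (rule has_w1I[OF smooth_on_differentiable[OF smooth_on_w1(1)[OF sm] UNIV_I]])
  have "w1b h x = 0" for x
  proof -
    have "w1b ?Q = (\<lambda>x. cnj (h x))" using cQ by blast
    then show ?thesis using harm[of x] has_w1_eqs(1)[OF has_w1_cnj[OF dh[of x]]] by simp
  qed
  then have "(h has_field_derivative w1 h x) (at x)" for x
    using dh[of x] by (simp add: has_w1_def has_field_derivative_def)
  then have "h holomorphic_on UNIV"
    unfolding holomorphic_on_def field_differentiable_def by auto
  from holomorphic_convex_primitive'[OF convex_UNIV open_UNIV this]
  obtain S :: "complex \<Rightarrow> complex" where S: "\<And>x. (S has_field_derivative h x) (at x)" by (metis UNIV_I)
  have const: "2 * Re (S x) - q x = 2 * Re (S 0) - q 0" for x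
  proof -
    have "((\<lambda>x. 2 * Re (S x) - q x) has_derivative (\<lambda>v. 0)) (at x)" for x
    proof -
      have 1: "(S has_derivative (*) (h x)) (at x)" using S by (simp add: has_field_derivative_def)
      have 2: "((\<lambda>x. Re (?Q x)) has_derivative (\<lambda>v. Re (h x * v + cnj (h x) * cnj v))) (at x)"
        using bounded_linear.has_derivative[OF bounded_linear_Re dQ[of x, unfolded has_w1_def]]
        by (simp add: cQ h_def)
      show ?thesis
        by (rule has_derivative_eq_rhs[OF has_derivative_diff[OF has_derivative_mult_right[OF bounded_linear.has_derivative[OF bounded_linear_Re 1]]
              2[simplified]]]) (auto simp: fun_eq_iff algebra_simps)
    qed
    then show ?thesis
      using has_derivative_zero_unique[OF convex_UNIV, of "\<lambda>x. 2 * Re (S x) - q x" 0 x] by auto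
  qed
  have "(\<lambda>x. exp (2 * S x)) holomorphic_on UNIV"
  proof -
    have "S holomorphic_on UNIV" unfolding holomorphic_on_def field_differentiable_def using S by auto
    then show ?thesis by (intro holomorphic_intros)
  qed
  moreover have "bounded (range (\<lambda>x. exp (2 * S x)))"
  proof (rule boundedI)
    fix y assume "y \<in> range (\<lambda>x. exp (2 * S x))"
    then obtain x where y: "y = exp (2 * S x)" by auto
    show "norm y \<le> exp (M + (2 * Re (S 0) - q 0))" using const[of x] bdd[of x] by (simp add: y norm_exp_eq_Re)
  qed
  ultimately have "(\<lambda>x. exp (2 * S x)) constant_on UNIV" by (rule Liouville_theorem)
  then obtain C where C: "\<And>x. exp (2 * S x) = C" by (auto simp: constant_on_def)
  have "exp (2 * Re (S x)) = exp (2 * Re (S 0))"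
    using arg_cong[OF C[of x], of norm] arg_cong[OF C[of 0], of norm] by (simp add: norm_exp_eq_Re)
  then show ?thesis using const[of x] by simp
qed

section \<open>Radial functions of one complex variable\<close>

lemma has_w1_norm:
  assumes "x \<noteq> 0"
  shows "has_w1 (\<lambda>x. complex_of_real (norm x)) (cnj x / (2 * norm x)) (x / (2 * norm x)) x"
proof -
  have 1: "has_w1 (\<lambda>x. complex_of_real ((norm x)\<^sup>2)) (cnj x) x x"
    using has_w1_mult[OF has_w1_id has_w1_cnj[OF has_w1_id], of x]
    by (simp add: complex_norm_square del: of_real_power)
  have "(sqrt has_real_derivative inverse (sqrt ((norm x)\<^sup>2)) / 2) (at ((norm x)\<^sup>2))"
    using assms by (intro DERIV_real_sqrt) simp
  from has_w1_of_real[OF 1 this]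
  have "has_w1 (\<lambda>x. complex_of_real (norm x)) (of_real (inverse (norm x) / 2) * cnj x) (of_real (inverse (norm x) / 2) * x) x"
    unfolding real_sqrt_abs abs_norm_cancel .
  then show ?thesis
    by (rule has_w1_cong) (use assms in \<open>simp_all add: field_simps\<close>)
qed

text \<open>The mixed derivative is a quarter of the Laplacian in polar form. In the pure one x is
  replaced by its conjugate, which has no holomorphic derivative, and this reverses the sign of the
  term with \<psi>' / r.\<close>

lemma w1_radial:
  fixes \<psi> :: "real \<Rightarrow> real"
  assumes F: "\<And>x. x \<noteq> 0 \<Longrightarrow> F x = complex_of_real (\<psi> (norm x))" and sm: "smooth_on UNIV \<psi>" and r: "r > 0"
  shows "w1 F (of_real r) = of_real (deriv \<psi> r / 2)"
    "w1 (w1b F) (of_real r) = of_real ((deriv (deriv \<psi>) r + deriv \<psi> r / r) / 4)"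
    "w1 (w1 F) (of_real r) = of_real ((deriv (deriv \<psi>) r - deriv \<psi> r / r) / 4)"
proof -
  have o: "open (- {0 :: complex})" by auto
  note d1 = smooth_on_real_deriv(2)[OF sm open_UNIV UNIV_I]
  note d2 = smooth_on_real_deriv(2)[OF smooth_on_real_deriv(1)[OF sm open_UNIV] open_UNIV UNIV_I]
  have hF: "has_w1 F (of_real (deriv \<psi> (norm x)) * (cnj x / (2 * norm x))) (of_real (deriv \<psi> (norm x)) * (x / (2 * norm x))) x"
    if "x \<noteq> 0" for x
    by (rule has_w1_transform[OF has_w1_of_real[OF has_w1_norm[OF that] d1] o]) (use that F in auto)
  have r0: "complex_of_real r \<noteq> 0" using r by simp
  show "w1 F (of_real r) = of_real (deriv \<psi> r / 2)"
    using has_w1_eqs(1)[OF hF[OF r0]] r by simp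
  have n2: "has_w1 (\<lambda>x. inverse (2 * complex_of_real (norm x))) (- (1 / (4 * r\<^sup>2))) (- (1 / (4 * r\<^sup>2))) (of_real r)"
    by (rule has_w1_cong[OF has_w1_inverse[OF has_w1_mult[OF has_w1_const has_w1_norm[OF r0]]]])
       (use r in \<open>auto simp: power2_eq_square\<close>)
  have D: "has_w1 (\<lambda>x. complex_of_real (deriv \<psi> (norm x))) (of_real (deriv (deriv \<psi>) r / 2)) (of_real (deriv (deriv \<psi>) r / 2)) (of_real r)"
    by (rule has_w1_cong[OF has_w1_of_real[OF has_w1_norm[OF r0] d2]]) (use r in auto)
  have Fb: "w1b F x = of_real (deriv \<psi> (norm x)) * (x * inverse (2 * of_real (norm x)))"
    "w1 F x = of_real (deriv \<psi> (norm x)) * (cnj x * inverse (2 * of_real (norm x)))" if "x \<noteq> 0" for x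
    by (simp_all only: has_w1_eqs[OF hF[OF that]] divide_inverse of_real_mult of_real_numeral)
  have "has_w1 (w1b F) (of_real ((deriv (deriv \<psi>) r + deriv \<psi> r / r) / 4)) (of_real ((deriv (deriv \<psi>) r - deriv \<psi> r / r) / 4)) (of_real r)"
  proof (rule has_w1_transform[OF _ o])
    show "has_w1 (\<lambda>x. of_real (deriv \<psi> (norm x)) * (x * inverse (2 * of_real (norm x))))
       (of_real ((deriv (deriv \<psi>) r + deriv \<psi> r / r) / 4)) (of_real ((deriv (deriv \<psi>) r - deriv \<psi> r / r) / 4)) (of_real r)"
      by (rule has_w1_cong[OF has_w1_mult[OF D has_w1_mult[OF has_w1_id n2]]])
         (use r in \<open>auto simp: field_simps power2_eq_square\<close>)
  qed (use r Fb in auto)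
  then show "w1 (w1b F) (of_real r) = of_real ((deriv (deriv \<psi>) r + deriv \<psi> r / r) / 4)" by (rule has_w1_eqs(1))
  have "has_w1 (w1 F) (of_real ((deriv (deriv \<psi>) r - deriv \<psi> r / r) / 4)) (of_real ((deriv (deriv \<psi>) r + deriv \<psi> r / r) / 4)) (of_real r)"
  proof (rule has_w1_transform[OF _ o])
    show "has_w1 (\<lambda>x. of_real (deriv \<psi> (norm x)) * (cnj x * inverse (2 * of_real (norm x))))
       (of_real ((deriv (deriv \<psi>) r - deriv \<psi> r / r) / 4)) (of_real ((deriv (deriv \<psi>) r + deriv \<psi> r / r) / 4)) (of_real r)"
      by (rule has_w1_cong[OF has_w1_mult[OF D has_w1_mult[OF has_w1_cnj[OF has_w1_id] n2]]])
         (use r in \<open>auto simp: field_simps power2_eq_square\<close>)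
  qed (use r Fb in auto)
  then show "w1 (w1 F) (of_real r) = of_real ((deriv (deriv \<psi>) r - deriv \<psi> r / r) / 4)" by (rule has_w1_eqs(1))
qed

section \<open>Unitary normal forms\<close>

text \<open>The Householder reflection in the hyperplane orthogonal to \<open>v\<close>; for
  \<open>v = 0\<close>, division by zero makes it the identity.\<close>

definition rank1_reflection :: "complex^'n \<Rightarrow> complex^'n::finite^'n" where
  "rank1_reflection v = (\<chi> i l. (if i = l then 1 else 0) - 2 * v $ i * cnj (v $ l) / herm v v)"

lemma rank1_reflection_apply: "rank1_reflection v *v z = z - (2 * herm z v / herm v v) *s v"
proof -
  have "(\<Sum>l\<in>UNIV. ((if i = l then 1 else 0) - 2 * v $ i * cnj (v $ l) / herm v v) * z $ l) =
      z $ i - 2 * v $ i / herm v v * herm z v" for i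
  proof -
    have "(\<Sum>l\<in>UNIV. ((if i = l then 1 else 0) - 2 * v $ i * cnj (v $ l) / herm v v) * z $ l) =
        (\<Sum>l\<in>UNIV. (if i = l then z $ l else 0) - 2 * v $ i / herm v v * (z $ l * cnj (v $ l)))"
      by (intro sum.cong) (auto simp: algebra_simps)
    also have "\<dots> = z $ i - 2 * v $ i / herm v v * herm z v"
      unfolding herm_def[of z v] by (simp only: sum_subtractf sum_distrib_left[symmetric]) simp
    finally show ?thesis .
  qed
  then show ?thesis by (simp add: vec_eq_iff rank1_reflection_def matrix_vector_mult_def mult_ac)
qed

lemma unitary_matrixI:
  assumes "\<And>v. (\<chi> i j. cnj (U $ j $ i)) *v (U *v v) = v" shows "unitary_matrix (U :: complex^'n::finite^'n)"
proof -
  have "(\<chi> i j. cnj (U $ j $ i)) ** U = mat 1"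
    using assms by (simp add: matrix_eq flip: matrix_vector_mul_assoc)
  then show ?thesis by (simp add: unitary_matrix_def matrix_left_right_inverse)
qed

lemma herm_zero: "herm v v = 0 \<longleftrightarrow> v = 0"
proof
  assume "herm v v = 0"
  then have "(\<Sum>i\<in>UNIV. complex_of_real ((norm (v $ i))\<^sup>2)) = 0" by (simp add: herm_def complex_norm_square del: of_real_power)
  then have "(\<Sum>i\<in>UNIV. (norm (v $ i))\<^sup>2) = 0" by (metis of_real_eq_0_iff of_real_sum)
  then show "v = 0" by (simp add: sum_nonneg_eq_0_iff vec_eq_iff)
qed (simp add: herm_def)

lemma unitary_reflection: "unitary_matrix (rank1_reflection v)"
proof (rule unitary_matrixI)
  fix z
  have "(\<chi> i j. cnj (rank1_reflection v $ j $ i)) = rank1_reflection v"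
    by (auto simp: vec_eq_iff rank1_reflection_def cnj_herm)
  moreover have "rank1_reflection v *v (rank1_reflection v *v z) = z"
  proof (cases "v = 0")
    case False
    then have "herm v v \<noteq> 0" by (simp add: herm_zero)
    then show ?thesis
      by (simp add: rank1_reflection_apply herm_diff herm_scale vec_eq_iff field_simps)
  qed (simp add: rank1_reflection_apply herm_def)
  ultimately show "(\<chi> i j. cnj (rank1_reflection v $ j $ i)) *v (rank1_reflection v *v z) = z" by simp
qed

definition diag_matrix :: "('n \<Rightarrow> complex) \<Rightarrow> complex^'n::finite^'n" where
  "diag_matrix d = (\<chi> i l. if i = l then d i else 0)"

lemma diag_matrix_apply: "(diag_matrix d *v z) $ i = d i * z $ i"
  by (simp add: diag_matrix_def matrix_vector_mult_def if_distrib[of "\<lambda>f. f * _"] cong: if_cong)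

lemma unitary_diag:
  assumes "\<And>i. norm (d i) = 1" shows "unitary_matrix (diag_matrix d)"
proof (rule unitary_matrixI)
  fix v
  have "(\<chi> i j. cnj (diag_matrix d $ j $ i)) = diag_matrix (\<lambda>i. cnj (d i))"
    by (auto simp: vec_eq_iff diag_matrix_def)
  moreover have "cnj (d i) * d i = 1" for i
    using assms[of i] by (metis complex_norm_square mult.commute of_real_1 one_power2)
  ultimately show "(\<chi> i j. cnj (diag_matrix d $ j $ i)) *v (diag_matrix d *v v) = v"
    by (simp add: vec_eq_iff diag_matrix_apply flip: mult.assoc)
qed

definition swap_matrix :: "'n \<Rightarrow> 'n \<Rightarrow> complex^'n::finite^'n" where
  "swap_matrix a b = (\<chi> i l. if l = (if i = a then b else if i = b then a else i) then 1 else 0)"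

lemma swap_matrix_apply: "(swap_matrix a b *v z) $ i = z $ (if i = a then b else if i = b then a else i)"
  by (simp add: swap_matrix_def matrix_vector_mult_def if_distrib[of "\<lambda>f. f * _"] cong: if_cong)

lemma unitary_swap: "unitary_matrix (swap_matrix a b)"
proof (rule unitary_matrixI)
  fix v
  have "(\<chi> i j. cnj (swap_matrix a b $ j $ i)) = swap_matrix a b"
    by (auto simp: vec_eq_iff swap_matrix_def)
  then show "(\<chi> i j. cnj (swap_matrix a b $ j $ i)) *v (swap_matrix a b *v v) = v"
    by (simp add: vec_eq_iff swap_matrix_apply)
qed

lemma unitary_mult:
  assumes "unitary_matrix U" "unitary_matrix (V :: complex^'n::finite^'n)" shows "unitary_matrix (U ** V)"
proof (rule unitary_matrixI)
  fix v
  have adj: "(\<chi> i j. cnj ((U ** V) $ j $ i)) = (\<chi> i j. cnj (V $ j $ i)) ** (\<chi> i j. cnj (U $ j $ i))"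
    by (simp add: vec_eq_iff matrix_matrix_mult_def mult.commute)
  have "((\<chi> i j. cnj (V $ j $ i)) ** (\<chi> i j. cnj (U $ j $ i))) ** (U ** V) = mat 1"
    using assms unfolding unitary_matrix_def by (metis matrix_mul_assoc matrix_mul_lid)
  then show "(\<chi> i j. cnj ((U ** V) $ j $ i)) *v ((U ** V) *v v) = v"
    by (simp add: adj matrix_vector_mul_assoc)
qed

text \<open>The Householder reflection exchanging \<open>z\<close> and a multiple of a coordinate vector, chosen with real
  Hermitian product, followed by a scalar.\<close>

lemma unitary_to_axis:
  fixes z :: "complex^'n::finite"
  assumes "norm \<beta> = 1"
  obtains U where "unitary_matrix U" "U *v z = axis j (\<beta> * of_real (sqrt (Re (herm z z))))"
proof -
  \<comment> \<open>The phase of \<open>z $ j\<close>, which makes the product of \<open>z\<close>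
    and the target \<open>y\<close> real. If \<open>z $ j\<close> = 0 the product is 0 and any unit
    number serves.\<close>
  define \<alpha> where "\<alpha> = (if z $ j = 0 then 1 else sgn (z $ j))"
  have \<alpha>: "norm \<alpha> = 1" by (simp add: \<alpha>_def norm_sgn)
  have \<alpha>z: "cnj \<alpha> * z $ j = of_real (norm (z $ j))"
    by (simp add: \<alpha>_def sgn_div_norm complex_norm_square[symmetric] scaleR_conv_of_real power2_eq_square
        field_simps mult.commute[of _ "cnj (z $ j)"] del: of_real_power)
  define R where "R = sqrt (Re (herm z z))"
  have hz: "herm z z = of_real (R\<^sup>2)"
  proof -
    have "herm z z = of_real (\<Sum>i\<in>UNIV. (norm (z $ i))\<^sup>2)" by (simp add: herm_def complex_norm_square del: of_real_power)
    moreover have "(\<Sum>i\<in>UNIV. (norm (z $ i))\<^sup>2) \<ge> 0" by (simp add: sum_nonneg)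
    ultimately show ?thesis by (simp add: R_def del: of_real_sum of_real_power)
  qed
  define y where "y = axis j (\<alpha> * of_real R)"
  have zy: "herm z y = of_real (R * norm (z $ j))" "herm y z = of_real (R * norm (z $ j))" "herm y y = of_real (R\<^sup>2)"
  proof -
    show 1: "herm z y = of_real (R * norm (z $ j))"
      using \<alpha>z by (simp add: herm_def y_def axis_def if_distrib[of "\<lambda>f. _ * f"] if_distrib[of cnj] mult_ac cong: if_cong)
    then show "herm y z = of_real (R * norm (z $ j))" by (metis cnj_herm complex_cnj_complex_of_real)
    have "\<alpha> * cnj \<alpha> = 1" using \<alpha> by (metis complex_norm_square of_real_1 one_power2)
    then show "herm y y = of_real (R\<^sup>2)"
      by (simp add: herm_def y_def axis_def if_distrib[of "\<lambda>f. _ * f"] if_distrib[of cnj] power2_eq_square cong: if_cong)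
  qed
  define H where "H = rank1_reflection (z - y)"
  have "H *v z = y"
  proof (cases "z = y")
    case True
    then show ?thesis by (simp add: H_def rank1_reflection_apply herm_def)
  next
    case False
    then have "herm (z - y) (z - y) \<noteq> 0" by (simp add: herm_zero)
    moreover have "herm (z - y) (z - y) = 2 * herm z (z - y)"
      by (simp add: herm_diff hz zy)
    ultimately have "2 * herm z (z - y) / herm (z - y) (z - y) = 1" by simp
    then show ?thesis by (simp add: H_def rank1_reflection_apply)
  qed
  define U where "U = diag_matrix (\<lambda>_. \<beta> * cnj \<alpha>) ** H"
  have "unitary_matrix U" unfolding U_def H_def
    by (intro unitary_mult unitary_diag unitary_reflection) (simp add: norm_mult assms \<alpha>)
  moreover have "U *v z = axis j (\<beta> * of_real R)"
  proof -
    have "cnj \<alpha> * \<alpha> = 1" using \<alpha> by (metis complex_norm_square mult.commute of_real_1 one_power2)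
    then show ?thesis
      unfolding U_def matrix_vector_mul_assoc[symmetric] \<open>H *v z = y\<close>
      by (auto simp: vec_eq_iff diag_matrix_apply y_def axis_def)
  qed
  ultimately show ?thesis using that by (simp add: R_def)
qed

section \<open>The structure of invariant metrics\<close>

lemma bnorm_axis [simp]: "bnorm j (axis j c) = 1"
  by (simp add: bnorm_def axis_def)

lemma wnorm_axis [simp]: "wnorm s j (axis j c) = (norm c)\<^sup>2"
  by (simp add: wnorm_def)

lemma affine_lift_axis: "affine_lift j (axis j c) = axis j 1"
  by (simp add: vec_eq_iff affine_lift_nth axis_def)

lemma nuc_axis [simp]: "nuc j (axis j c) i = 0"
  by (simp add: nuc_def axis_def)

lemma mmat_axis: "mmat s j a b (axis j c) $ i $ l = (if i = l then of_real (if i = j then b else a) else 0)"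
  by (simp add: mmat_def fsc_def xic_def)

lemma sform_axis_scaled: "sform M (axis i p) (axis l q) = p * cnj q * M $ i $ l"
proof -
  have ax: "axis i c = c *s axis i (1 :: complex)" for i :: 'a and c by (simp add: vec_eq_iff axis_def)
  have "sform M (p *s v) (q *s u) = p * cnj q * sform M v u" for v u
    by (simp add: sform_def sum_distrib_left mult_ac)
  then show ?thesis unfolding ax[of i p] ax[of l q] by (simp add: sform_axis)
qed

text \<open>A matrix fixing a coordinate vector fixes the fibre over it pointwise; invariance then
  becomes a condition on the components at a single point.\<close>

lemma Tmap_fix_axis:
  assumes "U *v axis j 1 = axis j 1"
  shows "Tmap s s j j U (axis j c) = axis j c"
proof -
  have z: "U *v affine_lift j (axis j c) = axis j 1" using assms by (simp add: affine_lift_axis)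
  show ?thesis unfolding Tmap_def Let_def z by (simp add: vec_eq_iff axis_def)
qed

lemma Dmap_fix_axis:
  assumes "U *v axis j 1 = axis j 1" "(U *v bpart j v) $ j = 0"
  shows "Dmap s s j j U (axis j c) v = (\<chi> i. if i = j then v $ j else (U *v bpart j v) $ i)"
proof -
  have z: "U *v affine_lift j (axis j c) = axis j 1" using assms by (simp add: affine_lift_axis)
  show ?thesis unfolding Dmap_def Let_def z by (simp add: vec_eq_iff assms(2))
qed

text \<open>The fibre over the coordinate point \<open>j0\<close> meets every orbit of the unitary
  group; \<open>l0\<close> stands for a direction along the base.\<close>

locale invariant_metric =
  fixes k :: nat and g :: "('n::finite, 'n piece_point set) tensor_field" and j0 l0 :: 'n
  assumes k: "k \<ge> 1" and kahler: "kahler_metric (Mk_atlas k) g" and inv: "unitary_invariant k g"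
    and jl: "l0 \<noteq> j0"
begin

lemma pos: "pos_def_hermitian (g (ch k e j) x)"
  and smooth_g: "smooth_on UNIV (g (ch k e j))"
  and closed: "wirt m (\<lambda>u. g (ch k e j) u $ i $ l) x = wirt i (\<lambda>u. g (ch k e j) u $ m $ l) x"
  using kahler by (simp_all add: kahler_metric_def ball_atlas smooth_iff_smooth_on)

lemma pullback:
  assumes "unitary_matrix U" "(U *v affine_lift j x) $ j' \<noteq> 0" "e = e' \<or> x $ j \<noteq> 0"
  shows "g (ch k e j) x $ i $ l = sform (g (ch k e' j') (Tmap (sg k e) (sg k e') j j' U x))
          (Dmap (sg k e) (sg k e') j j' U x (axis i 1)) (Dmap (sg k e) (sg k e') j j' U x (axis l 1))"
  using inv assms is_pullback_act_iff[OF k similarity_unitary[OF assms(1)], of g g]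
  unfolding unitary_invariant_def by blast

lemma pullback_id:
  assumes "affine_lift j x $ j' \<noteq> 0" "e = e' \<or> x $ j \<noteq> 0"
  shows "g (ch k e j) x $ i $ l = sform (g (ch k e' j') (Tmap (sg k e) (sg k e') j j' (mat 1) x))
          (Dmap (sg k e) (sg k e') j j' (mat 1) x (axis i 1)) (Dmap (sg k e) (sg k e') j j' (mat 1) x (axis l 1))"
proof -
  have "is_pullback (Mk_atlas k) (Mk_act k (mat 1)) g g"
    using kahler unfolding kahler_metric_def is_pullback_id_iff[OF k] by blast
  moreover have "(mat 1 *v affine_lift j x) $ j' \<noteq> 0" using assms(1) by simp
  ultimately show ?thesis using assms(2) unfolding is_pullback_act_iff[OF k similarity_1] by blast
qed

text \<open>Read off at the point with fibre coordinate sqrt w over \<open>j0\<close>, which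
  represents the points of squared norm w.\<close>

definition a :: "bool \<Rightarrow> real \<Rightarrow> real" where
  "a e w = Re (g (ch k e j0) (axis j0 (of_real (sqrt w))) $ l0 $ l0)"

definition b :: "bool \<Rightarrow> real \<Rightarrow> real" where
  "b e w = Re (g (ch k e j0) (axis j0 (of_real (sqrt w))) $ j0 $ j0)"

text \<open>Changing the sign of a coordinate other than \<open>j0\<close> is unitary and fixes the
  fibre over \<open>j0\<close>, but reverses each off-diagonal component with that index. Of two
  distinct indices, one is always different from \<open>j0\<close>.\<close>

lemma axis_offdiag:
  assumes "i \<noteq> l" shows "g (ch k e j0) (axis j0 c) $ i $ l = 0"
proof -
  have 1: "g (ch k e j0) (axis j0 c) $ i $ l = 0" if il: "i \<noteq> l" and q: "q \<noteq> j0" "q = i \<or> q = l" for q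
  proof -
    define d :: "'n \<Rightarrow> complex" where "d = (\<lambda>m. if m = q then -1 else 1)"
    have u: "unitary_matrix (diag_matrix d)" by (rule unitary_diag) (simp add: d_def)
    have f: "diag_matrix d *v axis j0 1 = axis j0 1"
      using q by (auto simp: vec_eq_iff diag_matrix_apply d_def axis_def)
    have b: "(diag_matrix d *v bpart j0 v) $ j0 = 0" for v by (simp add: diag_matrix_apply bpart_def)
    have D: "Dmap (sg k e) (sg k e) j0 j0 (diag_matrix d) (axis j0 c) (axis m 1) = axis m (d m)" for m
      unfolding Dmap_fix_axis[OF f b] using q by (auto simp: vec_eq_iff diag_matrix_apply bpart_def axis_def d_def)
    have "g (ch k e j0) (axis j0 c) $ i $ l = sform (g (ch k e j0) (axis j0 c)) (axis i (d i)) (axis l (d l))"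
      using pullback[OF u, of j0 "axis j0 c" j0 e e i l]
      by (simp add: affine_lift_axis f Tmap_fix_axis D)
    also have "\<dots> = d i * cnj (d l) * g (ch k e j0) (axis j0 c) $ i $ l"
      by (rule sform_axis_scaled)
    also have "d i * cnj (d l) = -1" using il q by (auto simp: d_def)
    finally show ?thesis by simp
  qed
  show ?thesis using 1[of i] 1[of l] assms by (cases "i = j0") auto
qed

lemma axis_diag:
  assumes "i \<noteq> j0" shows "g (ch k e j0) (axis j0 c) $ i $ i = g (ch k e j0) (axis j0 c) $ l0 $ l0"
proof -
  let ?U = "swap_matrix i l0"
  have f: "?U *v axis j0 1 = axis j0 1" using assms jl by (auto simp: vec_eq_iff swap_matrix_apply axis_def)
  have b: "(?U *v bpart j0 v) $ j0 = 0" for v using assms jl by (simp add: swap_matrix_apply bpart_def)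
  have D: "Dmap (sg k e) (sg k e) j0 j0 ?U (axis j0 c) (axis i 1) = axis l0 1"
    unfolding Dmap_fix_axis[OF f b] using assms jl by (auto simp: vec_eq_iff swap_matrix_apply bpart_def axis_def)
  show ?thesis
    using pullback[OF unitary_swap, of i l0 j0 "axis j0 c" j0 e e i i]
    by (simp add: affine_lift_axis f Tmap_fix_axis D sform_axis)
qed

lemma diag_real: "g (ch k e j) x $ i $ i = of_real (Re (g (ch k e j) x $ i $ i))" "Re (g (ch k e j) x $ i $ i) > 0"
proof -
  have h: "g (ch k e j) x $ i $ i = cnj (g (ch k e j) x $ i $ i)"
    using pos[of e j x] unfolding pos_def_hermitian_def by blast
  then show "g (ch k e j) x $ i $ i = of_real (Re (g (ch k e j) x $ i $ i))"
    by (simp add: complex_eq_iff)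
  have "axis i (1 :: complex) \<noteq> 0" by (simp add: axis_eq_0_iff)
  then have "0 < Re (\<Sum>p\<in>UNIV. \<Sum>q\<in>UNIV. g (ch k e j) x $ p $ q * axis i 1 $ p * cnj (axis i 1 $ q))"
    using pos[of e j x] unfolding pos_def_hermitian_def by blast
  then show "Re (g (ch k e j) x $ i $ i) > 0"
    using sform_axis[of "g (ch k e j) x" i i] unfolding sform_def by (simp only:)
qed

lemma a_pos: "a e w > 0" and b_pos: "b e w > 0"
  by (simp_all add: a_def b_def diag_real(2))

lemma axis_form:
  assumes "w \<ge> 0"
  shows "g (ch k e j0) (axis j0 (of_real (sqrt w))) = mmat s j0 (a e w) (b e w) (axis j0 (of_real (sqrt w)))"
  unfolding vec_eq_iff mmat_axis
  using axis_offdiag axis_diag diag_real(1) by (auto simp: a_def b_def)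

text \<open>A unitary matrix carries the lift to \<beta> R times the coordinate vector
  \<open>j0\<close>. The free phase \<beta> is spent on making the fibre coordinate real and
  nonnegative, which leads to a point where \<open>a\<close> and \<open>b\<close> were read off; the
  behaviour of \<open>mform\<close> under similarities carries the normal form back.\<close>

lemma radial: "radial_tensor k a b g"
  unfolding radial_tensor_def
proof (intro allI)
  fix e j and x :: "complex^'n"
  let ?s = "sg k e"
  define z where "z = affine_lift j x"
  define R where "R = sqrt (bnorm j x)"
  have R: "R > 0" "R\<^sup>2 = bnorm j x" using bnorm_pos[of j x] by (simp_all add: R_def)
  have rz: "sqrt (Re (herm z z)) = R" by (simp add: z_def R_def herm_affine_lift)
  \<comment> \<open>Rotating the lift by cis (- t / s) rotates the fibre coordinate, of nonzero
    degree s, by cis (- t).\<close>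
  obtain \<beta> where \<beta>: "norm \<beta> = 1" "\<beta> powi ?s * x $ j = of_real (norm (x $ j))"
  proof -
    obtain t where t: "x $ j = of_real (norm (x $ j)) * cis t"
      by (metis rcis_def rcis_cmod_Arg)
    have "cis (- t / of_int ?s) powi ?s = cis (- t)"
      using sg_nz[OF k, of e] by (simp add: cis_power_int)
    then have "cis (- t / of_int ?s) powi ?s * x $ j = of_real (norm (x $ j))"
      by (subst t) (simp add: cis_mult mult.left_commute)
    then show ?thesis by (intro that[of "cis (- t / of_int ?s)"]) auto
  qed
  obtain U where U: "unitary_matrix U" "U *v z = axis j0 (\<beta> * of_real R)"
    using unitary_to_axis[OF \<beta>(1), of z j0] rz by metis
  have m: "(U *v affine_lift j x) $ j0 \<noteq> 0" using U(2) R \<beta>(1) by (auto simp: z_def axis_def)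
  define r where "r = sqrt (wnorm ?s j x)"
  have "Tmap ?s ?s j j0 U x = axis j0 (of_real r)"
  proof -
    have "R powi ?s * norm (x $ j) = r"
    proof -
      have "(R powi ?s * norm (x $ j))\<^sup>2 = wnorm ?s j x"
        unfolding wnorm_def R(2)[symmetric] by (simp add: power_mult_distrib power2_eq_square power_int_mult_distrib)
      moreover have "R powi ?s * norm (x $ j) \<ge> 0" using R by simp
      ultimately show ?thesis unfolding r_def by (metis real_sqrt_abs abs_of_nonneg)
    qed
    then have "(\<beta> * of_real R) powi ?s * x $ j = of_real r"
      using \<beta>(2) by (simp add: power_int_mult_distrib mult_ac flip: of_real_power_int of_real_mult) (metis mult.commute of_real_mult mult.left_commute)
    then show ?thesis using U(2) by (simp add: Tmap_def Let_def z_def[symmetric] vec_eq_iff axis_def)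
  qed
  moreover have w: "wnorm ?s j x \<ge> 0" by (rule wnorm_nonneg)
  ultimately have T: "g (ch k e j0) (Tmap ?s ?s j j0 U x) = mmat ?s j0 (a e (wnorm ?s j x)) (b e (wnorm ?s j x)) (Tmap ?s ?s j j0 U x)"
    using axis_form[OF w] by (simp add: r_def)
  have "g (ch k e j) x $ i $ l = mform ?s j (a e (wnorm ?s j x)) (b e (wnorm ?s j x)) x (axis i 1) (axis l 1)" for i l
    using pullback[OF U(1) m, of e e i l] unfolding T sform_mmat mform_Dmap_same[OF similarity_unitary[OF U(1)] m refl]
    by simp
  then show "g (ch k e j) x = mmat ?s j (a e (wnorm ?s j x)) (b e (wnorm ?s j x)) x"
    by (simp add: vec_eq_iff flip: sform_mmat) (simp add: sform_axis)
qed

lemma radial_form: "g (ch k e j) x = mmat (sg k e) j (a e (wnorm (sg k e) j x)) (b e (wnorm (sg k e) j x)) x"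
  using radial by (simp add: radial_tensor_def)

lemma opp:
  assumes "w > 0" shows "a (\<not> e) (1 / w) = a e w" "b (\<not> e) (1 / w) = w\<^sup>2 * b e w"
proof -
  let ?X = "axis j0 (complex_of_real (sqrt w))"
  have X: "?X $ j0 \<noteq> 0" using assms by (simp add: axis_def)
  have m: "(mat 1 *v affine_lift j0 ?X) $ j0 \<noteq> 0" by (simp add: affine_lift_nth)
  have s: "sg k (\<not> e) = - sg k e" by (simp add: sg_def)
  let ?T = "Tmap (sg k e) (sg k (\<not> e)) j0 j0 (mat 1) ?X"
  have wX: "wnorm (sg k e) j0 ?X = w" using assms by simp
  have "wnorm (sg k (\<not> e)) j0 ?T = 1 / w"
    using wnorm_Tmap_opp[OF similarity_1 m s sg_nz[OF k] X] wX by simp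
  then have T: "g (ch k (\<not> e) j0) ?T = mmat (sg k (\<not> e)) j0 (a (\<not> e) (1 / w)) (b (\<not> e) (1 / w)) ?T"
    by (simp add: radial_form)
  have "mmat (sg k e) j0 (a e w) (b e w) ?X $ i $ l = mmat (sg k e) j0 (a (\<not> e) (1 / w)) (b (\<not> e) (1 / w) / w\<^sup>2) ?X $ i $ l" for i l
    using pullback_id[of j0 ?X j0 e "\<not> e" i l] X
    unfolding T sform_mmat mform_Dmap_opp[OF similarity_1 m s sg_nz[OF k] X] radial_form[of e j0 ?X] wX
    by (simp add: affine_lift_nth flip: sform_mmat) (simp add: sform_axis)
  from this[of l0 l0] this[of j0 j0] show "a (\<not> e) (1 / w) = a e w" "b (\<not> e) (1 / w) = w\<^sup>2 * b e w"
    using jl assms unfolding mmat_axis by (simp_all add: field_simps flip: of_real_mult of_real_power of_real_divide)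
qed

text \<open>The components as functions of the radius. Along the real line in the fibre they are
  restrictions of smooth functions, whereas smoothness of \<open>a\<close> and \<open>b\<close> in w
  at 0 is not evident.\<close>

definition A :: "bool \<Rightarrow> real \<Rightarrow> real" where "A e r = a e (r\<^sup>2)"
definition B :: "bool \<Rightarrow> real \<Rightarrow> real" where "B e r = b e (r\<^sup>2)"

lemma AB_axis: "g (ch k e j0) (axis j0 c) $ l0 $ l0 = of_real (A e (norm c))"
  "g (ch k e j0) (axis j0 c) $ j0 $ j0 = of_real (B e (norm c))"
  using jl by (simp_all add: radial_form mmat_axis A_def B_def)

lemma AB_pos: "A e r > 0" "B e r > 0" by (simp_all add: A_def B_def a_pos b_pos)

lemma smooth_entry: "smooth_on UNIV (\<lambda>u. g (ch k e j) u $ i $ l)"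
  by (rule smooth_on_nth[OF open_UNIV smooth_on_nth[OF open_UNIV smooth_g]])

lemma smooth_axis_line: "smooth_on UNIV F \<Longrightarrow> smooth_on UNIV (\<lambda>r::real. F (axis j (complex_of_real r)))"
  by (rule smooth_on_compose_linear[OF bounded_linear_compose[OF bounded_linear_axis bounded_linear_of_real] open_UNIV, unfolded o_def])
     auto

lemma smooth_AB: "smooth_on UNIV (A e)" "smooth_on UNIV (B e)"
proof -
  have "A e = (\<lambda>r. Re (g (ch k e j0) (axis j0 (of_real r)) $ l0 $ l0))" "B e = (\<lambda>r. Re (g (ch k e j0) (axis j0 (of_real r)) $ j0 $ j0))"
    by (simp_all add: AB_axis fun_eq_iff) (simp_all add: A_def B_def)
  then show "smooth_on UNIV (A e)" "smooth_on UNIV (B e)"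
    using smooth_on_linear_compose[OF bounded_linear_Re open_UNIV smooth_axis_line[OF smooth_entry]] by simp_all
qed

text \<open>The relation a' = s b in terms of the radius, from the closedness condition for the
  components \<open>l0 l0\<close> and \<open>j0 l0\<close>. The first is differentiated along the
  fibre, radially; the second transversally to it, starting from the value 0.\<close>

lemma A_deriv:
  assumes r: "r > 0" shows "deriv (A e) r = 2 * of_int (sg k e) * r * B e r"
proof -
  let ?s = "sg k e" and ?X = "axis j0 (complex_of_real r)"
  have "wirt j0 (\<lambda>u. g (ch k e j0) u $ l0 $ l0) ?X = w1 (\<lambda>x. of_real (A e (norm x))) (of_real r)"
    using line_wirt(1)[OF smooth_entry[of e j0 l0 l0], of j0] by (simp add: AB_axis fun_eq_iff)
  then have L: "wirt j0 (\<lambda>u. g (ch k e j0) u $ l0 $ l0) ?X = of_real (deriv (A e) r / 2)"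
    using w1_radial(1)[OF refl smooth_AB(1) r] by simp
  define F where "F = (\<lambda>u. g (ch k e j0) u $ j0 $ l0)"
  have "F differentiable (at ?X)" unfolding F_def by (rule smooth_on_differentiable[OF smooth_entry UNIV_I])
  then have dF: "(F has_derivative frechet_derivative F (at ?X)) (at ?X)" using frechet_derivative_works by blast
  \<comment> \<open>On this transversal line the component is t times a function that is continuous
    at 0, so Caratheodory's criterion gives its derivative without differentiating
    \<open>b\<close>.\<close>
  have line: "F (?X + t *\<^sub>R axis l0 c) = of_real t * of_real (b e (r\<^sup>2 * (1 + t\<^sup>2) powi ?s) * (1 + t\<^sup>2) powi ?s / (1 + t\<^sup>2)) * (of_int ?s * of_real r * c)"
    if "norm c = 1" for t c
  proof -
    let ?u = "?X + t *\<^sub>R axis l0 c"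
    have uj: "?u $ j0 = of_real r" "?u $ l0 = of_real t * c" using jl by (simp_all add: axis_def) (simp add: scaleR_conv_of_real)
    have "(\<Sum>i\<in>UNIV - {j0}. (norm (?u $ i))\<^sup>2) = (\<Sum>i\<in>{l0}. (norm (?u $ i))\<^sup>2)"
      using jl by (intro sum.mono_neutral_right) (auto simp: axis_def)
    also have "\<dots> = (norm (?u $ l0))\<^sup>2" by simp
    finally have sum: "(\<Sum>i\<in>UNIV - {j0}. (norm (?u $ i))\<^sup>2) = (norm (?u $ l0))\<^sup>2" .
    have N: "bnorm j0 ?u = 1 + t\<^sup>2"
      unfolding bnorm_def sum uj(2) using that by (simp add: norm_mult)
    have X0: "?X $ l0 = 0" using jl by (simp add: axis_def)
    have w: "wnorm ?s j0 ?u = r\<^sup>2 * (1 + t\<^sup>2) powi ?s" unfolding wnorm_def N uj(1) using r by simp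
    show ?thesis unfolding F_def radial_form w mmat_def using jl
      unfolding fsc_def xic_def nuc_def N uj by (simp add: mult_ac X0) (simp add: scaleR_conv_of_real)
  qed
  have cont: "isCont (\<lambda>t. b e (r\<^sup>2 * (1 + t\<^sup>2) powi ?s) * (1 + t\<^sup>2) powi ?s / (1 + t\<^sup>2)) 0"
  proof -
    have "b e w = B e (sqrt w)" if "w \<ge> 0" for w using that by (simp add: B_def)
    then have eq: "(\<lambda>t. b e (r\<^sup>2 * (1 + t\<^sup>2) powi ?s) * (1 + t\<^sup>2) powi ?s / (1 + t\<^sup>2)) =
        (\<lambda>t. B e (sqrt (r\<^sup>2 * (1 + t\<^sup>2) powi ?s)) * (1 + t\<^sup>2) powi ?s / (1 + t\<^sup>2))"
      by (simp add: fun_eq_iff)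
    have cB: "isCont (B e) y" for y
      using DERIV_isCont[OF smooth_on_real_deriv(2)[OF smooth_AB(2) open_UNIV UNIV_I]] .
    have p: "isCont (\<lambda>t::real. (1 + t\<^sup>2) powi ?s) 0"
    proof (rule DERIV_isCont)
      show "((\<lambda>t::real. (1 + t\<^sup>2) powi ?s) has_real_derivative 0) (at 0)"
        by (auto intro!: derivative_eq_intros)
    qed
    have sq: "isCont (\<lambda>t. sqrt (r\<^sup>2 * (1 + t\<^sup>2) powi ?s)) 0"
      by (intro continuous_intros p)
    have "isCont (\<lambda>t. B e (sqrt (r\<^sup>2 * (1 + t\<^sup>2) powi ?s))) 0"
      by (rule isCont_o2[OF sq cB])
    then have "isCont (\<lambda>t. B e (sqrt (r\<^sup>2 * (1 + t\<^sup>2) powi ?s)) * (1 + t\<^sup>2) powi ?s / (1 + t\<^sup>2)) 0"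
      by (intro continuous_intros p) auto
    then show ?thesis by (simp only: eq)
  qed
  have D: "frechet_derivative F (at ?X) (axis l0 c) = of_real (B e r * of_int ?s * r) * c" if "norm c = 1" for c
  proof -
    have 1: "((\<lambda>t. F (?X + t *\<^sub>R axis l0 c)) has_vector_derivative frechet_derivative F (at ?X) (axis l0 c)) (at 0)"
    proof -
      have "((\<lambda>t. ?X + t *\<^sub>R axis l0 c) has_derivative (\<lambda>t. t *\<^sub>R axis l0 c)) (at (0::real))"
        by (auto intro!: derivative_eq_intros)
      moreover have "(F has_derivative frechet_derivative F (at ?X)) (at (?X + 0 *\<^sub>R axis l0 c))" using dF by simp
      ultimately have "((\<lambda>t. F (?X + t *\<^sub>R axis l0 c)) has_derivative (\<lambda>t. frechet_derivative F (at ?X) (t *\<^sub>R axis l0 c))) (at 0)"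
        by (rule has_derivative_compose)
      then show ?thesis
        unfolding has_vector_derivative_def linear_scale[OF has_derivative_linear[OF dF]] .
    qed
    define h where "h = (\<lambda>t. b e (r\<^sup>2 * (1 + t\<^sup>2) powi ?s) * (1 + t\<^sup>2) powi ?s / (1 + t\<^sup>2))"
    have "((\<lambda>t. t * h t) has_real_derivative h 0) (at 0)"
      unfolding CARAT_DERIV by (rule exI[of _ h]) (use cont in \<open>simp add: h_def mult.commute\<close>)
    then have "((\<lambda>t. of_real (t * h t) * (of_int ?s * of_real r * c)) has_vector_derivative of_real (h 0) * (of_int ?s * of_real r * c)) (at 0)"
      by (intro has_vector_derivative_mult_left has_vector_derivative_of_real)
         (simp add: has_real_derivative_iff_has_vector_derivative)
    then have "((\<lambda>t. F (?X + t *\<^sub>R axis l0 c)) has_vector_derivative of_real (h 0) * (of_int ?s * of_real r * c)) (at 0)"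
      unfolding line[OF that] h_def by simp
    from vector_derivative_unique_at[OF 1 this] show ?thesis
      using r by (simp add: h_def B_def)
  qed
  have wF: "wirt l0 F ?X = of_real (B e r * of_int ?s * r)"
    unfolding wirt_def D[of 1, simplified] by (subst D) (auto simp: field_simps)
  have "complex_of_real (deriv (A e) r / 2) = of_real (B e r * of_int ?s * r)"
    unfolding L[symmetric] wF[symmetric] F_def by (rule closed)
  then have "deriv (A e) r / 2 = B e r * of_int ?s * r" using of_real_eq_iff by blast
  then show ?thesis by simp
qed

end

section \<open>Reduction to an ordinary differential equation\<close>

lemma ch_axis_opp:
  assumes "k \<ge> 1" "x \<noteq> 0"
  shows "ch k e j (axis j x) = ch k (\<not> e) j (axis j (1 / x))"
proof -
  have "Tmap (sg k e) (sg k (\<not> e)) j j (mat 1) (axis j x) = axis j (1 / x)"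
    using sg_nz[OF assms(1), of e] by (simp add: Tmap_def Let_def affine_lift_axis sg_opp[of "\<not> e" e])
      (simp add: vec_eq_iff axis_def divide_inverse)
  moreover have "(mat 1 *v affine_lift j (axis j x)) $ j \<noteq> 0" "e = (\<not> e) \<or> axis j x $ j \<noteq> 0"
    using assms(2) by (simp_all add: affine_lift_nth)
  ultimately show ?thesis using act_ch[of "mat 1" j "axis j x" j e "\<not> e" k] act_1[OF assms(1)] assms(1) by metis
qed

lemma ch_axis_move:
  assumes "k \<ge> 1" "x \<noteq> 0" "l \<noteq> j"
  shows "ch k e j (axis l x) = ch k e l (axis j (1 / x))"
proof -
  have z: "affine_lift j (axis l x) $ i = (if i = j then 1 else if i = l then x else 0)" for i
    by (simp add: affine_lift_nth axis_def)
  have "Tmap (sg k e) (sg k e) j l (mat 1) (axis l x) = axis j (1 / x)"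
    unfolding Tmap_def Let_def using assms(2,3) by (simp add: vec_eq_iff z) (simp add: axis_def)
  moreover have "(mat 1 *v affine_lift j (axis l x)) $ l \<noteq> 0" using assms by (simp add: z)
  ultimately show ?thesis using act_ch[of "mat 1" j "axis l x" l e e k] act_1[OF assms(1)] assms(1) by metis
qed

text \<open>The unit discs of two charts glued by inversion cover the sphere and are compact. With
  \<open>ch_axis_opp\<close> this applies to a fibre, with \<open>ch_axis_move\<close> to a line
  inside a section.\<close>

lemma bounded_two_charts:
  fixes p q :: "complex \<Rightarrow> real"
  assumes "continuous_on UNIV p" "continuous_on UNIV q" and eq: "\<And>x. x \<noteq> 0 \<Longrightarrow> p x = q (1 / x)"
  obtains M where "\<And>x. \<bar>p x\<bar> \<le> M"
proof -
  have "compact (p ` cball 0 1)" "compact (q ` cball 0 1)"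
    by (intro compact_continuous_image continuous_on_subset[OF assms(1)] continuous_on_subset[OF assms(2)]; simp)+
  then have "bounded (p ` cball 0 1 \<union> q ` cball 0 1)" by (simp add: compact_imp_bounded)
  then obtain M where M: "\<And>y. y \<in> p ` cball 0 1 \<union> q ` cball 0 1 \<Longrightarrow> \<bar>y\<bar> \<le> M"
    unfolding bounded_iff real_norm_def by blast
  have "\<bar>p x\<bar> \<le> M" for x
  proof (cases "norm x \<le> 1")
    case False
    then have "x \<noteq> 0" "norm (1 / x) \<le> 1" by (auto simp: norm_divide divide_le_eq)
    then show ?thesis using M[of "q (1 / x)"] eq[of x] by auto
  qed (use M in auto)
  then show ?thesis by (rule that)
qed

text \<open>Only the metric is assumed invariant; what is needed about the symmetry of
  \<open>f\<close> is derived in \<open>f_radial\<close>.\<close>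

locale invariant_soliton = invariant_metric k g j0 l0
  for k and g :: "('n::finite, 'n piece_point set) tensor_field" and j0 l0 +
  fixes f :: "'n piece_point set \<Rightarrow> real"
  assumes f_smooth: "smooth_on UNIV (\<lambda>x. f (ch k e j x))"
    and mixed: "ricci (g (ch k e j)) i l x - g (ch k e j) x $ i $ l
      = hess_mixed (\<lambda>u. complex_of_real (f (ch k e j u))) i l x"
    and pure: "hess_pure (g (ch k e j)) (\<lambda>u. complex_of_real (f (ch k e j u))) i l x = 0"
begin

abbreviation F :: "bool \<Rightarrow> complex^'n \<Rightarrow> complex" where "F e u \<equiv> complex_of_real (f (ch k e j0 u))"
abbreviation LD :: "bool \<Rightarrow> complex^'n \<Rightarrow> complex" where "LD e u \<equiv> Ln (det (g (ch k e j0) u))"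

lemma smooth_F: "smooth_on UNIV (F e)"
  by (rule smooth_on_of_real[OF open_UNIV f_smooth])

lemma LD_eq: "LD e u = of_real (ln (a e (wnorm (sg k e) j0 u) ^ (CARD('n) - 1) * b e (wnorm (sg k e) j0 u) * bnorm j0 u powi (sg k e - int CARD('n))))"
  unfolding radial_form det_mmat[OF a_pos]
  by (rule Ln_of_real) (simp add: a_pos b_pos bnorm_pos)

lemma smooth_LD: "smooth_on UNIV (LD e)"
proof -
  have d: "det (g (ch k e j0) u) = of_real (a e (wnorm (sg k e) j0 u) ^ (CARD('n) - 1) * b e (wnorm (sg k e) j0 u) * bnorm j0 u powi (sg k e - int CARD('n)))" for u
    by (simp only: radial_form det_mmat[OF a_pos])
  have "LD e = (\<lambda>u. of_real (ln (Re (det (g (ch k e j0) u)))))"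
    unfolding d Re_complex_of_real
    by (rule ext, rule Ln_of_real) (simp add: a_pos b_pos bnorm_pos)
  moreover have "smooth_on UNIV (\<lambda>u. complex_of_real (ln (Re (det (g (ch k e j0) u)))))"
    by (rule smooth_on_of_real[OF open_UNIV smooth_on_compose_real[OF open_UNIV smooth_on_ln
        smooth_on_linear_compose[OF bounded_linear_Re open_UNIV smooth_on_det[OF open_UNIV smooth_g]]]])
       (auto simp: d a_pos b_pos bnorm_pos simp del: of_real_mult of_real_power of_real_power_int)
  ultimately show ?thesis by simp
qed

text \<open>The mixed equation with both second derivatives on one side: f + log det satisfies a
  Laplace equation with source - g on every coordinate line.\<close>

lemma hess_F_LD: "wirt i (wirt_bar l (\<lambda>u. F e u + LD e u)) x = - g (ch k e j0) x $ i $ l"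
proof -
  have W: "has_wirt G (\<lambda>i. wirt i G x) (\<lambda>i. wirt_bar i G x) x" if "smooth_on UNIV G" for G :: "complex^'n \<Rightarrow> complex" and x
    by (rule has_wirtI[OF smooth_on_differentiable[OF that UNIV_I]])
  have "wirt_bar l (\<lambda>u. F e u + LD e u) = (\<lambda>u. wirt_bar l (F e) u + wirt_bar l (LD e) u)"
    using has_wirt_eqs(2)[OF has_wirt_add[OF W[OF smooth_F] W[OF smooth_LD]]] by blast
  then have "wirt i (wirt_bar l (\<lambda>u. F e u + LD e u)) x = wirt i (wirt_bar l (F e)) x + wirt i (wirt_bar l (LD e)) x"
    using has_wirt_eqs(1)[OF has_wirt_add[OF W[OF smooth_on_wirt_bar(1)[OF smooth_F]] W[OF smooth_on_wirt_bar(1)[OF smooth_LD]]]]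
    by simp
  moreover have "wirt i (wirt_bar l (F e)) x = - wirt i (wirt_bar l (LD e)) x - g (ch k e j0) x $ i $ l"
    using mixed[of e j0 i l x] unfolding ricci_def hess_mixed_def by (rule sym)
  ultimately show ?thesis by simp
qed

definition \<psi> :: "bool \<Rightarrow> real \<Rightarrow> real" where "\<psi> e r = f (ch k e j0 (axis j0 (of_real r)))"
text \<open>f + log det along the half-line, by \<open>det_mmat\<close> with \<open>bnorm\<close> =
  1 on this fibre.\<close>

definition \<h> :: "bool \<Rightarrow> real \<Rightarrow> real" where "\<h> e r = \<psi> e r + ln (A e r ^ (CARD('n) - 1) * B e r)"

lemma smooth_psi: "smooth_on UNIV (\<psi> e)"
  unfolding \<psi>_def by (rule smooth_axis_line[OF f_smooth])

lemma LD_axis: "LD e (axis j0 x) = of_real (ln (A e (norm x) ^ (CARD('n) - 1) * B e (norm x)))"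
  by (simp add: LD_eq A_def B_def del: of_real_mult)

lemma smooth_line: "smooth_on UNIV G \<Longrightarrow> smooth_on UNIV (\<lambda>x::complex. G (axis j x))"
  by (rule smooth_on_compose_linear[OF bounded_linear_axis open_UNIV]) auto

text \<open>Rotating the fibre coordinate changes neither log det nor the fibre component of the
  metric, so f minus its rotated copy is harmonic. It is bounded, as the fibre closes up to a
  sphere, and vanishes at the origin, hence everywhere on the fibre.\<close>

lemma f_radial: "f (ch k e j0 (axis j0 x)) = \<psi> e (norm x)"
proof -
  define p where "p = (\<lambda>x. f (ch k e j0 (axis j0 x)))"
  define H where "H = (\<lambda>x. F e (axis j0 x) + LD e (axis j0 x))"
  have smH: "smooth_on UNIV H"
    unfolding H_def by (rule smooth_line[OF smooth_on_add[OF open_UNIV smooth_F smooth_LD]])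
  have hH: "w1 (w1b H) x = - of_real (B e (norm x))" for x
    unfolding H_def line_hess(1)[OF smooth_on_add[OF open_UNIV smooth_F smooth_LD]] hess_F_LD AB_axis ..
  have cont: "continuous_on UNIV (\<lambda>x. f (ch k e j0 (axis j0 x)))" for e
  proof -
    have "smooth_on UNIV (\<lambda>x::complex. f (ch k e j0 (axis j0 x)))" by (rule smooth_line[OF f_smooth])
    then show ?thesis by (meson UNIV_I continuous_at_imp_continuous_on differentiable_imp_continuous_within smooth_on_differentiable)
  qed
  obtain M where M: "\<And>x. \<bar>p x\<bar> \<le> M"
    using bounded_two_charts[OF cont[of e] cont[of "\<not> e"]] ch_axis_opp[OF k] unfolding p_def by metis
  have "p x = p (t * x)" if t: "norm t = 1" for t x
  proof -
    define q where "q = (\<lambda>x. p x - p (t * x))"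
    have Q: "complex_of_real (q x) = H x + (- 1) * H (t * x)" for x
      using t by (simp add: q_def p_def H_def LD_axis norm_mult)
    have smQ: "smooth_on UNIV (\<lambda>x. complex_of_real (q x))"
      unfolding Q
      by (intro smooth_on_add[OF open_UNIV smH] smooth_on_mult[OF open_UNIV smooth_on_const]
          smooth_on_compose_linear[OF bounded_linear_mult_right open_UNIV smH]) auto
    have W: "has_w1 G (w1 G x) (w1b G x) x" if "smooth_on UNIV G" for G x
      by (rule has_w1I[OF smooth_on_differentiable[OF that UNIV_I]])
    have "w1b (\<lambda>x. complex_of_real (q x)) = (\<lambda>x. w1b H x + (- 1) * (w1b H (t * x) * cnj t))"
      unfolding Q
      by (rule ext) (simp only: has_w1_eqs(2)[OF has_w1_add[OF W[OF smH] has_w1_mult[OF has_w1_const[of "- 1"] has_w1_rot[OF W[OF smH]]]]]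
          mult_zero_left add_0_right)
    moreover have "w1 (\<lambda>x. w1b H x + (- 1) * (w1b H (t * x) * cnj t)) x = w1 (w1b H) x - w1 (w1b H) (t * x) * t * cnj t" for x
      using has_w1_eqs(1)[OF has_w1_add[OF W[OF smooth_on_w1(2)[OF smH]] has_w1_mult[OF has_w1_const[of "- 1"]
              has_w1_mult[OF has_w1_rot[OF W[OF smooth_on_w1(2)[OF smH]]] has_w1_const[of "cnj t"]]]]] by simp
    moreover have "t * cnj t = 1" using t by (metis complex_norm_square of_real_1 one_power2)
    ultimately have "w1 (w1b (\<lambda>x. complex_of_real (q x))) x = 0" for x
      using t by (simp add: hH norm_mult mult.assoc)
    moreover have "q x \<le> M + M" for x using M[of x] M[of "t * x"] unfolding q_def by linarith
    ultimately have "q x = q 0" by (intro harmonic_bounded_above[OF smQ])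
    then show ?thesis by (simp add: q_def)
  qed
  note rot = this
  have "p x = p (of_real (norm x))"
  proof (cases "x = 0")
    case False
    define t where "t = cnj x / norm x"
    have "norm t = 1" "t * x = of_real (norm x)"
      using False by (simp_all add: t_def norm_divide complex_norm_square[symmetric] mult.commute power2_eq_square
          flip: of_real_mult) (metis complex_norm_square mult.commute of_real_power power2_eq_square nonzero_mult_div_cancel_right norm_eq_zero of_real_eq_0_iff of_real_mult)
    then show ?thesis using rot by metis
  qed simp
  then show ?thesis by (simp add: p_def \<psi>_def)
qed

lemma smooth_h: "smooth_on UNIV (\<h> e)"
proof -
  have "\<h> e = (\<lambda>r. \<psi> e r + Re (LD e (axis j0 (of_real r))))"
    by (simp add: \<h>_def fun_eq_iff LD_axis) (simp add: A_def B_def)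
  moreover have "smooth_on UNIV (\<lambda>r. \<psi> e r + Re (LD e (axis j0 (of_real r))))"
    by (rule smooth_on_add[OF open_UNIV smooth_psi smooth_on_linear_compose[OF bounded_linear_Re open_UNIV smooth_axis_line[OF smooth_LD]]])
  ultimately show ?thesis by simp
qed

lemma mixed_ode:
  assumes "r > 0" shows "deriv (deriv (\<h> e)) r + deriv (\<h> e) r / r = - 4 * B e r"
proof -
  have "w1 (w1b (\<lambda>x. F e (axis j0 x) + LD e (axis j0 x))) (of_real r) = - of_real (B e r)"
    unfolding line_hess(1)[OF smooth_on_add[OF open_UNIV smooth_F smooth_LD]] hess_F_LD AB_axis using assms by simp
  moreover have "F e (axis j0 x) + LD e (axis j0 x) = of_real (\<h> e (norm x))" for x
    by (simp add: f_radial LD_axis \<h>_def)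
  ultimately have "complex_of_real ((deriv (deriv (\<h> e)) r + deriv (\<h> e) r / r) / 4) = - of_real (B e r)"
    using w1_radial(2)[OF refl smooth_h assms, of e] by simp
  then have "(deriv (deriv (\<h> e)) r + deriv (\<h> e) r / r) / 4 = - B e r"
    by (metis of_real_eq_iff of_real_minus)
  then show ?thesis by simp
qed

text \<open>The metric is diagonal along the fibre, so the only Christoffel symbol that enters is
  the one with all indices \<open>j0\<close>, the logarithmic derivative of the fibre component. A
  common factor 1 / 4 drops out.\<close>

lemma pure_ode:
  assumes r: "r > 0"
  shows "deriv (deriv (\<psi> e)) r - deriv (\<psi> e) r / r = deriv (B e) r / B e r * deriv (\<psi> e) r"
proof -
  let ?X = "axis j0 (complex_of_real r)" and ?G = "g (ch k e j0)"
  have Fl: "(\<lambda>x. F e (axis j0 x)) = (\<lambda>x. of_real (\<psi> e (norm x)))" by (simp add: f_radial)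
  have 1: "wirt j0 (wirt j0 (F e)) ?X = of_real ((deriv (deriv (\<psi> e)) r - deriv (\<psi> e) r / r) / 4)"
    unfolding line_hess(2)[OF smooth_F, symmetric] Fl by (rule w1_radial(3)[OF refl smooth_psi r])
  have 2: "wirt j0 (F e) ?X = of_real (deriv (\<psi> e) r / 2)"
    using fun_cong[OF line_wirt(1)[OF smooth_F[of e], of j0], of "of_real r"] w1_radial(1)[OF refl smooth_psi r, of e]
    unfolding Fl by simp
  have 3: "wirt j0 (\<lambda>u. ?G u $ j0 $ p) ?X = (if p = j0 then of_real (deriv (B e) r / 2) else 0)" for p
  proof -
    have "wirt j0 (\<lambda>u. ?G u $ j0 $ p) ?X = w1 (\<lambda>x. ?G (axis j0 x) $ j0 $ p) (of_real r)"
      using fun_cong[OF line_wirt(1)[OF smooth_entry[of e j0 j0 p], of j0], of "of_real r"] by simp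
    also have "\<dots> = (if p = j0 then of_real (deriv (B e) r / 2) else 0)"
    proof (cases "p = j0")
      case True
      then show ?thesis using w1_radial(1)[OF refl smooth_AB(2) r, of e] by (simp add: AB_axis)
    next
      case False
      then show ?thesis by (simp add: axis_offdiag has_w1_eqs(1)[OF has_w1_const])
    qed
    finally show ?thesis .
  qed
  have 4: "matrix_inv (?G ?X) $ j0 $ m = (if m = j0 then 1 / of_real (B e r) else 0)" for m
  proof -
    have "(matrix_inv (?G ?X) ** ?G ?X) $ j0 $ m = mat 1 $ j0 $ m"
      using matrix_inv_left[OF invertible_pos_def[OF pos]] by simp
    moreover have "(matrix_inv (?G ?X) ** ?G ?X) $ j0 $ m = matrix_inv (?G ?X) $ j0 $ m * ?G ?X $ m $ m"
      unfolding matrix_matrix_mult_def vec_lambda_beta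
      by (subst sum.remove[of _ m]) (auto simp: axis_offdiag intro!: sum.neutral)
    ultimately have "matrix_inv (?G ?X) $ j0 $ m * ?G ?X $ m $ m = (if m = j0 then 1 else 0)" by (simp add: mat_def)
    moreover have "?G ?X $ m $ m \<noteq> 0"
      using diag_real[of e j0 ?X m] by (metis less_irrefl zero_complex.sel(1))
    moreover have "?G ?X $ j0 $ j0 = of_real (B e r)" using r by (simp add: AB_axis)
    ultimately show ?thesis by (auto simp: field_simps split: if_splits)
  qed
  have ch: "christoffel ?G m j0 j0 ?X = (if m = j0 then of_real (deriv (B e) r / 2) / of_real (B e r) else 0)" for m
    unfolding christoffel_def 3 by (simp add: 4 if_distrib[of "\<lambda>f. _ * f"] cong: if_cong)
  have "(\<Sum>m\<in>UNIV. christoffel ?G m j0 j0 ?X * wirt m (F e) ?X) =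
     of_real (deriv (B e) r / 2) / of_real (B e r) * of_real (deriv (\<psi> e) r / 2)"
    unfolding ch by (simp add: if_distrib[of "\<lambda>f. f * _"] 2 cong: if_cong)
  then have "complex_of_real ((deriv (deriv (\<psi> e)) r - deriv (\<psi> e) r / r) / 4) =
      of_real (deriv (B e) r / 2 / B e r * (deriv (\<psi> e) r / 2))"
    using pure[of e j0 j0 j0 ?X] unfolding hess_pure_def 1 by simp
  then have "(deriv (deriv (\<psi> e)) r - deriv (\<psi> e) r / r) / 4 = deriv (B e) r / 2 / B e r * (deriv (\<psi> e) r / 2)"
    using of_real_eq_iff by blast
  then show ?thesis by simp
qed

text \<open>On the zero section, \<open>f\<close> restricted to a projective line satisfies a Laplace equation solvable only if
  the area of the line is the topologically prescribed one.\<close>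

lemma A_zero: "A e 0 = real CARD('n) - of_int (sg k e)"
proof -
  let ?s = "sg k e" and ?n = "CARD('n)"
  define p where "p = (\<lambda>x. f (ch k e j0 (axis l0 x)))"
  define L where "L = (\<lambda>x::complex. ln (1 + (norm x)\<^sup>2))"
  \<comment> \<open>The multiple of L that f would have to contain on this line; it must vanish
    because L is unbounded there.\<close>
  define \<kappa> where "\<kappa> = real ?n - of_int ?s - A e 0"
  have N: "bnorm j0 (axis l0 x) = 1 + (norm x)\<^sup>2" and W: "wnorm ?s j0 (axis l0 x) = 0" for x :: complex
  proof -
    have "(\<Sum>i\<in>UNIV - {j0}. (norm (axis l0 x $ i))\<^sup>2) = (\<Sum>i\<in>{l0}. (norm (axis l0 x $ i))\<^sup>2)"
      using jl by (intro sum.mono_neutral_right) (auto simp: axis_def)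
    then show "bnorm j0 (axis l0 x) = 1 + (norm x)\<^sup>2" by (simp add: bnorm_def)
    show "wnorm ?s j0 (axis l0 x) = 0" using jl by (simp add: wnorm_def axis_def)
  qed
  have cont: "continuous_on UNIV (\<lambda>x. f (ch k e j (axis l x)))" for j l
  proof -
    have "smooth_on UNIV (\<lambda>x::complex. f (ch k e j (axis l x)))" by (rule smooth_line[OF f_smooth])
    then show ?thesis by (meson UNIV_I continuous_at_imp_continuous_on differentiable_imp_continuous_within smooth_on_differentiable)
  qed
  obtain M where M: "\<And>x. \<bar>p x\<bar> \<le> M"
    using bounded_two_charts[OF cont[of j0 l0] cont[of l0 j0]] ch_axis_move[OF k _ jl] unfolding p_def by metis
  have pos1: "1 + (norm x)\<^sup>2 > 0" for x :: complex by (simp add: add_pos_nonneg)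
  have smL: "smooth_on UNIV (\<lambda>x. complex_of_real (L x))"
  proof -
    have "smooth_on UNIV (\<lambda>u::complex^'n. ln (bnorm j0 u))"
      by (rule smooth_on_compose_real[OF open_UNIV smooth_on_ln smooth_on_bnorm]) (auto simp: bnorm_pos)
    from smooth_on_of_real[OF open_UNIV smooth_line[OF this, of l0]] show ?thesis by (simp add: N L_def)
  qed
  have dL: "w1 (w1b (\<lambda>x. complex_of_real (L x))) x = of_real (1 / (1 + (norm x)\<^sup>2)\<^sup>2)" for x
  proof -
    have nn: "has_w1 (\<lambda>x. complex_of_real (1 + (norm x)\<^sup>2)) (cnj x) x x" for x
      using has_w1_add[OF has_w1_const[of 1] has_w1_mult[OF has_w1_id has_w1_cnj[OF has_w1_id]], of x]
      by (simp add: complex_norm_square del: of_real_power)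
    have "(ln has_real_derivative 1 / (1 + (norm x)\<^sup>2)) (at (1 + (norm x)\<^sup>2))" for x :: complex
      using pos1[of x] by (auto intro!: derivative_eq_intros)
    from has_w1_eqs(2)[OF has_w1_of_real[OF nn this]]
    have wb: "w1b (\<lambda>x. complex_of_real (L x)) = (\<lambda>x. inverse (of_real (1 + (norm x)\<^sup>2)) * x)"
      by (simp add: L_def fun_eq_iff divide_inverse)
    have nz: "complex_of_real (1 + (norm x)\<^sup>2) \<noteq> 0" using pos1[of x] by (metis less_irrefl of_real_eq_0_iff)
    have "w1 (\<lambda>x. inverse (of_real (1 + (norm x)\<^sup>2)) * x) x =
        inverse (of_real (1 + (norm x)\<^sup>2)) * 1 + - cnj x / (of_real (1 + (norm x)\<^sup>2))\<^sup>2 * x"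
      by (rule has_w1_eqs(1)[OF has_w1_mult[OF has_w1_inverse[OF nn nz] has_w1_id]])
    also have "\<dots> = (of_real (1 + (norm x)\<^sup>2) - x * cnj x) / (of_real (1 + (norm x)\<^sup>2))\<^sup>2"
      using nz by (simp add: field_simps power2_eq_square del: of_real_add of_real_power of_real_mult)
    also have "of_real (1 + (norm x)\<^sup>2) - x * cnj x = 1" by (simp add: complex_norm_square del: of_real_power)
    finally show ?thesis unfolding wb by simp
  qed
  define C where "C = ln (A e 0 ^ (?n - 1) * B e 0)"
  have LDl: "LD e (axis l0 x) = of_real (C + (of_int ?s - real ?n) * L x)" for x
  proof -
    have "ln ((1 + (norm x)\<^sup>2) powi m) = of_int m * L x" for m
      using powr_real_of_int'[of "1 + (norm x)\<^sup>2" m] pos1[of x] unfolding L_def by (metis less_imp_le ln_powr less_irrefl)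
    then show ?thesis unfolding LD_eq N W
      using a_pos[of e 0] b_pos[of e 0] pos1[of x] by (subst ln_mult) (simp_all add: C_def A_def B_def)
  qed
  have gl: "g (ch k e j0) (axis l0 x) $ l0 $ l0 = of_real (A e 0 / (1 + (norm x)\<^sup>2)\<^sup>2)" for x
  proof -
    have nz: "complex_of_real (1 + (norm x)\<^sup>2) \<noteq> 0" using pos1[of x] by (metis less_irrefl of_real_eq_0_iff)
    have xj: "axis l0 x $ j0 = 0" "axis l0 x $ l0 = x" using jl by (simp_all add: axis_def)
    have "fsc j0 (axis l0 x) l0 l0 = 1 / of_real (1 + (norm x)\<^sup>2) - cnj x / of_real (1 + (norm x)\<^sup>2) * (x / of_real (1 + (norm x)\<^sup>2))"
      using jl unfolding fsc_def nuc_def N xj by simp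
    also have "\<dots> = (of_real (1 + (norm x)\<^sup>2) - x * cnj x) / (of_real (1 + (norm x)\<^sup>2))\<^sup>2"
      using nz by (simp add: field_simps power2_eq_square del: of_real_add of_real_power of_real_mult)
    also have "of_real (1 + (norm x)\<^sup>2) - x * cnj x = 1" by (simp add: complex_norm_square del: of_real_power)
    finally show ?thesis unfolding radial_form W mmat_def using jl xj by (simp add: xic_def A_def)
  qed
  define H where "H = (\<lambda>x. F e (axis l0 x) + LD e (axis l0 x))"
  have smH: "smooth_on UNIV H"
    unfolding H_def by (rule smooth_line[OF smooth_on_add[OF open_UNIV smooth_F smooth_LD]])
  have hH: "w1 (w1b H) x = - of_real (A e 0 / (1 + (norm x)\<^sup>2)\<^sup>2)" for x
    unfolding H_def line_hess(1)[OF smooth_on_add[OF open_UNIV smooth_F smooth_LD]] hess_F_LD gl ..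
  \<comment> \<open>p - \<kappa> L is harmonic: f + log det and - g contribute multiples of the same
    second derivative of L. The sign \<sigma> permits a bound from either side, according to the
    sign of \<kappa>.\<close>
  have key: "p x - \<kappa> * L x = p 0" if M': "\<And>x. \<sigma> * (p x - \<kappa> * L x) \<le> M'" and \<sigma>: "\<sigma> \<noteq> 0" for \<sigma> M' x
  proof -
    define q where "q = (\<lambda>x. \<sigma> * (p x - \<kappa> * L x))"
    have Q: "complex_of_real (q x) = of_real \<sigma> * (H x + of_real (A e 0) * of_real (L x)) + - of_real (\<sigma> * C)" for x
      by (simp add: q_def H_def LDl p_def \<kappa>_def algebra_simps)
    have smQ: "smooth_on UNIV (\<lambda>x. complex_of_real (q x))"
      unfolding Q by (intro smooth_on_add smooth_on_mult open_UNIV smooth_on_const smH smL)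
    have W1: "has_w1 G (w1 G x) (w1b G x) x" if "smooth_on UNIV G" for G x
      by (rule has_w1I[OF smooth_on_differentiable[OF that UNIV_I]])
    have "w1b (\<lambda>x. complex_of_real (q x)) = (\<lambda>x. of_real \<sigma> * (w1b H x + of_real (A e 0) * w1b (\<lambda>x. complex_of_real (L x)) x))"
      unfolding Q
      by (rule ext)
         (simp only: has_w1_eqs(2)[OF has_w1_add[OF has_w1_mult[OF has_w1_const has_w1_add[OF W1[OF smH] has_w1_mult[OF has_w1_const W1[OF smL]]]] has_w1_const]]
          mult_zero_left add_0_right)
    moreover have "w1 (\<lambda>x. of_real \<sigma> * (w1b H x + of_real (A e 0) * w1b (\<lambda>x. complex_of_real (L x)) x)) x =
       of_real \<sigma> * (w1 (w1b H) x + of_real (A e 0) * w1 (w1b (\<lambda>x. complex_of_real (L x))) x)" for x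
      using has_w1_eqs(1)[OF has_w1_mult[OF has_w1_const has_w1_add[OF W1[OF smooth_on_w1(2)[OF smH]]
          has_w1_mult[OF has_w1_const W1[OF smooth_on_w1(2)[OF smL]]]]]] by simp
    ultimately have "w1 (w1b (\<lambda>x. complex_of_real (q x))) x = 0" for x
      by (simp add: hH dL)
    then have "q x = q 0" using M' by (intro harmonic_bounded_above[OF smQ]) (auto simp: q_def)
    then show ?thesis using \<sigma> by (simp add: q_def L_def)
  qed
  have L0: "L x \<ge> 0" for x by (simp add: L_def)
  have "p x - \<kappa> * L x = p 0" for x
  proof (cases "\<kappa> \<ge> 0")
    case True
    show ?thesis
    proof (rule key[of 1 M])
      fix x show "1 * (p x - \<kappa> * L x) \<le> M"
        unfolding mult_1_left using M[of x] mult_nonneg_nonneg[OF True L0[of x]] by (simp add: abs_le_iff)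
    qed simp
  next
    case False
    show ?thesis
    proof (rule key[of "- 1" M])
      fix x
      have "(- \<kappa>) * L x \<ge> 0" using False L0[of x] by (intro mult_nonneg_nonneg) auto
      then show "- 1 * (p x - \<kappa> * L x) \<le> M" using M[of x] by simp
    qed simp
  qed
  then have bd: "\<bar>\<kappa> * L x\<bar> \<le> 2 * M" for x using M[of x] M[of 0] by (smt (verit))
  have "\<kappa> = 0"
  proof (rule ccontr)
    assume "\<kappa> \<noteq> 0"
    \<comment> \<open>The point below has L = y, so |\<kappa>| L is 2 M + 1 there and exceeds the
      bound 2 M.\<close>
    define y where "y = (2 * M + 1) / \<bar>\<kappa>\<bar>"
    have y: "y \<ge> 0" using M[of 0] by (simp add: y_def)
    have "L (of_real (sqrt (exp y - 1))) = y" using y by (simp add: L_def)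
    then have "\<bar>\<kappa> * L (of_real (sqrt (exp y - 1)))\<bar> = \<bar>\<kappa>\<bar> * y" using y by (simp add: abs_mult)
    also have "\<dots> = 2 * M + 1" using \<open>\<kappa> \<noteq> 0\<close> by (simp add: y_def)
    finally show False using bd[of "of_real (sqrt (exp y - 1))"] by simp
  qed
  then show ?thesis by (simp add: \<kappa>_def)
qed

end

section \<open>Integration of the equation\<close>

lemma constant_on_ray:
  fixes G :: "real \<Rightarrow> real"
  assumes "continuous_on {0..} G" "\<And>r. r > 0 \<Longrightarrow> (G has_real_derivative 0) (at r)" "r \<ge> 0"
  shows "G r = G 0"
  by (rule DERIV_isconst2[of 0 "r + 1"]) (use assms in \<open>auto intro: continuous_on_subset\<close>)

lemma constant_on_open_ray:
  fixes G :: "real \<Rightarrow> real"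
  assumes "\<And>r. r > 0 \<Longrightarrow> (G has_real_derivative 0) (at r)"
  shows "\<exists>C. \<forall>r>0. G r = C"
proof -
  have "\<exists>C. \<forall>r\<in>{0<..}. G r = C"
    by (rule has_field_derivative_zero_constant) (use assms in \<open>auto intro: has_field_derivative_at_within\<close>)
  then show ?thesis by auto
qed

lemma isCont_zero_limit:
  fixes G :: "real \<Rightarrow> real"
  assumes "isCont G 0" "\<And>u. u > 0 \<Longrightarrow> G u = 0"
  shows "G 0 = 0"
proof -
  have "(G \<longlongrightarrow> G 0) (at_right 0)" using assms(1) unfolding isCont_def by (rule tendsto_mono[rotated]) (simp add: at_le)
  moreover have "(G \<longlongrightarrow> 0) (at_right 0)"
    by (rule tendsto_eventually) (auto simp: eventually_at_right_less intro!: eventually_mono[OF eventually_at_right_less[of 0]] assms(2))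
  ultimately show ?thesis by (rule tendsto_unique[rotated]) simp
qed

lemma moment_primitive:
  obtains P where "\<And>x. (P has_real_derivative (real n - x) * x ^ (n - 1) * exp (c * x)) (at x)"
proof -
  have "\<exists>P. \<forall>x. (- \<infinity> :: ereal) < x \<longrightarrow> x < \<infinity> \<longrightarrow>
      (P has_vector_derivative (real n - x) * x ^ (n - 1) * exp (c * x)) (at x)"
    by (rule einterval_antiderivative) (auto intro!: continuous_intros)
  then show ?thesis using that by (auto simp: has_real_derivative_iff_has_vector_derivative)
qed

context invariant_soliton
begin

lemma D_A: "(A e has_real_derivative deriv (A e) r) (at r)"
  and D_B: "(B e has_real_derivative deriv (B e) r) (at r)"
  and D_psi: "(\<psi> e has_real_derivative deriv (\<psi> e) r) (at r)"
  and D_psi2: "(deriv (\<psi> e) has_real_derivative deriv (deriv (\<psi> e)) r) (at r)"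
  and D_h2: "(deriv (\<h> e) has_real_derivative deriv (deriv (\<h> e)) r) (at r)"
  using smooth_on_real_deriv(2)[OF _ open_UNIV UNIV_I] smooth_on_real_deriv(1)[OF _ open_UNIV] smooth_AB smooth_psi smooth_h
  by blast+

lemma cont_AB: "continuous_on S (A e)" "continuous_on S (B e)" "isCont (A e) r" "isCont (B e) r"
  using DERIV_isCont[OF D_A] DERIV_isCont[OF D_B] by (auto intro: continuous_at_imp_continuous_on)

lemma deriv_h: "deriv (\<h> e) r = deriv (\<psi> e) r + ((real CARD('n) - 1) * (deriv (A e) r / A e r) + deriv (B e) r / B e r)"
proof (rule DERIV_imp_deriv)
  let ?n = "CARD('n)"
  have "\<h> e = (\<lambda>r. \<psi> e r + ((real ?n - 1) * ln (A e r) + ln (B e r)))"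
  proof
    fix r
    have "ln (A e r ^ (?n - 1) * B e r) = real (?n - 1) * ln (A e r) + ln (B e r)"
      using AB_pos[of e r] by (simp add: ln_mult ln_realpow)
    moreover have "real (?n - 1) = real ?n - 1" by (simp add: of_nat_diff)
    ultimately show "\<h> e r = \<psi> e r + ((real ?n - 1) * ln (A e r) + ln (B e r))" by (simp add: \<h>_def)
  qed
  then show "(\<h> e has_real_derivative deriv (\<psi> e) r + ((real ?n - 1) * (deriv (A e) r / A e r) + deriv (B e) r / B e r)) (at r)"
    using AB_pos[of e r] by (auto intro!: derivative_eq_intros D_A D_B D_psi)
qed

text \<open>\<open>pure_ode\<close> says that \<psi>' / (r B) is constant, and A' is a multiple of r
  B by \<open>A_deriv\<close>. It is the radial form of the gradient field being a multiple of the
  Euler field.\<close>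

lemma psi_A: obtains c where "\<And>r. r > 0 \<Longrightarrow> deriv (\<psi> e) r = c * deriv (A e) r"
proof -
  have "((\<lambda>r. deriv (\<psi> e) r / (r * B e r)) has_real_derivative 0) (at r)" if r: "r > 0" for r
  proof -
    have B: "B e r > 0" by (rule AB_pos)
    have "((\<lambda>r. deriv (\<psi> e) r / (r * B e r)) has_real_derivative
      (deriv (deriv (\<psi> e)) r * (r * B e r) - deriv (\<psi> e) r * (B e r + r * deriv (B e) r)) / ((r * B e r) * (r * B e r))) (at r)"
      using r B by (auto intro!: derivative_eq_intros D_psi2 D_B simp: algebra_simps)
    moreover have "deriv (deriv (\<psi> e)) r = deriv (\<psi> e) r / r + deriv (B e) r / B e r * deriv (\<psi> e) r"
      using pure_ode[OF r, of e] by linarith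
    then have "deriv (deriv (\<psi> e)) r * (r * B e r) - deriv (\<psi> e) r * (B e r + r * deriv (B e) r) = 0"
      using r B by (simp add: field_simps)
    ultimately show ?thesis by simp
  qed
  from constant_on_open_ray[OF this] obtain C where C: "\<And>r. r > 0 \<Longrightarrow> deriv (\<psi> e) r / (r * B e r) = C"
    by blast
  have "deriv (\<psi> e) r = C / (2 * of_int (sg k e)) * deriv (A e) r" if r: "r > 0" for r
    using C[OF r] A_deriv[OF r, of e] AB_pos(2)[of e r] r sg_nz[OF k, of e] by (simp add: field_simps)
  then show ?thesis by (rule that)
qed

text \<open>After multiplication by r, \<open>mixed_ode\<close> equates the derivative of r times
  the derivative of \<open>\<h>\<close> with that of - (2 / s) A, by \<open>A_deriv\<close>. The
  constant is given by \<open>A_zero\<close> at r = 0.\<close>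

lemma first_integral:
  assumes r: "r > 0"
  shows "r * deriv (\<h> e) r = 2 / of_int (sg k e) * (real CARD('n) - of_int (sg k e) - A e r)"
proof -
  let ?s = "real_of_int (sg k e)"
  have s: "?s \<noteq> 0" using sg_nz[OF k, of e] by simp
  define G where "G = (\<lambda>r. r * deriv (\<h> e) r + 2 / ?s * A e r)"
  have "G r = G 0"
  proof (rule constant_on_ray)
    show "continuous_on {0..} G"
      unfolding G_def using DERIV_isCont[OF D_h2] cont_AB
      by (intro continuous_intros) (auto intro: continuous_at_imp_continuous_on)
    fix r :: real assume r: "r > 0"
    have "(G has_real_derivative (deriv (\<h> e) r + r * deriv (deriv (\<h> e)) r + 2 / ?s * deriv (A e) r)) (at r)"
      unfolding G_def using s by (auto intro!: derivative_eq_intros D_h2 D_A)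
    moreover have "deriv (\<h> e) r + r * deriv (deriv (\<h> e)) r = r * (deriv (deriv (\<h> e)) r + deriv (\<h> e) r / r)"
      using r by (simp add: field_simps)
    ultimately show "(G has_real_derivative 0) (at r)"
      using mixed_ode[OF r, of e] A_deriv[OF r, of e] s by simp
  qed (use r in simp)
  then show ?thesis using s by (simp add: G_def A_zero field_simps)
qed

text \<open>By \<open>first_integral\<close>, Y = A^(n-1) exp (c A) r^2 B has logarithmic derivative
  2 (n - A) / (s r). With A' = 2 s r B this gives s^2 Y' = P'(A) A', and s^2 = k^2. The constant is
  found at r = 0, where Y vanishes.\<close>

lemma second_integral:
  assumes c: "\<And>r. r > 0 \<Longrightarrow> deriv (\<psi> e) r = c * deriv (A e) r"
    and P: "\<And>x. (P has_real_derivative (real CARD('n) - x) * x ^ (CARD('n) - 1) * exp (c * x)) (at x)"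
    and r: "r \<ge> 0"
  shows "(real k)\<^sup>2 * (A e r ^ (CARD('n) - 1) * exp (c * A e r) * (r\<^sup>2 * B e r)) =
    P (A e r) - P (real CARD('n) - of_int (sg k e))"
proof -
  let ?s = "real_of_int (sg k e)" and ?n = "CARD('n)"
  have s: "?s \<noteq> 0" "(real k)\<^sup>2 = ?s * ?s" using sg_nz[OF k, of e] by (auto simp: sg_def power2_eq_square)
  define G where "G = (\<lambda>r. (real k)\<^sup>2 * (A e r ^ (?n - 1) * exp (c * A e r) * (r\<^sup>2 * B e r)) - P (A e r))"
  have "G r = G 0"
  proof (rule constant_on_ray[OF _ _ r])
    have "continuous_on {0..} (\<lambda>r. P (A e r))"
      by (intro continuous_at_imp_continuous_on ballI DERIV_isCont[OF DERIV_chain2[OF P D_A]])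
    then show "continuous_on {0..} G" unfolding G_def by (intro continuous_intros cont_AB)
    fix r :: real assume r: "r > 0"
    define Y where "Y = A e r ^ (?n - 1) * exp (c * A e r) * (r\<^sup>2 * B e r)"
    define Y' where "Y' = Y * ((real ?n - 1) * (deriv (A e) r / A e r) + c * deriv (A e) r + 2 / r + deriv (B e) r / B e r)"
    have AB: "A e r > 0" "B e r > 0" by (rule AB_pos)+
    \<comment> \<open>Writing Y as the exponential of a sum of logarithms yields its logarithmic
      derivative directly.\<close>
    have "((\<lambda>r. exp ((real ?n - 1) * ln (A e r) + c * A e r + 2 * ln r + ln (B e r))) has_real_derivative
        exp ((real ?n - 1) * ln (A e r) + c * A e r + 2 * ln r + ln (B e r)) *
        ((real ?n - 1) * (deriv (A e) r / A e r) + c * deriv (A e) r + 2 / r + deriv (B e) r / B e r)) (at r)"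
      using r AB by (auto intro!: derivative_eq_intros D_A D_B)
    moreover have ex: "exp ((real ?n - 1) * ln (A e x) + c * A e x + 2 * ln x + ln (B e x)) =
        A e x ^ (?n - 1) * exp (c * A e x) * (x\<^sup>2 * B e x)" if "x > 0" for x
    proof -
      have "exp ((real ?n - 1) * ln (A e x)) = A e x ^ (?n - 1)"
        using exp_of_nat_mult[of "?n - 1" "ln (A e x)"] AB_pos(1)[of e x] by (simp add: of_nat_diff)
      moreover have "exp (2 * ln x) = x\<^sup>2" using exp_of_nat_mult[of 2 "ln x"] that by simp
      ultimately show ?thesis using AB_pos(2)[of e x] by (simp add: exp_add)
    qed
    ultimately have "((\<lambda>r. exp ((real ?n - 1) * ln (A e r) + c * A e r + 2 * ln r + ln (B e r))) has_real_derivative Y') (at r)"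
      unfolding Y'_def Y_def ex[OF r] by simp
    then have dY: "((\<lambda>r. A e r ^ (?n - 1) * exp (c * A e r) * (r\<^sup>2 * B e r)) has_real_derivative Y') (at r)"
      by (rule has_field_derivative_transform_within_open[OF _ open_greaterThan[of 0]]) (use r ex in auto)
    have "r * ((real ?n - 1) * (deriv (A e) r / A e r) + c * deriv (A e) r + 2 / r + deriv (B e) r / B e r) =
        r * deriv (\<h> e) r + 2"
      unfolding deriv_h c[OF r] using r by (simp add: field_simps)
    also have "\<dots> = 2 / ?s * (real ?n - A e r)"
      unfolding first_integral[OF r] using s by (simp add: field_simps)
    finally have "r * Y' = Y * (2 / ?s * (real ?n - A e r))" unfolding Y'_def by (simp add: mult.left_commute)
    moreover have "?s * ?s * (Y * (2 / ?s * (real ?n - A e r))) = 2 * ?s * (Y * (real ?n - A e r))" using s by simp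
    ultimately have "?s * ?s * (r * Y') = 2 * ?s * (Y * (real ?n - A e r))" by simp
    then have "r * ((real k)\<^sup>2 * Y') = r * ((real ?n - A e r) * A e r ^ (?n - 1) * exp (c * A e r) * deriv (A e) r)"
      unfolding Y_def A_deriv[OF r] s(2) by (simp add: algebra_simps power2_eq_square)
    then have "(real k)\<^sup>2 * Y' = (real ?n - A e r) * A e r ^ (?n - 1) * exp (c * A e r) * deriv (A e) r"
      using r by simp
    then show "(G has_real_derivative 0) (at r)"
      using DERIV_diff[OF DERIV_cmult[OF dY, of "(real k)\<^sup>2"] DERIV_chain2[OF P D_A[of e]]] by (simp add: G_def)
  qed
  then show ?thesis by (simp add: G_def A_zero)
qed

lemma A_opp: "r > 0 \<Longrightarrow> A (\<not> e) (1 / r) = A e r"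
  and B_opp: "r > 0 \<Longrightarrow> B (\<not> e) (1 / r) = r ^ 4 * B e r"
  using opp[of "r\<^sup>2" e] by (simp_all add: A_def B_def power_divide power2_eq_square eval_nat_numeral mult.assoc)

text \<open>The integral identity for the zero section, rewritten by inversion in the radius u
  around the infinity section, extends to u = 0 by continuity. There the left side vanishes and the
  momentum is n + k, so P agrees at n - k and n + k. The identity is stated for all primitives so
  that a single P can serve two metrics.\<close>

lemma soliton_constant:
  assumes kn: "k < CARD('n)"
  obtains c where "moment CARD('n) k c = 0"
    "\<And>P r. (\<And>x. (P has_real_derivative (real CARD('n) - x) * x ^ (CARD('n) - 1) * exp (c * x)) (at x)) \<Longrightarrow> r \<ge> 0 \<Longrightarrow>
      (real k)\<^sup>2 * (A True r ^ (CARD('n) - 1) * exp (c * A True r) * (r\<^sup>2 * B True r)) = P (A True r) - P (real CARD('n) - k)"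
proof -
  let ?n = "CARD('n)"
  obtain c where c: "\<And>r. r > 0 \<Longrightarrow> deriv (\<psi> True) r = c * deriv (A True) r" using psi_A by blast
  have I: "(real k)\<^sup>2 * (A True r ^ (?n - 1) * exp (c * A True r) * (r\<^sup>2 * B True r)) = P (A True r) - P (real ?n - k)"
    if "\<And>x. (P has_real_derivative (real ?n - x) * x ^ (?n - 1) * exp (c * x)) (at x)" "r \<ge> 0" for P r
    using second_integral[OF c that] by (simp add: sg_def)
  obtain P where P: "\<And>x. (P has_real_derivative (real ?n - x) * x ^ (?n - 1) * exp (c * x)) (at x)"
    using moment_primitive by blast
  define G where "G = (\<lambda>u. (real k)\<^sup>2 * (A False u ^ (?n - 1) * exp (c * A False u) * (u\<^sup>2 * B False u)) - (P (A False u) - P (real ?n - k)))"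
  have "G 0 = 0"
  proof (rule isCont_zero_limit)
    have "isCont (\<lambda>u. P (A False u)) 0" by (rule DERIV_isCont[OF DERIV_chain2[OF P D_A]])
    then show "isCont G 0" unfolding G_def by (intro continuous_intros cont_AB)
    fix u :: real assume u: "u > 0"
    have "A False u = A True (1 / u)" "u\<^sup>2 * B False u = (1 / u)\<^sup>2 * B True (1 / u)"
      using A_opp[of "1 / u" True] B_opp[of "1 / u" True] u by (simp_all add: field_simps power2_eq_square eval_nat_numeral)
    then show "G u = 0" using I[OF P, of "1 / u"] u by (simp add: G_def)
  qed
  then have "P (real ?n + k) = P (real ?n - k)" by (simp add: G_def A_zero sg_def)
  then have "moment ?n k c = 0" using moment_eq_0_iff[OF kn, of P c] P by blast
  then show ?thesis using that I by blast
qed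

section \<open>The range of the momentum and the comparison of two solitons\<close>

lemma A_range:
  assumes "r > 0" shows "real CARD('n) - k < A True r" "A True r < real CARD('n) + k"
proof -
  have "A True 0 < A True r"
  proof (rule DERIV_pos_imp_increasing_open[where f = "A True", OF assms])
    fix x :: real assume "0 < x"
    then have "deriv (A True) x > 0" using A_deriv[of x True] AB_pos(2)[of True x] k by (simp add: sg_def)
    then show "\<exists>y. (A True has_real_derivative y) (at x) \<and> 0 < y" using D_A by blast
  qed (rule cont_AB)
  then show "real CARD('n) - k < A True r" by (simp add: A_zero sg_def)
  have "A False 0 > A False (1 / r)"
  proof (rule DERIV_neg_imp_decreasing_open[where f = "A False"])
    show "0 < 1 / r" using assms by simp
    fix x :: real assume "0 < x"
    then have "deriv (A False) x < 0" using A_deriv[of x False] AB_pos(2)[of False x] k by (simp add: sg_def)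
    then show "\<exists>y. (A False has_real_derivative y) (at x) \<and> y < 0" using D_A by blast
  qed (rule cont_AB)
  then show "A True r < real CARD('n) + k" using A_opp[OF assms, of True] by (simp add: A_zero sg_def)
qed

text \<open>\<open>A True\<close> starts at n - k; far out its values are those of
  \<open>A False\<close> near 0, which come close to n + k. The intermediate value theorem fills the
  gap.\<close>

lemma A_onto:
  assumes "real CARD('n) - k < x" "x < real CARD('n) + k"
  obtains r where "r > 0" "A True r = x"
proof -
  have "\<exists>d>0. \<forall>u. \<bar>u - 0\<bar> < d \<longrightarrow> \<bar>A False u - A False 0\<bar> < real CARD('n) + k - x"
    using cont_AB(3)[of 0 False] assms(2) unfolding continuous_at_eps_delta dist_real_def
    by (metis diff_gt_0_iff_gt)
  then obtain d where d: "d > 0" "\<And>u. \<bar>u\<bar> < d \<Longrightarrow> \<bar>A False u - (real CARD('n) + k)\<bar> < real CARD('n) + k - x"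
    by (auto simp: A_zero sg_def)
  define u where "u = d / 2"
  have u: "u > 0" "A False u > x" using d(2)[of u] d(1) by (auto simp: u_def)
  then have "A True (1 / u) > x" using A_opp[of "1 / u" True] by simp
  then have "\<exists>r\<ge>0. r \<le> 1 / u \<and> A True r = x"
    using u assms cont_AB(3) by (intro IVT) (auto simp: A_zero sg_def)
  then obtain r where r: "r \<ge> 0" "A True r = x" by blast
  then have "r \<noteq> 0" using assms by (auto simp: A_zero sg_def)
  then have "r > 0" using r(1) by simp
  then show ?thesis using r(2) by (rule that)
qed

end

text \<open>\<open>moment\<close> has only one zero, so both metrics share c and the function F with
  k^2 r^2 B = F(A). For a primitive Q of 1 / F, the difference Q(A) - (2 / k) log r is constant by
  \<open>A_deriv\<close>. As Q is injective, the two momenta differ by a translation in log r, and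
  \<theta> is read off from the two constants.\<close>

lemma solitons_rescaled:
  fixes g h :: "('n::finite, 'n piece_point set) tensor_field"
  assumes "invariant_soliton k g j0 l0 f" "invariant_soliton k h j0 l0 f'" and kn: "k < CARD('n)"
  defines "Ag \<equiv> invariant_metric.A k g j0 l0" and "Bg \<equiv> invariant_metric.B k g j0"
    and "Ah \<equiv> invariant_metric.A k h j0 l0" and "Bh \<equiv> invariant_metric.B k h j0"
  obtains \<theta> where "\<theta> > 0" "\<And>r. r > 0 \<Longrightarrow> Ah True r = Ag True (\<theta> * r)" "\<And>r. r > 0 \<Longrightarrow> Bh True r = \<theta>\<^sup>2 * Bg True (\<theta> * r)"
proof -
  interpret G: invariant_soliton k g j0 l0 f by fact
  interpret H: invariant_soliton k h j0 l0 f' by fact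
  let ?n = "CARD('n)"
  define a where "a = real ?n - k"
  define b where "b = real ?n + k"
  have k: "k \<ge> 1" by (rule G.k)
  have ab: "0 < a" "a < b" using k kn by (auto simp: a_def b_def)
  obtain c where c: "moment ?n k c = 0" and Ig: "\<And>P r. (\<And>x. (P has_real_derivative (real ?n - x) * x ^ (?n - 1) * exp (c * x)) (at x)) \<Longrightarrow> r \<ge> 0 \<Longrightarrow>
      (real k)\<^sup>2 * (Ag True r ^ (?n - 1) * exp (c * Ag True r) * (r\<^sup>2 * Bg True r)) = P (Ag True r) - P a"
    using G.soliton_constant[OF kn] unfolding Ag_def Bg_def a_def by blast
  obtain c' where c': "moment ?n k c' = 0" and Ih': "\<And>P r. (\<And>x. (P has_real_derivative (real ?n - x) * x ^ (?n - 1) * exp (c' * x)) (at x)) \<Longrightarrow> r \<ge> 0 \<Longrightarrow>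
      (real k)\<^sup>2 * (Ah True r ^ (?n - 1) * exp (c' * Ah True r) * (r\<^sup>2 * Bh True r)) = P (Ah True r) - P a"
    using H.soliton_constant[OF kn] unfolding Ah_def Bh_def a_def by blast
  have cc: "c' = c"
    using moment_strict[OF k kn, of c c'] moment_strict[OF k kn, of c' c] c c' by (cases c c' rule: linorder_cases) auto
  note Ih = Ih'[unfolded cc]
  obtain P where P: "\<And>x. (P has_real_derivative (real ?n - x) * x ^ (?n - 1) * exp (c * x)) (at x)"
    using moment_primitive by blast
  define F where "F = (\<lambda>x. (P x - P a) / (x ^ (?n - 1) * exp (c * x)))"
  have Fg: "(real k)\<^sup>2 * (r\<^sup>2 * Bg True r) = F (Ag True r)" and Fh: "(real k)\<^sup>2 * (r\<^sup>2 * Bh True r) = F (Ah True r)" if "r > 0" for r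
  proof -
    have "Ag True r > 0" "Ah True r > 0" using G.AB_pos H.AB_pos by (simp_all add: Ag_def Ah_def)
    then show "(real k)\<^sup>2 * (r\<^sup>2 * Bg True r) = F (Ag True r)" "(real k)\<^sup>2 * (r\<^sup>2 * Bh True r) = F (Ah True r)"
      unfolding F_def using Ig[OF P, of r] Ih[OF P, of r] that by (simp_all add: field_simps)
  qed
  \<comment> \<open>Every value in the open interval is attained by the momentum of
    \<open>g\<close>, and there F is a positive multiple of the fibre component.\<close>
  have Fpos: "F x > 0" if x: "a < x" "x < b" for x
  proof -
    obtain r where "r > 0" "Ag True r = x" unfolding Ag_def by (rule G.A_onto[of x]) (use x in \<open>auto simp: a_def b_def\<close>)
    moreover have "Bg True r > 0" using G.AB_pos by (simp add: Bg_def)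
    ultimately show ?thesis using Fg[of r] k by (metis mult_pos_pos of_nat_0_less_iff less_le_trans zero_less_one zero_less_power)
  qed
  have "isCont (\<lambda>x. 1 / F x) x" if "a < x" "x < b" for x
  proof -
    have "isCont P x" by (rule DERIV_isCont[OF P])
    then have "isCont F x" unfolding F_def using that ab by (intro continuous_intros) auto
    then show ?thesis using Fpos[OF that] by (intro continuous_intros) auto
  qed
  then have "\<exists>Q. \<forall>x. ereal a < x \<longrightarrow> x < ereal b \<longrightarrow> (Q has_vector_derivative 1 / F x) (at x)"
    using ab by (intro einterval_antiderivative) auto
  then obtain Q where Q: "\<And>x. a < x \<Longrightarrow> x < b \<Longrightarrow> (Q has_real_derivative 1 / F x) (at x)"
    by (auto simp: has_real_derivative_iff_has_vector_derivative)
  have Qinj: "x = y" if "a < x" "x < b" "a < y" "y < b" "Q x = Q y" for x y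
  proof -
    have inc: "Q x < Q y" if "a < x" "y < b" "x < y" for x y
    proof (rule DERIV_pos_imp_increasing[OF that(3)])
      fix z assume "x \<le> z" "z \<le> y"
      then have "a < z" "z < b" using that by auto
      then show "\<exists>d. (Q has_real_derivative d) (at z) \<and> 0 < d" using Q Fpos by (meson divide_pos_pos zero_less_one)
    qed
    show ?thesis using inc[of x y] inc[of y x] that by (cases x y rule: linorder_cases) auto
  qed
  have rng: "a < Ag True r" "Ag True r < b" "a < Ah True r" "Ah True r < b" if "r > 0" for r
    using G.A_range[OF that] H.A_range[OF that] by (simp_all add: a_def b_def Ag_def Ah_def)
  have const: "\<exists>C. \<forall>r>0. Q (X r) - 2 / k * ln r = C"
    if X: "\<And>r. r > 0 \<Longrightarrow> (X has_real_derivative 2 * real k * r * Y r) (at r)"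
      and XY: "\<And>r. r > 0 \<Longrightarrow> (real k)\<^sup>2 * (r\<^sup>2 * Y r) = F (X r)" and R: "\<And>r. r > 0 \<Longrightarrow> a < X r \<and> X r < b" for X Y
  proof -
    have "((\<lambda>r. Q (X r) - 2 / k * ln r) has_real_derivative 0) (at r)" if r: "r > 0" for r
    proof -
      have Fp: "F (X r) > 0" using Fpos R[OF r] by blast
      have "((\<lambda>r. Q (X r)) has_real_derivative 1 / F (X r) * (2 * real k * r * Y r)) (at r)"
        by (rule DERIV_chain2[OF _ X[OF r]]) (use Q R[OF r] in blast)
      then have "((\<lambda>r. Q (X r) - 2 / k * ln r) has_real_derivative 1 / F (X r) * (2 * real k * r * Y r) - 2 / k * (1 / r)) (at r)"
        using r k by (intro derivative_intros) (auto intro!: derivative_eq_intros)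
      moreover have "1 / F (X r) * (2 * real k * r * Y r) = 2 / k * (1 / r)"
      proof -
        have "Y r \<noteq> 0" using Fp XY[OF r] by auto
        then show ?thesis unfolding XY[OF r, symmetric] using r k by (simp add: field_simps power2_eq_square)
      qed
      ultimately show ?thesis by simp
    qed
    from constant_on_open_ray[OF this] show ?thesis by blast
  qed
  have dA: "(Ag True has_real_derivative 2 * real k * r * Bg True r) (at r)" "(Ah True has_real_derivative 2 * real k * r * Bh True r) (at r)" if "r > 0" for r
    using G.D_A[of True r] H.D_A[of True r] G.A_deriv[OF that, of True] H.A_deriv[OF that, of True]
    by (simp_all add: sg_def Ag_def Bg_def Ah_def Bh_def)
  obtain C where C: "\<And>r. r > 0 \<Longrightarrow> Q (Ag True r) - 2 / k * ln r = C"
    using const[OF dA(1) Fg] rng by blast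
  obtain C' where C': "\<And>r. r > 0 \<Longrightarrow> Q (Ah True r) - 2 / k * ln r = C'"
    using const[OF dA(2) Fh] rng by blast
  define \<theta> where "\<theta> = exp (k * (C' - C) / 2)"
  have l: "\<theta> > 0" "2 / k * ln \<theta> = C' - C" using k by (simp_all add: \<theta>_def)
  have AA: "Ah True r = Ag True (\<theta> * r)" if r: "r > 0" for r
  proof (rule Qinj)
    have "2 / k * ln (\<theta> * r) = (C' - C) + 2 / k * ln r"
      using l r by (simp add: ln_mult distrib_left)
    then show "Q (Ah True r) = Q (Ag True (\<theta> * r))" using C[of "\<theta> * r"] C'[OF r] l r by simp
  qed (use rng[OF r] rng[of "\<theta> * r"] l r in auto)
  moreover have "Bh True r = \<theta>\<^sup>2 * Bg True (\<theta> * r)" if r: "r > 0" for r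
  proof -
    have "(real k)\<^sup>2 * (r\<^sup>2 * Bh True r) = (real k)\<^sup>2 * ((\<theta> * r)\<^sup>2 * Bg True (\<theta> * r))"
      using Fh[OF r] Fg[of "\<theta> * r"] AA[OF r] l r by simp
    then show ?thesis using r k by (simp add: power_mult_distrib)
  qed
  ultimately show ?thesis using that l by blast
qed

section \<open>Scalar automorphisms\<close>

abbreviation scalar_matrix :: "complex \<Rightarrow> complex^'n::finite^'n" where "scalar_matrix m \<equiv> diag_matrix (\<lambda>_. m)"

lemma scalar_apply: "scalar_matrix m *v z = m *s z"
  by (simp add: vec_eq_iff diag_matrix_apply)

lemma similarity_scalar: "m \<noteq> 0 \<Longrightarrow> similarity (scalar_matrix m) ((norm m)\<^sup>2)"
  by (simp add: similarity_def scalar_apply herm_scale complex_norm_square del: of_real_power)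

text \<open>A scalar matrix fixes the base and multiplies the fibre coordinate by a power of m, its
  degree being the exponent; so it acts linearly in each chart.\<close>

lemma act_scalar_ch:
  assumes "k \<ge> 1" "m \<noteq> 0"
  shows "Mk_act k (scalar_matrix m) (ch k e j x) = ch k e j (diag_matrix (\<lambda>i. if i = j then m powi sg k e else 1) *v x)"
proof -
  have "Tmap (sg k e) (sg k e) j j (scalar_matrix m) x = diag_matrix (\<lambda>i. if i = j then m powi sg k e else 1) *v x"
    using assms(2) by (simp add: Tmap_def Let_def scalar_apply vec_eq_iff affine_lift_nth diag_matrix_apply)
  then show ?thesis
    using act_ch[of "scalar_matrix m" j x j e e k] assms by (simp add: scalar_apply affine_lift_nth)
qed

lemma Mk_chE:
  assumes "P \<in> Mk k" obtains e j x where "P = ch k e j x"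
  using assms unfolding Union_Mk_atlas[symmetric] Mk_atlas_eq by auto

lemma act_scalar_inverse:
  assumes "k \<ge> 1" "m \<noteq> 0" "P \<in> Mk k"
  shows "Mk_act k (scalar_matrix (inverse m)) (Mk_act k (scalar_matrix m) P) = P"
proof -
  obtain e j x where P: "P = ch k e j x" using assms(3) by (rule Mk_chE)
  have "diag_matrix (\<lambda>i. if i = j then inverse m powi sg k e else 1) *v (diag_matrix (\<lambda>i. if i = j then m powi sg k e else 1) *v x) = x"
    using assms(2) by (simp add: vec_eq_iff diag_matrix_apply power_int_inverse)
  then show ?thesis unfolding P using assms by (simp add: act_scalar_ch)
qed

lemma act_scalar_in: "k \<ge> 1 \<Longrightarrow> m \<noteq> 0 \<Longrightarrow> P \<in> Mk k \<Longrightarrow> Mk_act k (scalar_matrix m) P \<in> Mk k"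
  by (erule Mk_chE) (auto simp: act_scalar_ch Union_Mk_atlas[symmetric] Mk_atlas_eq)

text \<open>As the action is complex linear within each chart, its other coordinate expressions
  arise by composing with the coordinate changes, holomorphic by
  \<open>complex_atlas_Mk\<close>.\<close>

lemma holomorphic_scalar:
  assumes "k \<ge> 1" "m \<noteq> 0"
  shows "holomorphic_map (Mk_atlas k :: ('n::finite, _) atlas) (Mk_act k (scalar_matrix m))"
  unfolding holomorphic_map_def ball_atlas
proof (intro allI conjI impI)
  fix e e' and j j' :: 'n
  let ?c = "ch k e j" and ?d = "ch k e' j'"
  define D where "D = (\<lambda>x. diag_matrix (\<lambda>i. if i = j then m powi sg k e else 1) *v x :: complex^'n)"
  have c: "Mk_act k (scalar_matrix m) (?c x) = ?c (D x)" for x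
    unfolding D_def by (rule act_scalar_ch[OF assms])
  have hid: "open {x. ?c x \<in> range ?d}" "\<And>x. ?c x \<in> range ?d \<Longrightarrow> complex_differentiable_at (inv ?d \<circ> ?c) x"
  proof -
    have "\<forall>c\<in>Mk_atlas k. \<forall>d\<in>Mk_atlas k. open {x. c x \<in> range d} \<and>
        (\<forall>x. (c :: complex^'n \<Rightarrow> _) x \<in> range d \<longrightarrow> complex_differentiable_at (inv d \<circ> c) x)"
      using complex_atlas_Mk[of k, where 'n = 'n] by (simp add: complex_atlas_def holomorphic_map_def)
    from bspec[OF bspec[OF this ch_in_atlas[of k e j]] ch_in_atlas[of k e' j']]
    show "open {x. ?c x \<in> range ?d}" "\<And>x. ?c x \<in> range ?d \<Longrightarrow> complex_differentiable_at (inv ?d \<circ> ?c) x"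
      by (simp_all only:)
  qed
  have lin: "bounded_linear D" unfolding D_def
    by (intro linear_conv_bounded_linear[THEN iffD1] linearI)
       (simp_all add: vec_eq_iff diag_matrix_apply algebra_simps)
  have "open (D -` {x. ?c x \<in> range ?d})"
    by (intro open_vimage hid linear_continuous_on lin)
  then show "open {x. Mk_act k (scalar_matrix m) (?c x) \<in> range ?d}" by (simp add: c vimage_def)
  fix x assume "Mk_act k (scalar_matrix m) (?c x) \<in> range ?d"
  then obtain E where E: "((inv ?d \<circ> ?c) has_derivative E) (at (D x))" "\<And>a v. E (a *s v) = a *s E v"
    using hid(2)[of "D x"] unfolding c complex_differentiable_at_def by blast
  have "((\<lambda>x. (inv ?d \<circ> ?c) (D x)) has_derivative (\<lambda>v. E (D v))) (at x)"
    by (rule has_derivative_compose[OF bounded_linear_imp_has_derivative[OF lin] E(1)])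
  moreover have "inv ?d \<circ> Mk_act k (scalar_matrix m) \<circ> ?c = (\<lambda>x. (inv ?d \<circ> ?c) (D x))"
    by (simp add: fun_eq_iff c)
  moreover have "E (D (a *s v)) = a *s E (D v)" for a v by (simp add: D_def vec.scale E(2))
  ultimately show "complex_differentiable_at (inv ?d \<circ> Mk_act k (scalar_matrix m) \<circ> ?c) x"
    unfolding complex_differentiable_at_def by auto
qed

lemma automorphism_scalar:
  assumes "k \<ge> 1" "m \<noteq> 0"
  shows "automorphism (Mk k) (Mk_atlas k :: ('n::finite, _) atlas) (Mk_act k (scalar_matrix m))"
proof -
  let ?F = "Mk_act k (scalar_matrix m :: complex^'n^'n)" and ?G = "Mk_act k (scalar_matrix (inverse m) :: complex^'n^'n)"
  have im: "inverse m \<noteq> 0" using assms by simp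
  have bij: "bij_betw ?F (Mk k) (Mk k)"
    by (rule bij_betw_byWitness[where f' = ?G])
       (use act_scalar_inverse[OF assms] act_scalar_inverse[OF assms(1) im] act_scalar_in[OF assms] act_scalar_in[OF assms(1) im] in auto)
  have "inv_into (Mk k) ?F P = ?G P" if "P \<in> Mk k" for P
    by (rule inv_into_f_eq[OF bij_betw_imp_inj_on[OF bij]])
       (use that act_scalar_in[OF assms(1) im that] act_scalar_inverse[OF assms(1) im that] in auto)
  then have "inv_into (Mk k) ?F (c x) = ?G (c x)" if "c \<in> Mk_atlas k" for c x
    using that Union_Mk_atlas[of k] by blast
  then have "holomorphic_map (Mk_atlas k) (inv_into (Mk k) ?F) \<longleftrightarrow> holomorphic_map (Mk_atlas k) ?G"
    unfolding holomorphic_map_def by (simp add: o_def cong: ball_cong)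
  then show ?thesis unfolding automorphism_def using bij holomorphic_scalar[OF assms] holomorphic_scalar[OF assms(1) im] by blast
qed

lemma equivariant_scalar:
  assumes "m \<noteq> 0" shows "unitary_equivariant k (Mk_act k (scalar_matrix m :: complex^'n::finite^'n))"
  unfolding unitary_equivariant_def
proof (intro allI impI ballI)
  fix U :: "complex^'n^'n" and P :: "'n piece_point set"
  assume U: "unitary_matrix U" and "P \<in> Mk k"
  then obtain j z y where P: "P = Mk_point k j z y" "z $ j \<noteq> 0" by (auto simp: Mk_eq)
  have "U *v z \<noteq> 0"
  proof
    assume "U *v z = 0"
    then have "herm z z = 0" using herm_unitary[OF U, of z z] by (simp add: herm_def)
    then show False using P(2) by (auto simp: herm_zero)
  qed
  then obtain i where i: "(U *v z) $ i \<noteq> 0" by (auto simp: vec_eq_iff)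
  have "(scalar_matrix m *v (U *v z)) $ i \<noteq> 0" "(scalar_matrix m *v z) $ j \<noteq> 0"
    "(U *v (scalar_matrix m *v z)) $ i \<noteq> 0"
    using i P(2) assms by (simp_all add: scalar_apply vec.scale)
  then show "Mk_act k (scalar_matrix m) (Mk_act k U P) = Mk_act k U (Mk_act k (scalar_matrix m) P)"
    unfolding P(1) using i P(2) assms
    by (simp add: Mk_act_point scalar_apply vec.scale sphere_scale_scale mult.commute[of m] flip: power_mult_distrib)
qed

theorem theorem3:
  fixes k :: nat
  assumes "1 \<le> k" and "k \<le> CARD('n::finite) - 1"
  shows "(\<exists>g :: ('n, 'n piece_point set) tensor_field.
            kahler_ricci_soliton (Mk_atlas k) g \<and> unitary_invariant k g) \<and>
         (\<forall>g h :: ('n, 'n piece_point set) tensor_field.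
            kahler_ricci_soliton (Mk_atlas k) g \<and> unitary_invariant k g \<and>
            kahler_ricci_soliton (Mk_atlas k) h \<and> unitary_invariant k h \<longrightarrow>
            (\<exists>F. automorphism (Mk k) (Mk_atlas k) F \<and> unitary_equivariant k F \<and>
                 is_pullback (Mk_atlas k) F g h))"
proof (intro conjI allI impI)
  have kn: "k < CARD('n)" using assms by linarith
  show "\<exists>g :: ('n, 'n piece_point set) tensor_field. kahler_ricci_soliton (Mk_atlas k) g \<and> unitary_invariant k g"
  proof -
    obtain \<Phi> c \<epsilon> where "soliton_profile k CARD('n) \<Phi> c \<epsilon>" using profile_exists[OF assms(1) kn] by blast
    then interpret soliton_profile k "CARD('n)" \<Phi> c \<epsilon> .
    have "unitary_invariant k (metric :: ('n, 'n piece_point set) tensor_field)"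
      unfolding unitary_invariant_def using metric_pullback[OF similarity_unitary] by blast
    then show ?thesis using soliton[OF refl] by blast
  qed
  fix g h :: "('n, 'n piece_point set) tensor_field"
  assume gh: "kahler_ricci_soliton (Mk_atlas k) g \<and> unitary_invariant k g \<and>
            kahler_ricci_soliton (Mk_atlas k) h \<and> unitary_invariant k h"
  have "CARD('n) > 1" using assms kn by linarith
  then obtain j0 l0 :: 'n where jl: "l0 \<noteq> j0" by (metis is_singletonI' is_singleton_altdef less_irrefl UNIV_not_empty)
  have loc: "\<exists>f. invariant_soliton k g j0 l0 f" if "kahler_ricci_soliton (Mk_atlas k) g" "unitary_invariant k g"
    for g :: "('n, 'n piece_point set) tensor_field"
  proof -
    from that(1) obtain f :: "'n piece_point set \<Rightarrow> real" where f: "kahler_metric (Mk_atlas k) g"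
      "\<And>e j. smooth (f \<circ> ch k e j)"
      "\<And>e j x i l. ricci (g (ch k e j)) i l x - g (ch k e j) x $ i $ l = hess_mixed (\<lambda>u. complex_of_real (f (ch k e j u))) i l x"
      "\<And>e j x i l. hess_pure (g (ch k e j)) (\<lambda>u. complex_of_real (f (ch k e j u))) i l x = 0"
      unfolding kahler_ricci_soliton_def ball_atlas by blast
    have "invariant_soliton k g j0 l0 f"
      by unfold_locales (use assms f that(2) jl in \<open>auto simp: smooth_iff_smooth_on o_def\<close>)
    then show ?thesis by blast
  qed
  obtain f f' where ff: "invariant_soliton k g j0 l0 f" "invariant_soliton k h j0 l0 f'"
    using loc gh by blast
  interpret G: invariant_soliton k g j0 l0 f by (rule ff)
  interpret H: invariant_soliton k h j0 l0 f' by (rule ff)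
  obtain \<theta> where l: "\<theta> > 0" "\<And>r. r > 0 \<Longrightarrow> H.A True r = G.A True (\<theta> * r)"
      "\<And>r. r > 0 \<Longrightarrow> H.B True r = \<theta>\<^sup>2 * G.B True (\<theta> * r)"
    using solitons_rescaled[OF ff kn] by blast
  \<comment> \<open>A similarity of scale \<rho> multiplies w by \<open>\<rho> powi sg k e\<close>,
    whereas rescaling the radius by \<theta> multiplies it by the square of \<theta>; hence the k-th
    root.\<close>
  define \<rho> where "\<rho> = (\<theta>\<^sup>2) powr (1 / k)"
  have \<rho>: "\<rho> > 0" using l(1) by (simp add: \<rho>_def)
  have "\<rho> ^ k = \<rho> powr k" using \<rho> by (simp add: powr_realpow)
  then have \<rho>k: "\<rho> ^ k = \<theta>\<^sup>2" using l(1) assms by (simp add: \<rho>_def powr_powr)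
  have L: "\<rho> powi sg k True = \<theta>\<^sup>2" "\<rho> powi sg k False = 1 / \<theta>\<^sup>2"
    using \<rho>k by (simp_all add: sg_def power_int_minus divide_inverse)
  \<comment> \<open>\<open>solitons_rescaled\<close> speaks of the zero section charts and r > 0.
    Inversion carries it to the other section, with scale 1 / \<theta>; at r = 0 the values of B
    agree by continuity and those of A by \<open>A_zero\<close>.\<close>
  have AB: "H.A e r = G.A e (\<mu> * r) \<and> H.B e r = \<mu>\<^sup>2 * G.B e (\<mu> * r)"
    if "\<mu> = (if e then \<theta> else 1 / \<theta>)" "r \<ge> 0" for e r \<mu>
  proof -
    have pos: "H.A e r = G.A e (\<mu> * r) \<and> H.B e r = \<mu>\<^sup>2 * G.B e (\<mu> * r)" if r: "r > 0" for r
    proof (cases e)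
      case True
      then show ?thesis using l that \<open>\<mu> = _\<close> by simp
    next
      case False
      then have m: "\<mu> = 1 / \<theta>" using \<open>\<mu> = _\<close> by simp
      have "H.A False r = G.A False (r / \<theta>)"
        using H.A_opp[of "1 / r" True] G.A_opp[of "\<theta> / r" True] l r by simp
      moreover have "r ^ 4 * (\<theta>\<^sup>2 * H.B False r) = r ^ 4 * G.B False (r / \<theta>)"
        using H.B_opp[of "1 / r" True] G.B_opp[of "\<theta> / r" True] l(1) l(3)[of "1 / r"] r
        by (simp add: field_simps power2_eq_square eval_nat_numeral)
      then have "\<theta>\<^sup>2 * H.B False r = G.B False (r / \<theta>)" using r by simp
      ultimately show ?thesis using False l(1) by (simp add: m power_divide field_simps)
    qed
    show ?thesis
    proof (cases "r = 0")
      case True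
      have "(\<lambda>r. H.B e r - \<mu>\<^sup>2 * G.B e (\<mu> * r)) 0 = 0"
      proof (rule isCont_zero_limit)
        show "isCont (\<lambda>r. H.B e r - \<mu>\<^sup>2 * G.B e (\<mu> * r)) 0"
          by (intro continuous_intros H.cont_AB isCont_o2[of 0 "\<lambda>r. \<mu> * r" "G.B e"] G.cont_AB)
      qed (use pos in auto)
      then show ?thesis using True by (simp add: G.A_zero H.A_zero)
    qed (use pos that in auto)
  qed
  have sq: "\<theta> powr 2 = \<theta>\<^sup>2" using l(1) by (simp add: powr_numeral)
  have ab: "H.a e w = G.a e (\<rho> powi sg k e * w) \<and> H.b e w = \<rho> powi sg k e * G.b e (\<rho> powi sg k e * w)" if w: "w \<ge> 0" for e w
  proof -
    define \<mu> where "\<mu> = (if e then \<theta> else 1 / \<theta>)"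
    have m2: "\<mu>\<^sup>2 = \<rho> powi sg k e" using L by (simp add: \<mu>_def power_divide)
    have "(\<mu> * sqrt w)\<^sup>2 = \<rho> powi sg k e * w" using w by (simp add: power_mult_distrib m2)
    then show ?thesis using AB[OF \<mu>_def, of "sqrt w"] w by (simp add: H.A_def G.A_def H.B_def G.B_def m2)
  qed
  define m where "m = complex_of_real (sqrt \<rho>)"
  have m: "m \<noteq> 0" "(norm m)\<^sup>2 = \<rho>" using \<rho> by (simp_all add: m_def)
  have "is_pullback (Mk_atlas k) (Mk_act k (scalar_matrix m)) g h"
    by (rule radial_pullback[OF assms(1) similarity_scalar[OF m(1), unfolded m(2)] G.radial H.radial])
       (use G.opp ab in auto)
  then show "\<exists>F. automorphism (Mk k) (Mk_atlas k) F \<and> unitary_equivariant k F \<and> is_pullback (Mk_atlas k) F g h"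
    using automorphism_scalar[OF assms(1) m(1)] equivariant_scalar[OF m(1)] by blast
qed

end
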